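(* Given a time series $A$ (and its dissimilarity values), the square root DTW distance problem can be solved in $O(|A|^2\log^2|A|)$ time and $O(|A|^2)$ space.
   Context: A time series is a nonempty finite sequence; $|S|$ is the length of $S$, $S[i]$ its $i$-th element (1-indexed), $S[a:b]=S[a]\circ\cdots\circ S[b]$. For time series $X,Y$ built from elements of $A$, the dissimilarity of elements $A[i]$ and $A[j]$ is a given value $d(i,j)$; standing assumption: every dissimilarity value is an integer in $\{0,1,\dots,c\}$ where $c=O(1)$ is a constant independent of the lengths. An alignment of $A[i_\vdash:i_\dashv]$ and $A[j_\vdash:j_\dashv]$ is a sequence of index pairs $(i_1,j_1)\circ\cdots\circ(i_m,j_m)$ with $(i_1,j_1)=(i_\vdash,j_\vdash)$, $(i_m,j_m)=(i_\dashv,j_\dashv)$, and each step $(i_k,j_k)-(i_{k-1},j_{k-1})\in\{(1,1),(1,0),(0,1)\}$; its discrepancy is $\sum_k d(i_k,j_k)$, and the DTW distance is the minimum discrepancy over all alignments. The square root DTW distance problem: given $A$, find an index $i$ with $1\le i\le|A|-1$ minimizing the DTW distance between the prefix $A[1:i]$ and the suffix $A[i+1:|A|]$, and determine this minimum DTW distance. *)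

theory Defs
  imports Complex_Main "HOL-Library.Landau_Symbols"
begin

section \<open>Dynamic time warping\<close>

text \<open>All indices are 1-based. The dissimilarity of the elements at positions \<open>i\<close> and \<open>j\<close> of the
  time series is the given value \<open>d i j\<close>; no relation between different values of \<open>d\<close> (symmetry,
  triangle inequality, zero diagonal) is required. The contiguous part from position \<open>a\<close> to position
  \<open>b\<close> is represented by the pair \<open>(a, b)\<close>.\<close>

type_synonym dissim = "nat \<Rightarrow> nat \<Rightarrow> nat"

definition align_step :: "nat \<times> nat \<Rightarrow> nat \<times> nat \<Rightarrow> bool" where
  "align_step p q \<longleftrightarrow>
     q \<in> {(fst p + 1, snd p + 1), (fst p + 1, snd p), (fst p, snd p + 1)}"

definition alignment :: "nat \<times> nat \<Rightarrow> nat \<times> nat \<Rightarrow> (nat \<times> nat) list \<Rightarrow> bool" where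
  "alignment X Y ps \<longleftrightarrow> ps \<noteq> [] \<and> hd ps = (fst X, fst Y) \<and> last ps = (snd X, snd Y)
     \<and> successively align_step ps"

definition discrepancy :: "dissim \<Rightarrow> (nat \<times> nat) list \<Rightarrow> nat" where
  "discrepancy d ps = (\<Sum>(i, j)\<leftarrow>ps. d i j)"

text \<open>\<open>Inf\<close> on a nonempty set of natural numbers is its minimum, and two nonempty parts always have
  an alignment.\<close>

definition dtw :: "dissim \<Rightarrow> nat \<times> nat \<Rightarrow> nat \<times> nat \<Rightarrow> nat" where
  "dtw d X Y = Inf (discrepancy d ` {ps. alignment X Y ps})"

definition split_dtw :: "'a list \<Rightarrow> dissim \<Rightarrow> nat \<Rightarrow> nat" where
  "split_dtw A d i = dtw d (1, i) (i + 1, length A)"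

definition sqrt_dtw_solution :: "'a list \<Rightarrow> dissim \<Rightarrow> nat \<Rightarrow> nat \<Rightarrow> bool" where
  "sqrt_dtw_solution A d i v \<longleftrightarrow>
     is_arg_min (split_dtw A d) (\<lambda>k. 1 \<le> k \<and> k \<le> length A - 1) i \<and> v = split_dtw A d i"


section \<open>Word RAM\<close>

text \<open>Structured programs for a random access machine with registers and an indirectly addressed
  memory. A program mentions only finitely many registers, so these contribute \<open>O(1)\<close> to the space.\<close>

datatype binop = Add | Sub | Mul | Div | Mod | Less | Eq

datatype expr = Const nat | Reg nat | Load expr | Binop binop expr expr

datatype prog =
    Skip
  | Assign nat expr
  | Store expr expr
  | Seq prog prog
  | Cond expr prog prog
  | While expr prog

record ram_state =
  reg :: "nat \<Rightarrow> nat"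
  mem :: "nat \<Rightarrow> nat"

fun binop_val :: "binop \<Rightarrow> nat \<Rightarrow> nat \<Rightarrow> nat" where
  "binop_val Add x y = x + y"
| "binop_val Sub x y = x - y"
| "binop_val Mul x y = x * y"
| "binop_val Div x y = x div y"
| "binop_val Mod x y = x mod y"
| "binop_val Less x y = of_bool (x < y)"
| "binop_val Eq x y = of_bool (x = y)"

fun eval_expr :: "expr \<Rightarrow> ram_state \<Rightarrow> nat" where
  "eval_expr (Const k) s = k"
| "eval_expr (Reg r) s = reg s r"
| "eval_expr (Load a) s = mem s (eval_expr a s)"
| "eval_expr (Binop f x y) s = binop_val f (eval_expr x s) (eval_expr y s)"

fun expr_cost :: "expr \<Rightarrow> nat" where
  "expr_cost (Const k) = 1"
| "expr_cost (Reg r) = 1"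
| "expr_cost (Load a) = 1 + expr_cost a"
| "expr_cost (Binop f x y) = 1 + expr_cost x + expr_cost y"

text \<open>\<open>fits w m e s\<close>: in evaluating \<open>e\<close>, every intermediate value is a \<open>w\<close>-bit word and only memory
  cells with addresses below \<open>m\<close> are read.\<close>

fun fits :: "nat \<Rightarrow> nat \<Rightarrow> expr \<Rightarrow> ram_state \<Rightarrow> bool" where
  "fits w m (Const k) s \<longleftrightarrow> k < 2 ^ w"
| "fits w m (Reg r) s \<longleftrightarrow> reg s r < 2 ^ w"
| "fits w m (Load a) s \<longleftrightarrow>
     fits w m a s \<and> eval_expr a s < m \<and> mem s (eval_expr a s) < 2 ^ w"
| "fits w m (Binop f x y) s \<longleftrightarrow>
     fits w m x s \<and> fits w m y s \<and> binop_val f (eval_expr x s) (eval_expr y s) < 2 ^ w"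

text \<open>\<open>exec w m P s t s'\<close>: on word length \<open>w\<close> and \<open>m\<close> memory cells, \<open>P\<close> started in \<open>s\<close> terminates in
  \<open>s'\<close> after time \<open>t\<close>. A run that produces a value of more than \<open>w\<close> bits or accesses an address
  outside the memory has no derivation. Every evaluated operator and every executed command has
  unit cost.\<close>

inductive exec :: "nat \<Rightarrow> nat \<Rightarrow> prog \<Rightarrow> ram_state \<Rightarrow> nat \<Rightarrow> ram_state \<Rightarrow> bool"
  for w m :: nat where
  Skip: "exec w m Skip s 1 s"
| Assign: "fits w m e s \<Longrightarrow>
    exec w m (Assign r e) s (1 + expr_cost e) (s\<lparr>reg := (reg s)(r := eval_expr e s)\<rparr>)"
| Store: "fits w m a s \<Longrightarrow> fits w m e s \<Longrightarrow> eval_expr a s < m \<Longrightarrow>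
    exec w m (Store a e) s (1 + expr_cost a + expr_cost e)
      (s\<lparr>mem := (mem s)(eval_expr a s := eval_expr e s)\<rparr>)"
| Seq: "exec w m P s t s' \<Longrightarrow> exec w m Q s' t' s'' \<Longrightarrow> exec w m (Seq P Q) s (t + t') s''"
| CondTrue: "fits w m e s \<Longrightarrow> eval_expr e s \<noteq> 0 \<Longrightarrow> exec w m P s t s' \<Longrightarrow>
    exec w m (Cond e P Q) s (1 + expr_cost e + t) s'"
| CondFalse: "fits w m e s \<Longrightarrow> eval_expr e s = 0 \<Longrightarrow> exec w m Q s t s' \<Longrightarrow>
    exec w m (Cond e P Q) s (1 + expr_cost e + t) s'"
| WhileFalse: "fits w m e s \<Longrightarrow> eval_expr e s = 0 \<Longrightarrow>
    exec w m (While e P) s (1 + expr_cost e) s"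
| WhileTrue: "fits w m e s \<Longrightarrow> eval_expr e s \<noteq> 0 \<Longrightarrow> exec w m P s t s' \<Longrightarrow>
    exec w m (While e P) s' t' s'' \<Longrightarrow>
    exec w m (While e P) s (1 + expr_cost e + t + t') s''"

inductive_cases exec_SkipE: "exec w m Skip s t s'"
inductive_cases exec_AssignE: "exec w m (Assign r e) s t s'"
inductive_cases exec_StoreE: "exec w m (Store a e) s t s'"
inductive_cases exec_SeqE: "exec w m (Seq P Q) s t s'"
inductive_cases exec_CondE: "exec w m (Cond e P Q) s t s'"
inductive_cases exec_WhileE: "exec w m (While e P) s t s'"

lemma exec_deterministic:
  assumes "exec w m P s t s'" and "exec w m P s u s''"
  shows "t = u \<and> s' = s''"
  using assms
proof (induction arbitrary: u s'' rule: exec.induct)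
  case Skip
  then show ?case by (elim exec_SkipE) simp
next
  case Assign
  from Assign.prems show ?case by (elim exec_AssignE) simp
next
  case Store
  from Store.prems show ?case by (elim exec_StoreE) simp
next
  case Seq
  from Seq.prems show ?case by (elim exec_SeqE) (auto dest!: Seq.IH)
next
  case CondTrue
  from CondTrue.prems show ?case by (elim exec_CondE) (use CondTrue.hyps(1,2) in \<open>auto dest!: CondTrue.IH\<close>)
next
  case CondFalse
  from CondFalse.prems show ?case by (elim exec_CondE) (use CondFalse.hyps(1,2) in \<open>auto dest!: CondFalse.IH\<close>)
next
  case WhileFalse
  from WhileFalse.prems show ?case by (rule exec_WhileE) (use WhileFalse.hyps in auto)
next
  case WhileTrue
  from WhileTrue.prems show ?case by (rule exec_WhileE) (use WhileTrue.hyps(1,2) in \<open>auto dest!: WhileTrue.IH\<close>)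
qed

text \<open>Initially register 0 holds the length \<open>n\<close> of the time series, the first \<open>n\<^sup>2\<close> memory cells hold
  the dissimilarities in row-major order, and everything else is zero. The input thus counts towards
  the space.\<close>

definition ram_input :: "'a list \<Rightarrow> dissim \<Rightarrow> ram_state" where
  "ram_input A d = (let n = length A in
     \<lparr>reg = (\<lambda>r. if r = 0 then n else 0),
      mem = (\<lambda>a. if a < n * n then d (a div n + 1) (a mod n + 1) else 0)\<rparr>)"

text \<open>The results are the index in register 0 and the distance in register 1.\<close>

definition computes_sqrt_dtw ::
  "nat \<Rightarrow> nat \<Rightarrow> nat \<Rightarrow> prog \<Rightarrow> 'a list \<Rightarrow> dissim \<Rightarrow> bool" where
  "computes_sqrt_dtw w m time P A d \<longleftrightarrow>
     (\<exists>t s. exec w m P (ram_input A d) t s \<and> t \<le> time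
        \<and> sqrt_dtw_solution A d (reg s 0) (reg s 1))"

end

theory Submission
  imports Defs "HOL-Library.Extended_Nat"
begin

text \<open>The alignments between all prefixes and their complementary suffixes are paths in one grid with
  vertices \<open>(x, y)\<close>. Cutting this grid along the antidiagonals \<open>x + y = t\<close> turns it into a layered
  graph in which the costs of walks through \<open>h\<close> layers form a band matrix of width \<open>2 h + 1\<close>, and
  these matrices are Monge, because the edges of the graph do not cross. With free edges added outside
  of the relevant triangle, all wanted distances are entries of one matrix that spans
  \<open>T = O(n)\<close> layers. This matrix is computed by repeatedly merging neighbouring blocks: the blocks
  of height \<open>h\<close> have \<open>O(n\<^sup>2)\<close> entries altogether, and the (min,+) product of two band matrices takes
  \<open>O(n h)\<close> steps, because by the Monge property the minimizing middle position for the entry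
  \<open>(p, q + 1)\<close> may be searched between those for \<open>(p, q)\<close> and \<open>(p + 1, q + 1)\<close>, so that the search
  intervals telescope. There are \<open>log T\<close> rounds of merging, and only the blocks of two successive
  rounds are stored.\<close>

section \<open>Min-plus products and walks in the layered grid\<close>

text \<open>An alignment of the prefix of length \<open>i\<close> with the remaining suffix runs
  from \<open>(1, i + 1)\<close> to \<open>(i, n)\<close>, and monotonicity keeps it in
  \<open>x <= i < y\<close>. So all splits live in the one triangle \<open>x < y\<close> and differ
  only in their endpoints; treating each split on its own would take cubic time. The obstacle:
  nothing is known about the dissimilarities except the bound \<open>c\<close>, but the search needs
  Monge inequalities. They must come from planarity alone. A diagonal step would skip an
  antidiagonal, so it is halved. Then two edges between the same layers can cross only as
  \<open>p\<close> to \<open>p + 2\<close> and \<open>p + 1\<close> to \<open>p + 1\<close>; one of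
  them starts at a midpoint and costs \<open>W > c\<close>, at least as much as the two half
  diagonals that replace the pair. Forbidden edges cost the finite \<open>W\<close> so that every
  entry of the band is a number and terms can be cancelled in the exchange argument.
  \<open>W = (c + 1) * n\<close> is large enough because an L-shaped alignment has fewer than
  \<open>n\<close> cells, each of cost at most \<open>c\<close>. The number \<open>T\<close> of
  layers is a power of two so that blocks always pair up.\<close>

definition mprod :: "(nat \<Rightarrow> nat \<Rightarrow> enat) \<Rightarrow> (nat \<Rightarrow> nat \<Rightarrow> enat) \<Rightarrow> nat \<Rightarrow> nat \<Rightarrow> enat" where
  "mprod A B p q = (INF k. A p k + B k q)"

text \<open>\<open>enat\<close> is well-ordered, so even an infimum over all middle positions is a
  minimum; no range for the middle position has to be carried through the algebra.\<close>

lemma INF_enat_attained: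
  fixes f :: "'b \<Rightarrow> enat"
  shows "\<exists>k. (INF k. f k) = f k"
proof -
  have "Inf (range f) \<in> range f"
    unfolding Inf_enat_def by (simp, rule LeastI[of _ "f undefined"], simp)
  then show ?thesis by auto
qed

lemma enat_add_finite_iff: "a + b < (\<infinity>::enat) \<longleftrightarrow> a < \<infinity> \<and> b < \<infinity>"
  by (cases a; cases b) auto

lemma mprod_attained: "\<exists>k. mprod A B p q = A p k + B k q"
  unfolding mprod_def by (rule INF_enat_attained)

lemma mprod_le: "mprod A B p q \<le> A p k + B k q"
  unfolding mprod_def by (rule INF_lower) simp

lemma mprod_assoc: "mprod (mprod A B) C = mprod A (mprod B C)"
proof (intro ext antisym)
  fix p q
  obtain k where k: "mprod (mprod A B) C p q = mprod A B p k + C k q" using mprod_attained by blast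
  obtain j where j: "mprod A B p k = A p j + B j k" using mprod_attained by blast
  have "mprod A (mprod B C) p q \<le> A p j + mprod B C j q" by (rule mprod_le)
  also have "\<dots> \<le> A p j + (B j k + C k q)" by (intro add_left_mono mprod_le)
  finally show "mprod A (mprod B C) p q \<le> mprod (mprod A B) C p q" by (simp add: k j add.assoc)
next
  fix p q
  obtain k where k: "mprod A (mprod B C) p q = A p k + mprod B C k q" using mprod_attained by blast
  obtain j where j: "mprod B C k q = B k j + C j q" using mprod_attained by blast
  have "mprod (mprod A B) C p q \<le> mprod A B p j + C j q" by (rule mprod_le)
  also have "\<dots> \<le> (A p k + B k j) + C j q" by (intro add_right_mono mprod_le)
  finally show "mprod (mprod A B) C p q \<le> mprod A (mprod B C) p q" by (simp add: k j add.assoc)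
qed

section \<open>Monge matrices and their closure under the min-plus product\<close>

definition monge :: "(nat \<Rightarrow> nat \<Rightarrow> enat) \<Rightarrow> bool" where
  "monge A \<longleftrightarrow> (\<forall>p p' q q'. p < p' \<longrightarrow> q < q' \<longrightarrow> A p q + A p' q' \<le> A p q' + A p' q)"

text \<open>Exchange argument on the minimizing middles \<open>k\<close> for \<open>(p, q')\<close>
  and \<open>j\<close> for \<open>(p', q)\<close>. If \<open>k < j\<close>, both rows keep their
  middles and the second factor is uncrossed; if \<open>j < k\<close>, the middles are swapped and
  the first factor is uncrossed; if \<open>k = j\<close>, the halves are merely recombined.\<close>

lemma monge_mprod:
  assumes "monge A" "monge B"
  shows "monge (mprod A B)"
  unfolding monge_def
proof (intro allI impI)
  fix p p' q q' :: nat
  assume lt: "p < p'" "q < q'"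
  obtain k where k: "mprod A B p q' = A p k + B k q'" using mprod_attained by blast
  obtain j where j: "mprod A B p' q = A p' j + B j q" using mprod_attained by blast
  consider "k < j" | "k = j" | "j < k" by linarith
  then show "mprod A B p q + mprod A B p' q' \<le> mprod A B p q' + mprod A B p' q"
  proof cases
    case 1
    have "mprod A B p q + mprod A B p' q' \<le> (A p k + B k q) + (A p' j + B j q')"
      by (intro add_mono mprod_le)
    also have "\<dots> = (A p k + A p' j) + (B k q + B j q')" by (simp add: ac_simps)
    also have "\<dots> \<le> (A p k + A p' j) + (B k q' + B j q)"
      using assms(2) 1 lt unfolding monge_def by (intro add_left_mono) blast
    finally show ?thesis by (simp add: k j ac_simps)
  next
    case 2
    have "mprod A B p q + mprod A B p' q' \<le> (A p k + B k q) + (A p' k + B k q')"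
      by (intro add_mono mprod_le)
    then show ?thesis by (simp add: k j 2 ac_simps)
  next
    case 3
    have "mprod A B p q + mprod A B p' q' \<le> (A p j + B j q) + (A p' k + B k q')"
      by (intro add_mono mprod_le)
    also have "\<dots> = (A p j + A p' k) + (B j q + B k q')" by (simp add: ac_simps)
    also have "\<dots> \<le> (A p k + A p' j) + (B j q + B k q')"
      using assms(1) 3 lt unfolding monge_def by (intro add_right_mono) blast
    finally show ?thesis by (simp add: k j ac_simps)
  qed
qed

text \<open>The cell \<open>(x, y)\<close> is placed at position \<open>2 * y\<close> of layer \<open>x + y\<close>; odd positions are the
  midpoints of diagonal steps. From position \<open>u\<close> of one layer, the next layer is entered at position
  \<open>u\<close> (step \<open>(1, 0)\<close>), \<open>u + 2\<close> (step \<open>(0, 1)\<close>) or \<open>u + 1\<close> (half of the step \<open>(1, 1)\<close>). The cells in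
  use are those with \<open>1 \<le> x < y \<le> n\<close>. Outside of them, half diagonal steps are free and the other
  steps have the prohibitive cost \<open>W\<close>, so that the walk from position \<open>i\<close> of layer 0 is forced to
  enter the grid in \<open>(1, i + 1)\<close>, and the walk to position \<open>T + n - i\<close> of a late layer \<open>T\<close> is forced
  to leave it from \<open>(i, n)\<close>.\<close>

locale grid =
  fixes n W c :: nat and d :: dissim
  assumes d_le: "\<And>i j. 1 \<le> i \<Longrightarrow> i \<le> n \<Longrightarrow> 1 \<le> j \<Longrightarrow> j \<le> n \<Longrightarrow> d i j \<le> c"
    and W_def: "W = (c + 1) * n" and n2: "2 \<le> n"
begin

text \<open>An edge pays for the cell \<open>(x, y)\<close> that it enters, where \<open>e\<close>
  is the increase of the position. The \<open>of_bool\<close> terms demand that the source of a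
  \<open>(1, 0)\<close> or \<open>(0, 1)\<close> step lies in the triangle too. A diagonal may start
  in column \<open>x = 0\<close>, which is how a walk gets into \<open>(1, i + 1)\<close>. Left of
  the grid, truncated subtraction yields \<open>x = 0\<close>, and the test fails.\<close>

definition base :: "nat \<Rightarrow> nat \<Rightarrow> nat \<Rightarrow> nat" where
  "base t u e = (let y = (u + e) div 2; x = t + 1 - y in
     if even (u + e) \<and> of_bool (e = 0) < x \<and> x + of_bool (e = 2) < y \<and> y < n + 1 then d x y
     else if e = 1 then 0 else W)"

definition edge :: "nat \<Rightarrow> nat \<Rightarrow> nat \<Rightarrow> enat" where
  "edge t u v = (if u \<le> v \<and> v \<le> u + 2 then enat (base t u (v - u)) else \<infinity>)"

fun walk_dist :: "nat \<Rightarrow> nat \<Rightarrow> nat \<Rightarrow> nat \<Rightarrow> enat" where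
  "walk_dist t 0 = (\<lambda>p q. if p = q then 0 else \<infinity>)"
| "walk_dist t (Suc h) = mprod (edge t) (walk_dist (Suc t) h)"

lemma c_less_W: "c < W"
proof -
  have "(c + 1) * 1 \<le> (c + 1) * n" using n2 by (intro mult_left_mono) auto
  then show ?thesis by (simp add: W_def)
qed

lemma base_le: "base t u e \<le> W"
proof -
  have "d x y \<le> W" if "0 < x" "x < y" "y \<le> n" for x y
    using d_le[of x y] c_less_W that by simp
  then show ?thesis unfolding base_def Let_def by (auto simp: of_bool_def split: if_splits)
qed

lemma base_diag_le: "base t u 1 \<le> c"
  unfolding base_def Let_def by (auto intro!: d_le)

lemma base_diag_even: "even u \<Longrightarrow> base t u 1 = 0"
  unfolding base_def Let_def by auto

lemma base_odd: "odd u \<Longrightarrow> e = 0 \<or> e = 2 \<Longrightarrow> base t u e = W"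
  unfolding base_def Let_def by auto

text \<open>The right-hand side is finite only for the crossing pair \<open>p\<close> to
  \<open>p + 2\<close> and \<open>p + 1\<close> to \<open>p + 1\<close>. One of the two starts at an
  odd position and costs \<open>W\<close>. After uncrossing, the half diagonal from the even
  position is free and the other one costs at most \<open>c\<close>.\<close>

lemma monge_edge: "monge (edge t)"
  unfolding monge_def
proof (intro allI impI)
  fix p p' q q' :: nat
  assume lt: "p < p'" "q < q'"
  show "edge t p q + edge t p' q' \<le> edge t p q' + edge t p' q"
  proof (cases "p \<le> q' \<and> q' \<le> p + 2 \<and> p' \<le> q \<and> q \<le> p' + 2")
    case True
    then have eq: "p' = Suc p" "q = Suc p" "q' = Suc (Suc p)" using lt by linarith+
    have "base t p 1 + base t (Suc p) 1 \<le> base t p 2 + base t (Suc p) 0"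
    proof (cases "even p")
      case True
      then have "base t p 1 = 0" "base t (Suc p) 0 = W" using base_diag_even[of p t] by (auto simp: base_odd)
      then show ?thesis using base_diag_le[of t "Suc p"] c_less_W by linarith
    next
      case False
      then have "base t (Suc p) 1 = 0" "base t p 2 = W" using base_diag_even[of "Suc p"] by (auto simp: base_odd)
      then show ?thesis using base_diag_le[of t p] c_less_W by linarith
    qed
    then show ?thesis by (simp add: edge_def eq Suc_diff_le numeral_2_eq_2)
  next
    case False
    then show ?thesis unfolding edge_def by auto
  qed
qed

section \<open>Band structure and Monge property of the walk costs\<close>

lemma dist_finite_iff: "walk_dist t h p q < \<infinity> \<longleftrightarrow> p \<le> q \<and> q \<le> p + 2 * h"
proof (induction h arbitrary: t p)
  case (Suc h)
  show ?case
  proof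
    assume a: "walk_dist t (Suc h) p q < \<infinity>"
    obtain k where "walk_dist t (Suc h) p q = edge t p k + walk_dist (Suc t) h k q"
      using mprod_attained by (metis walk_dist.simps(2))
    with a have "edge t p k < \<infinity>" "walk_dist (Suc t) h k q < \<infinity>" by (metis enat_add_finite_iff)+
    with Suc.IH show "p \<le> q \<and> q \<le> p + 2 * Suc h" unfolding edge_def by (fastforce split: if_splits)
  next
    assume a: "p \<le> q \<and> q \<le> p + 2 * Suc h"
    \<comment> \<open>Covering as much of the displacement as possible at once leaves at most
      \<open>2 * h\<close> for the remaining layers.\<close>
    define k where "k = (if q \<le> p + 2 then q else p + 2)"
    have k: "p \<le> k" "k \<le> p + 2" "k \<le> q" "q \<le> k + 2 * h" using a unfolding k_def by auto
    have "walk_dist t (Suc h) p q \<le> edge t p k + walk_dist (Suc t) h k q" by (simp add: mprod_le)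
    also have "\<dots> < \<infinity>" using k Suc.IH[of "Suc t" k] unfolding edge_def by (auto)
    finally show "walk_dist t (Suc h) p q < \<infinity>" .
  qed
qed (auto simp: zero_enat_def)

lemma monge_dist: "monge (walk_dist t h)"
proof (induction h arbitrary: t)
  case 0
  show ?case unfolding monge_def by auto
next
  case (Suc h)
  show ?case by (simp add: monge_mprod monge_edge Suc.IH)
qed

lemma dist_add: "walk_dist t (a + b) = mprod (walk_dist t a) (walk_dist (t + a) b)"
proof (induction a arbitrary: t)
  case 0
  show ?case
  proof (intro ext antisym)
    fix p q
    obtain k where k: "mprod (walk_dist t 0) (walk_dist (t + 0) b) p q = walk_dist t 0 p k + walk_dist (t + 0) b k q"
      using mprod_attained by blast
    show "walk_dist t (0 + b) p q \<le> mprod (walk_dist t 0) (walk_dist (t + 0) b) p q"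
      unfolding k by (cases "p = k") simp_all
    show "mprod (walk_dist t 0) (walk_dist (t + 0) b) p q \<le> walk_dist t (0 + b) p q"
      using mprod_le[of "walk_dist t 0" "walk_dist t b" p q p] by simp
  qed
next
  case (Suc a)
  have "walk_dist t (Suc a + b) = mprod (edge t) (mprod (walk_dist (Suc t) a) (walk_dist (t + Suc a) b))"
    using Suc.IH[of "Suc t"] by simp
  then show ?case by (simp add: mprod_assoc)
qed

lemma dist_le: "p \<le> q \<Longrightarrow> q \<le> p + 2 * h \<Longrightarrow> walk_dist t h p q \<le> enat (h * W)"
proof (induction h arbitrary: t p)
  case (Suc h)
  define k where "k = (if q \<le> p + 2 then q else p + 2)"
  have k: "p \<le> k" "k \<le> p + 2" "k \<le> q" "q \<le> k + 2 * h" using Suc.prems unfolding k_def by auto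
  have "walk_dist t (Suc h) p q \<le> edge t p k + walk_dist (Suc t) h k q" by (simp add: mprod_le)
  also have "\<dots> \<le> enat W + enat (h * W)"
    using k Suc.IH[of k "Suc t"] base_le unfolding edge_def by (intro add_mono) auto
  finally show ?case by simp
qed (auto simp: zero_enat_def)

text \<open>Inside the band this is the number kept in memory; outside it \<open>the_enat\<close> is
  applied to infinity and carries no information.\<close>

definition val :: "nat \<Rightarrow> nat \<Rightarrow> nat \<Rightarrow> nat \<Rightarrow> nat" where
  "val t h p q = the_enat (walk_dist t h p q)"

lemma dist_eq_val: "p \<le> q \<Longrightarrow> q \<le> p + 2 * h \<Longrightarrow> walk_dist t h p q = enat (val t h p q)"
  using dist_finite_iff[of t h p q] unfolding val_def by auto

lemma val_le: "p \<le> q \<Longrightarrow> q \<le> p + 2 * h \<Longrightarrow> val t h p q \<le> h * W"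
  using dist_le[of p q h t] dist_eq_val[of p q h t] by simp

lemma val_one: "e \<le> 2 \<Longrightarrow> val t 1 p (p + e) = base t p e"
proof -
  assume e: "e \<le> 2"
  have "walk_dist t 1 p (p + e) = edge t p (p + e)"
  proof (rule antisym)
    show "walk_dist t 1 p (p + e) \<le> edge t p (p + e)"
      using mprod_le[of "edge t" "walk_dist (Suc t) 0" p "p + e" "p + e"] by simp
    obtain k where "walk_dist t 1 p (p + e) = edge t p k + walk_dist (Suc t) 0 k (p + e)"
      using mprod_attained by (metis walk_dist.simps(2) One_nat_def)
    then show "edge t p (p + e) \<le> walk_dist t 1 p (p + e)" by (cases "k = p + e") auto
  qed
  then show ?thesis using e by (simp add: val_def edge_def)
qed

text \<open>The two outer hypotheses \<open>k' <= q\<close> and \<open>q' <= k + 2 * h\<close> place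
  all four entries in the band, so the inequality descends to natural numbers, where terms
  cancel.\<close>

lemma val_monge:
  assumes "k < k'" "q < q'" "k' \<le> q" "q' \<le> k + 2 * h"
  shows "val t h k q + val t h k' q' \<le> val t h k q' + val t h k' q"
proof -
  have "walk_dist t h k q + walk_dist t h k' q' \<le> walk_dist t h k q' + walk_dist t h k' q"
    using monge_dist assms unfolding monge_def by blast
  then show ?thesis using assms by (simp add: dist_eq_val)
qed

section \<open>Minimizing middle positions\<close>

definition adm :: "nat \<Rightarrow> nat \<Rightarrow> nat \<Rightarrow> nat \<Rightarrow> bool" where
  "adm h p q k \<longleftrightarrow> p \<le> k \<and> k \<le> p + 2 * h \<and> k \<le> q \<and> q \<le> k + 2 * h"

definition cost :: "nat \<Rightarrow> nat \<Rightarrow> nat \<Rightarrow> nat \<Rightarrow> nat \<Rightarrow> nat" where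
  "cost t h p q k = val t h p k + val (t + h) h k q"

definition opt :: "nat \<Rightarrow> nat \<Rightarrow> nat \<Rightarrow> nat \<Rightarrow> nat \<Rightarrow> bool" where
  "opt t h p q k \<longleftrightarrow> adm h p q k \<and> (\<forall>k'. adm h p q k' \<longrightarrow> cost t h p q k \<le> cost t h p q k')"

lemma cost_le: "adm h p q k \<Longrightarrow> cost t h p q k \<le> 2 * h * W"
  using val_le[of p k h t] val_le[of k q h "t + h"] unfolding adm_def cost_def by auto

lemma opt_exists:
  assumes "p \<le> q" "q \<le> p + 4 * h"
  shows "\<exists>k. opt t h p q k"
proof -
  \<comment> \<open>Any admissible middle will do; this one is as far right as possible.\<close>
  define k0 where "k0 = (if q \<le> p + 2 * h then q else p + 2 * h)"
  have "adm h p q k0" using assms unfolding k0_def adm_def by auto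
  then obtain k where "is_arg_min (cost t h p q) (adm h p q) k"
    by (metis arg_min_nat_le arg_min_natI is_arg_min_linorder)
  then show ?thesis by (auto simp: opt_def is_arg_min_linorder)
qed

text \<open>The product ranges over all middles, but outside the admissible ones a summand is
  infinite, and the product itself is finite in the band of height \<open>2 * h\<close>.\<close>

lemma opt_val:
  assumes "opt t h p q k"
  shows "val t (2 * h) p q = cost t h p q k"
proof -
  have k: "adm h p q k" using assms by (simp add: opt_def)
  then have pq: "p \<le> q" "q \<le> p + 2 * (2 * h)" by (auto simp: adm_def)
  have D: "walk_dist t (2 * h) p q = mprod (walk_dist t h) (walk_dist (t + h) h) p q"
    using dist_add[of t h h] by (simp add: mult_2)
  have C: "walk_dist t h p j + walk_dist (t + h) h j q = enat (cost t h p q j)" if "adm h p q j" for j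
    using that by (simp add: adm_def cost_def dist_eq_val)
  have "walk_dist t (2 * h) p q = enat (cost t h p q k)"
  proof (rule antisym)
    show "walk_dist t (2 * h) p q \<le> enat (cost t h p q k)"
      using mprod_le[of "walk_dist t h" "walk_dist (t + h) h" p q k] C[OF k] by (simp add: D)
    obtain j where j: "walk_dist t (2 * h) p q = walk_dist t h p j + walk_dist (t + h) h j q"
      using mprod_attained D by metis
    moreover have "walk_dist t (2 * h) p q < \<infinity>" using pq dist_finite_iff by blast
    ultimately have "walk_dist t h p j < \<infinity>" "walk_dist (t + h) h j q < \<infinity>" by (metis enat_add_finite_iff)+
    then have "adm h p q j" unfolding dist_finite_iff adm_def by blast
    then show "enat (cost t h p q k) \<le> walk_dist t (2 * h) p q"
      using assms C j by (simp add: opt_def)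
  qed
  then show ?thesis by (simp add: val_def)
qed

text \<open>Let \<open>k\<close> be any minimizer for \<open>(p, q + 1)\<close>. If
  \<open>k < a\<close>, then \<open>a\<close> is no worse: it beats \<open>k\<close> for
  \<open>(p, q)\<close>, and the Monge inequality of the second factor carries this from column
  \<open>q\<close> to \<open>q + 1\<close>. If \<open>b < k\<close>, the same argument with the
  first factor moves the comparison from row \<open>p + 1\<close> to \<open>p\<close>. Admissibility
  of the replacement follows from that of \<open>k\<close> and of \<open>a\<close> or
  \<open>b\<close>.\<close>

lemma opt_between:
  assumes l: "opt t h p q a" and r: "opt t h (p + 1) (q + 1) b" and "a \<le> b" "q + 1 \<le> p + 4 * h"
  shows "\<exists>k. a \<le> k \<and> k \<le> b \<and> opt t h p (q + 1) k"
proof -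
  have la: "adm h p q a" and ra: "adm h (p + 1) (q + 1) b" using l r by (auto simp: opt_def)
  then have "p \<le> q" by (auto simp: adm_def)
  with assms(4) obtain k where k: "opt t h p (q + 1) k" using opt_exists[of p "q + 1" h t] by auto
  then have ka: "adm h p (q + 1) k" by (simp add: opt_def)
  have optI: "opt t h p (q + 1) j"
    if "adm h p (q + 1) j" "cost t h p (q + 1) j \<le> cost t h p (q + 1) k" for j
    using k that unfolding opt_def by (meson order_trans)
  consider "k < a" | "b < k" | "a \<le> k \<and> k \<le> b" by linarith
  then show ?thesis
  proof cases
    case 1
    have "cost t h p q a \<le> cost t h p q k"
      using l 1 ka la by (auto simp: opt_def adm_def)
    moreover have "val (t + h) h k q + val (t + h) h a (q + 1) \<le> val (t + h) h k (q + 1) + val (t + h) h a q"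
      using 1 ka la by (intro val_monge) (auto simp: adm_def)
    ultimately have "cost t h p (q + 1) a \<le> cost t h p (q + 1) k" by (simp add: cost_def)
    moreover have "adm h p (q + 1) a" using 1 ka la by (auto simp: adm_def)
    ultimately show ?thesis using optI assms(3) by blast
  next
    case 2
    have "cost t h (p + 1) (q + 1) b \<le> cost t h (p + 1) (q + 1) k"
      using r 2 ka ra by (auto simp: opt_def adm_def)
    moreover have "val t h p b + val t h (p + 1) k \<le> val t h p k + val t h (p + 1) b"
      using 2 ka ra by (intro val_monge) (auto simp: adm_def)
    ultimately have "cost t h p (q + 1) b \<le> cost t h p (q + 1) k" by (simp add: cost_def)
    moreover have "adm h p (q + 1) b" using 2 ka ra by (auto simp: adm_def)
    ultimately show ?thesis using optI assms(3) by blast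
  qed (use k in blast)
qed


section \<open>Walks of cost below \<open>W\<close> correspond to alignments\<close>

declare walk_dist.simps(2) [simp del]

lemma dist_step_le: "e \<le> 2 \<Longrightarrow> walk_dist t (Suc k) u q \<le> enat (base t u e) + walk_dist (Suc t) k (u + e) q"
  using mprod_le[of "edge t" "walk_dist (Suc t) k" u q "u + e"] by (simp add: edge_def walk_dist.simps)

lemma dist_step_cases:
  assumes "walk_dist t (Suc k) u q = enat v"
  obtains e v' where "e \<le> 2" "walk_dist (Suc t) k (u + e) q = enat v'" "v = base t u e + v'"
proof -
  obtain j where j: "enat v = edge t u j + walk_dist (Suc t) k j q"
    using mprod_attained assms by (metis walk_dist.simps(2))
  then have j': "u \<le> j" "j \<le> u + 2" by (auto simp: edge_def split: if_splits)
  with j obtain v' where "walk_dist (Suc t) k j q = enat v'" "v = base t u (j - u) + v'"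
    by (cases "walk_dist (Suc t) k j q") (auto simp: edge_def)
  then show thesis using that[of "j - u" v'] j' by auto
qed

lemma dist_free_le:
  assumes "\<And>j. j < k \<Longrightarrow> base (t + j) (u + j) 1 = 0"
  shows "walk_dist t (k + m) u q \<le> walk_dist (t + k) m (u + k) q"
  using assms
proof (induction k arbitrary: t u)
  case (Suc k)
  have "walk_dist (Suc t) (k + m) (Suc u) q \<le> walk_dist (Suc t + k) m (Suc u + k) q"
    using Suc.prems[of "Suc _"] by (intro Suc.IH) auto
  moreover have "walk_dist t (Suc (k + m)) u q \<le> walk_dist (Suc t) (k + m) (Suc u) q"
    using dist_step_le[of 1 t "k + m" u q] Suc.prems[of 0] by (simp add: zero_enat_def[symmetric])
  ultimately show ?case by simp
qed simp

text \<open>A walk cheaper than \<open>W\<close> uses no edge of cost \<open>W\<close>, so only the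
  half diagonals remain. These may still cost something, hence \<open>v'\<close> at most
  \<open>v\<close> instead of equality.\<close>

lemma dist_forced:
  assumes "\<And>j. j < k \<Longrightarrow> base (t + j) (u + j) 0 = W \<and> base (t + j) (u + j) 2 = W"
    and "walk_dist t (k + m) u q = enat v" "v < W"
  shows "\<exists>v'\<le>v. walk_dist (t + k) m (u + k) q = enat v'"
  using assms
proof (induction k arbitrary: t u v)
  case (Suc k)
  from Suc.prems(2) obtain e v' where e: "e \<le> 2" "walk_dist (Suc t) (k + m) (u + e) q = enat v'"
    "v = base t u e + v'"
    using dist_step_cases by (metis add_Suc)
  have "e \<noteq> 0" "e \<noteq> 2" using Suc.prems(1)[of 0] Suc.prems(3) e(3) by (auto intro!: gr0I)
  then have "e = 1" using e(1) by simp
  have "\<exists>w\<le>v'. walk_dist (Suc t + k) m (Suc u + k) q = enat w"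
    using Suc.prems(1)[of "Suc _"] Suc.prems(3) e \<open>e = 1\<close> by (intro Suc.IH) auto
  then show ?case using e(3) by (auto intro: le_trans)
qed auto

text \<open>Position \<open>u\<close> of layer \<open>t\<close> belongs to
  \<open>x = t - u div 2\<close>; so \<open>2 * t <= u\<close> describes the region with
  \<open>x <= 0\<close>, in front of the grid.\<close>

lemma base_before:
  assumes "2 * t \<le> u"
  shows "base t u 0 = W" "base t u 2 = W" "2 * t < u \<Longrightarrow> base t u 1 = 0"
  using assms unfolding base_def Let_def by (auto elim!: evenE)

lemma base_after:
  assumes "2 * n \<le> u"
  shows "2 * n < u \<Longrightarrow> base t u 0 = W" "2 * n < u \<Longrightarrow> base t u 2 = W" "base t u 1 = 0"
  using assms unfolding base_def Let_def by (auto elim!: evenE)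

lemma base_cell:
  shows "1 \<le> x \<Longrightarrow> x + 1 < y \<Longrightarrow> y \<le> n \<Longrightarrow> base (x + y) (2 * y) 0 = d (x + 1) y"
    and "1 \<le> x \<Longrightarrow> x < y \<Longrightarrow> y + 1 \<le> n \<Longrightarrow> base (x + y) (2 * y) 2 = d x (y + 1)"
    and "x < y \<Longrightarrow> y + 1 \<le> n \<Longrightarrow> base (Suc (x + y)) (Suc (2 * y)) 1 = d (x + 1) (y + 1)"
  unfolding base_def Let_def by auto

lemma base_cell_forbidden:
  shows "1 \<le> x \<Longrightarrow> y \<le> x + 1 \<or> n < y \<Longrightarrow> base (x + y) (2 * y) 0 = W"
    and "1 \<le> x \<Longrightarrow> y \<le> x \<or> n < y + 1 \<Longrightarrow> base (x + y) (2 * y) 2 = W"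
  unfolding base_def Let_def by auto

lemma align_step_mono:
  "successively align_step ps \<Longrightarrow> ps \<noteq> [] \<Longrightarrow>
    fst (hd ps) \<le> fst (last ps) \<and> snd (hd ps) \<le> snd (last ps)"
  by (induction ps rule: induct_list012) (auto simp: align_step_def)

text \<open>Edges pay for the cell they enter, so the first cell must be added separately. Every
  cell of the path satisfies \<open>x <= i < y\<close>, hence none of its steps is forbidden. Behind
  \<open>(i, n)\<close> the free half diagonals fill the remaining layers and end at position
  \<open>2 * n + (T - (i + n)) = T + n - i\<close>.\<close>

lemma dist_le_discrepancy:
  assumes "i < n" "2 * n \<le> T"
  shows "successively align_step ps \<Longrightarrow> ps \<noteq> [] \<Longrightarrow> hd ps = (x, y) \<Longrightarrow> last ps = (i, n) \<Longrightarrow>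
    1 \<le> x \<Longrightarrow> i < y \<Longrightarrow>
    walk_dist (x + y) (T - (x + y)) (2 * y) (T + n - i) + enat (d x y) \<le> enat (discrepancy d ps)"
proof (induction ps arbitrary: x y rule: induct_list012)
  case 1
  then show ?case by simp
next
  case (2 a)
  then have xy: "x = i" "y = n" by auto
  have "walk_dist (i + n) ((T - (i + n)) + 0) (2 * n) (T + n - i)
      \<le> walk_dist (i + n + (T - (i + n))) 0 (2 * n + (T - (i + n))) (T + n - i)"
    using base_after(3) by (intro dist_free_le) auto
  also have "\<dots> = 0" using assms by simp
  finally show ?case using 2 xy by (simp add: discrepancy_def)
next
  case (3 a b ps)
  obtain x' y' where b: "b = (x', y')" by (cases b)
  have a: "a = (x, y)" using 3 by simp
  have le: "x' \<le> i" "y' \<le> n" using align_step_mono[of "b # ps"] 3 b by auto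
  have step: "(x', y') = (x + 1, y + 1) \<or> (x', y') = (x + 1, y) \<or> (x', y') = (x, y + 1)"
    using 3 a b by (auto simp: align_step_def)
  have IH: "walk_dist (x' + y') (T - (x' + y')) (2 * y') (T + n - i) + enat (d x' y') \<le> enat (discrepancy d (b # ps))"
    using 3 b step by (intro "3.IH"(2)) auto
  have ineq: "x < y" "x' + y' < T" "1 \<le> x" using le step 3 assms by auto
  have D: "walk_dist (x + y) (T - (x + y)) (2 * y) (T + n - i) \<le> walk_dist (x' + y') (T - (x' + y')) (2 * y') (T + n - i) + enat (d x' y')"
    using step
  proof (elim disjE)
    assume s: "(x', y') = (x + 1, y + 1)"
    then have T: "T - (x + y) = Suc (Suc (T - (x' + y')))" using ineq by auto
    have "walk_dist (x + y) (T - (x + y)) (2 * y) (T + n - i)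
        \<le> walk_dist (Suc (x + y)) (Suc (T - (x' + y'))) (Suc (2 * y)) (T + n - i)"
      using dist_step_le[of 1 "x + y" "Suc (T - (x' + y'))" "2 * y"] base_diag_even[of "2 * y" "x + y"] T
      by (simp add: zero_enat_def[symmetric])
    also have "\<dots> \<le> enat (d x' y') + walk_dist (x' + y') (T - (x' + y')) (2 * y') (T + n - i)"
      using dist_step_le[of 1 "Suc (x + y)" "T - (x' + y')" "Suc (2 * y)"] base_cell(3)[of x y] s le ineq
      by simp
    finally show ?thesis by (simp add: add.commute)
  next
    assume s: "(x', y') = (x + 1, y)"
    then have T: "T - (x + y) = Suc (T - (x' + y'))" using ineq by auto
    show ?thesis
      using dist_step_le[of 0 "x + y" "T - (x' + y')" "2 * y"] base_cell(1)[of x y] s le ineq T 3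
      by (simp add: add.commute)
  next
    assume s: "(x', y') = (x, y + 1)"
    then have T: "T - (x + y) = Suc (T - (x' + y'))" using ineq by auto
    show ?thesis
      using dist_step_le[of 2 "x + y" "T - (x' + y')" "2 * y"] base_cell(2)[of x y] s le ineq T 3
      by (simp add: add.commute)
  qed
  have "walk_dist (x + y) (T - (x + y)) (2 * y) (T + n - i) + enat (d x y)
      \<le> enat (discrepancy d (b # ps)) + enat (d x y)"
    using D IH by (intro add_right_mono) auto
  also have "\<dots> = enat (discrepancy d (a # b # ps))" by (simp add: a discrepancy_def)
  finally show ?case .
qed

text \<open>Since \<open>v < W\<close>, each step of the walk is either a permitted grid step or a
  half diagonal. Strong induction is used because a full diagonal consumes two layers.\<close>

lemma discrepancy_le_dist:
  assumes "i < n" "2 * n \<le> T"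
  shows "walk_dist (x + y) k (2 * y) (T + n - i) = enat v \<Longrightarrow> v < W \<Longrightarrow> x + y + k = T \<Longrightarrow>
    1 \<le> x \<Longrightarrow> x < y \<Longrightarrow> y \<le> n \<Longrightarrow>
    \<exists>ps. ps \<noteq> [] \<and> hd ps = (x, y) \<and> last ps = (i, n) \<and> successively align_step ps
      \<and> discrepancy d ps \<le> v + d x y"
proof (induction k arbitrary: x y v rule: less_induct)
  case (less k)
  have "k \<noteq> 0" using less.prems assms by auto
  then obtain k' where k: "k = Suc k'" by (cases k) auto
  have extend: ?case
    if IH: "\<exists>ps. ps \<noteq> [] \<and> hd ps = (x', y') \<and> last ps = (i, n) \<and> successively align_step ps
      \<and> discrepancy d ps \<le> v' + d x' y'" and s: "align_step (x, y) (x', y')" and v: "v = d x' y' + v'"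
    for x' y' v'
  proof -
    from IH obtain ps where ps: "ps \<noteq> []" "hd ps = (x', y')" "last ps = (i, n)"
      "successively align_step ps" "discrepancy d ps \<le> v' + d x' y'" by blast
    then show ?thesis using s v
      by (intro exI[of _ "(x, y) # ps"]) (auto simp: successively_Cons discrepancy_def)
  qed
  from less.prems(1) obtain e v' where e: "e \<le> 2" "walk_dist (Suc (x + y)) k' (2 * y + e) (T + n - i) = enat v'"
    "v = base (x + y) (2 * y) e + v'" unfolding k by (rule dist_step_cases)
  consider "e = 0" | "e = 1" | "e = 2" using e(1) by linarith
  then show ?case
  proof cases
    case 1
    have ok: "x + 1 < y"
      using base_cell_forbidden(1)[of x y] less.prems e 1 by (cases "x + 1 < y") auto
    show ?thesis
      using e 1 ok less.prems k base_cell(1)[of x y]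
      by (intro extend[of "x + 1" y v'] less.IH[of k']) (auto simp: align_step_def)
  next
    case 3
    have ok: "y + 1 \<le> n"
      using base_cell_forbidden(2)[of x y] less.prems e 3 by (cases "y + 1 \<le> n") auto
    show ?thesis
      using e 3 ok less.prems k base_cell(2)[of x y]
      by (intro extend[of x "y + 1" v'] less.IH[of k']) (auto simp: align_step_def)
  next
    case 2
    show ?thesis
    proof (cases "y = n")
      case True
      \<comment> \<open>A half diagonal out of row \<open>y = n\<close> leaves the grid for good:
        only free half diagonals follow, so the final position reveals the column of the exit, and
        it must be \<open>i\<close>.\<close>
      have "\<exists>w\<le>v'. walk_dist (Suc (x + y) + k') 0 (Suc (2 * n) + k') (T + n - i) = enat w"
        using base_after(1,2) e 2 True less.prems by (intro dist_forced) auto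
      then have "Suc (2 * n) + k' = T + n - i" by (auto split: if_splits)
      then have "x = i" using True less.prems k assms by auto
      then show ?thesis using True
        by (intro exI[of _ "[(i, n)]"]) (auto simp: discrepancy_def)
    next
      case False
      then have y: "y + 1 \<le> n" using less.prems by simp
      have "k' \<noteq> 0" using less.prems assms y k by auto
      then obtain k'' where k': "k' = Suc k''" by (cases k') auto
      have v: "v = v'" using e 2 base_diag_even[of "2 * y" "x + y"] by simp
      from e(2) obtain e' v'' where e': "e' \<le> 2"
        "walk_dist (Suc (Suc (x + y))) k'' (2 * y + 1 + e') (T + n - i) = enat v''"
        "v' = base (Suc (x + y)) (2 * y + 1) e' + v''" unfolding k' 2 by (rule dist_step_cases)
      \<comment> \<open>At a midpoint the position is odd, so every continuation but the second half
        of the diagonal costs \<open>W\<close>.\<close>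
      have "e' \<noteq> 0" "e' \<noteq> 2"
        using base_odd[of "2 * y + 1" _ "Suc (x + y)"] e' less.prems v by (auto intro!: gr0I)
      then have "e' = 1" using e' by simp
      then show ?thesis
        using e' y v less.prems k k' base_cell(3)[of x y]
        by (intro extend[of "x + 1" "y + 1" v''] less.IH[of k'']) (auto simp: align_step_def)
    qed
  qed
qed

text \<open>Going first in the \<open>x\<close> direction and then in the \<open>y\<close> direction
  visits \<open>m + 1\<close> cells. This is the witness showing that \<open>W\<close> exceeds every
  wanted distance.\<close>

lemma cheap_alignment:
  assumes "i \<le> n"
  shows "1 \<le> x \<Longrightarrow> 1 \<le> y \<Longrightarrow> x \<le> i \<Longrightarrow> y \<le> n \<Longrightarrow> m = (i - x) + (n - y) \<Longrightarrow>
    \<exists>ps. ps \<noteq> [] \<and> hd ps = (x, y) \<and> last ps = (i, n) \<and> successively align_step ps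
      \<and> discrepancy d ps \<le> c * (m + 1)"
proof (induction m arbitrary: x y)
  case 0
  then show ?case using assms d_le[of x y]
    by (intro exI[of _ "[(x, y)]"]) (auto simp: discrepancy_def)
next
  case (Suc m)
  define z where "z = (if x < i then (x + 1, y) else (x, y + 1))"
  have "\<exists>ps. ps \<noteq> [] \<and> hd ps = z \<and> last ps = (i, n) \<and> successively align_step ps
      \<and> discrepancy d ps \<le> c * (m + 1)"
  proof (cases "x < i")
    case True
    then have m: "m = (i - (x + 1)) + (n - y)" using Suc.prems by linarith
    show ?thesis using Suc.IH[OF _ _ _ _ m] Suc.prems(1-4) True by (simp add: z_def)
  next
    case False
    then have m: "m = (i - x) + (n - (y + 1))" "y < n" using Suc.prems by linarith+
    show ?thesis using Suc.IH[OF _ _ _ _ m(1)] Suc.prems(1-4) m(2) False by (simp add: z_def)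
  qed
  then obtain ps where ps: "ps \<noteq> []" "hd ps = z" "last ps = (i, n)" "successively align_step ps"
    "discrepancy d ps \<le> c * (m + 1)" by blast
  moreover have "align_step (x, y) z" by (auto simp: z_def align_step_def)
  moreover have "d x y \<le> c" using Suc.prems assms by (intro d_le) auto
  ultimately show ?case
    by (intro exI[of _ "(x, y) # ps"]) (auto simp: successively_Cons discrepancy_def)
qed

text \<open>Every alignment extends to a walk of the same cost. Conversely the cheap alignment
  pushes the optimal walk below \<open>W\<close>, which makes it decompose into forced parts around
  an alignment.\<close>

lemma dtw_eq_val:
  assumes i: "1 \<le> i" "i < n" and T: "2 * n \<le> T"
  shows "dtw d (1, i) (i + 1, n) = val 0 T i (T + n - i)"
proof -
  let ?S = "discrepancy d ` {ps. alignment (1, i) (i + 1, n) ps}"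
  let ?q = "T + n - i"
  have first: "base (i + 1) (2 * i + 1) 1 = d 1 (i + 1)" using i by (auto simp: base_def)
  \<comment> \<open>From position \<open>i\<close> of layer 0, \<open>i + 1\<close> half diagonals
    pass the virtual cell \<open>(0, i)\<close> and reach the midpoint before
    \<open>(1, i + 1)\<close>. The next edge pays for this cell and arrives in layer
    \<open>i + 2\<close>.\<close>
  have T': "T = Suc i + Suc (T - (i + 2))" using i T by simp
  have upper: "walk_dist 0 T i ?q \<le> enat s" if "s \<in> ?S" for s
  proof -
    from that obtain ps where ps: "alignment (1, i) (i + 1, n) ps" "s = discrepancy d ps" by auto
    have free: "base (0 + j) (i + j) 1 = 0" if "j < Suc i" for j
      using base_before(3)[of j "i + j"] base_diag_even[of "2 * i" i] that
      by (cases "j = i") (auto simp: mult_2)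
    have "walk_dist 0 T i ?q \<le> walk_dist (0 + Suc i) (Suc (T - (i + 2))) (i + Suc i) ?q"
      using dist_free_le[of "Suc i" 0 i "Suc (T - (i + 2))" ?q] free T' by metis
    also have "\<dots> \<le> enat (d 1 (i + 1)) + walk_dist (1 + (i + 1)) (T - (1 + (i + 1))) (2 * (i + 1)) ?q"
      using dist_step_le[of 1 "Suc i" "T - (i + 2)" "2 * i + 1" ?q] first
      by (simp add: mult_2)
    also have "\<dots> \<le> enat s"
      using ps dist_le_discrepancy[OF i(2) T, of ps 1 "i + 1"]
      by (auto simp: alignment_def add.commute)
    finally show ?thesis .
  qed
  obtain ps where "alignment (1, i) (i + 1, n) ps" "discrepancy d ps \<le> c * ((i - 1) + (n - (i + 1)) + 1)"
    using cheap_alignment[of i 1 "i + 1" "(i - 1) + (n - (i + 1))"] i by (auto simp: alignment_def)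
  moreover have "c * ((i - 1) + (n - (i + 1)) + 1) \<le> c * n"
    using i by (intro mult_left_mono) auto
  ultimately have ps: "discrepancy d ps \<in> ?S" "discrepancy d ps < W"
    using n2 by (auto simp: W_def)
  have v: "walk_dist 0 T i ?q = enat (val 0 T i ?q)" using i T by (intro dist_eq_val) auto
  with upper[OF ps(1)] ps(2) have vW: "val 0 T i ?q < W" by simp
  have forced: "base (0 + j) (i + j) 0 = W \<and> base (0 + j) (i + j) 2 = W" if "j < Suc (Suc i)" for j
    using that base_before[of j "i + j"] base_odd[of "i + j" _ j]
    by (cases "j = Suc i") (auto simp: mult_2)
  have "\<exists>s\<in>?S. s \<le> val 0 T i ?q"
  proof -
    have "\<exists>w\<le>val 0 T i ?q. walk_dist (0 + Suc i) (Suc (T - (i + 2))) (i + Suc i) ?q = enat w"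
      using dist_forced[of "Suc i" 0 i "Suc (T - (i + 2))" ?q] v vW T' forced by (metis add_0 less_SucI)
    then obtain w where w: "w \<le> val 0 T i ?q"
      "walk_dist (Suc i) (Suc (T - (i + 2))) (2 * i + 1) ?q = enat w" by (auto simp: mult_2)
    from w(2) obtain e v' where e: "e \<le> 2" "walk_dist (Suc (Suc i)) (T - (i + 2)) (2 * i + 1 + e) ?q = enat v'"
      "w = base (Suc i) (2 * i + 1) e + v'" by (rule dist_step_cases)
    have "e \<noteq> 0" "e \<noteq> 2" using base_odd[of "2 * i + 1" _ "Suc i"] e w vW by (auto intro!: gr0I)
    then have "e = 1" using e by simp
    have "\<exists>ps. ps \<noteq> [] \<and> hd ps = (1, i + 1) \<and> last ps = (i, n) \<and> successively align_step ps
      \<and> discrepancy d ps \<le> v' + d 1 (i + 1)"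
      using e \<open>e = 1\<close> w vW T' i by (intro discrepancy_le_dist[OF i(2) T, of _ _ "T - (i + 2)"]) auto
    then obtain ps where "alignment (1, i) (i + 1, n) ps" "discrepancy d ps \<le> v' + d 1 (i + 1)"
      by (auto simp: alignment_def)
    moreover have "w = d 1 (i + 1) + v'" using e \<open>e = 1\<close> first by simp
    ultimately show ?thesis using w by (intro bexI[of _ "discrepancy d ps"]) auto
  qed
  then obtain s where s: "s \<in> ?S" "s \<le> val 0 T i ?q" by blast
  have "Inf ?S \<le> s" using s by (intro wellorder_Inf_le1)
  moreover have "Inf ?S \<in> ?S" using s(1) by (rule wellorder_InfI)
  then have "val 0 T i ?q \<le> Inf ?S" using upper v by (metis enat_ord_simps(1))
  ultimately show ?thesis using s unfolding dtw_def by simp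
qed

end

section \<open>Weakest preconditions with elapsed time\<close>

text \<open>\<open>t\<close> is the time already spent, so that loop invariants can bound the time
  of the run so far. The existence of a run covers termination and all word and address
  checks.\<close>

definition wp :: "nat \<Rightarrow> nat \<Rightarrow> prog \<Rightarrow> (nat \<Rightarrow> ram_state \<Rightarrow> bool) \<Rightarrow> nat \<Rightarrow> ram_state \<Rightarrow> bool" where
  "wp w m P Q t s \<longleftrightarrow> (\<exists>t' s'. exec w m P s t' s' \<and> Q (t + t') s')"

text \<open>Determinism makes the given run the only one, which turns the precondition into an
  equivalence usable for rewriting.\<close>

lemma wp_exec: "exec w m P s t' s' \<Longrightarrow> wp w m P Q t s \<longleftrightarrow> Q (t + t') s'"
  unfolding wp_def using exec_deterministic by blast

lemma wp_Skip: "wp w m Skip Q t s \<longleftrightarrow> Q (t + 1) s"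
  by (intro wp_exec exec.Skip)

lemma wp_Assign: "wp w m (Assign r e) Q t s \<longleftrightarrow>
    fits w m e s \<and> Q (t + (1 + expr_cost e)) (s\<lparr>reg := (reg s)(r := eval_expr e s)\<rparr>)"
proof (cases "fits w m e s")
  case True
  then show ?thesis using wp_exec[OF exec.Assign] by blast
next
  case False
  then have "\<not> exec w m (Assign r e) s t' s'" for t' s' by (blast elim: exec_AssignE)
  with False show ?thesis unfolding wp_def by blast
qed

lemma wp_Store: "wp w m (Store a e) Q t s \<longleftrightarrow>
    fits w m a s \<and> fits w m e s \<and> eval_expr a s < m \<and>
    Q (t + (1 + expr_cost a + expr_cost e)) (s\<lparr>mem := (mem s)(eval_expr a s := eval_expr e s)\<rparr>)"
proof (cases "fits w m a s \<and> fits w m e s \<and> eval_expr a s < m")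
  case True
  then show ?thesis using wp_exec[OF exec.Store] by blast
next
  case False
  then have "\<not> exec w m (Store a e) s t' s'" for t' s' by (blast elim: exec_StoreE)
  with False show ?thesis unfolding wp_def by blast
qed

lemma wp_Seq: "wp w m (Seq P P') Q t s \<longleftrightarrow> wp w m P (wp w m P' Q) t s"
proof
  assume "wp w m (Seq P P') Q t s"
  then show "wp w m P (wp w m P' Q) t s" unfolding wp_def by (elim exE conjE exec_SeqE) (auto simp: add.assoc)
next
  assume "wp w m P (wp w m P' Q) t s"
  then show "wp w m (Seq P P') Q t s" unfolding wp_def add.assoc by (blast intro: exec.Seq)
qed

lemma wp_prefix:
  assumes "\<And>t' s'. exec w m P s t' s' \<longleftrightarrow> G \<and> (\<exists>t''. t' = a + t'' \<and> exec w m P' s t'' s')"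
  shows "wp w m P Q t s \<longleftrightarrow> G \<and> wp w m P' Q (t + a) s"
  unfolding wp_def assms by (metis add.assoc)

lemma wp_Cond: "wp w m (Cond e P P') Q t s \<longleftrightarrow>
    fits w m e s \<and> (if eval_expr e s \<noteq> 0 then wp w m P Q (t + (1 + expr_cost e)) s
      else wp w m P' Q (t + (1 + expr_cost e)) s)"
proof (cases "eval_expr e s = 0")
  case True
  have "exec w m (Cond e P P') s t' s' \<longleftrightarrow>
      fits w m e s \<and> (\<exists>t''. t' = 1 + expr_cost e + t'' \<and> exec w m P' s t'' s')" for t' s'
    by (intro iffI; (elim exec_CondE)?) (use True exec.CondFalse in auto)
  from wp_prefix[OF this] show ?thesis using True by simp
next
  case False
  have "exec w m (Cond e P P') s t' s' \<longleftrightarrow>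
      fits w m e s \<and> (\<exists>t''. t' = 1 + expr_cost e + t'' \<and> exec w m P s t'' s')" for t' s'
    by (intro iffI; (elim exec_CondE)?) (use False exec.CondTrue in auto)
  from wp_prefix[OF this] show ?thesis using False by simp
qed

lemmas wp_simps = wp_Skip wp_Assign wp_Store wp_Seq wp_Cond

lemma wp_mono: "wp w m P Q t s \<Longrightarrow> (\<And>t' s'. Q t' s' \<Longrightarrow> Q' t' s') \<Longrightarrow> wp w m P Q' t s"
  unfolding wp_def by blast

text \<open>The time bound is part of the invariant \<open>I\<close>; the measure is only needed for
  termination.\<close>

lemma wp_While:
  assumes "I t s"
    and "\<And>t s. I t s \<Longrightarrow> fits w m e s"
    and "\<And>t s. I t s \<Longrightarrow> eval_expr e s = 0 \<Longrightarrow> Q (t + (1 + expr_cost e)) s"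
    and "\<And>t s. I t s \<Longrightarrow> eval_expr e s \<noteq> 0 \<Longrightarrow>
      wp w m P (\<lambda>t' s'. I t' s' \<and> \<mu> s' < (\<mu> s :: nat)) (t + (1 + expr_cost e)) s"
  shows "wp w m (While e P) Q t s"
  using assms(1)
proof (induction "\<mu> s" arbitrary: t s rule: less_induct)
  case less
  show ?case
  proof (cases "eval_expr e s = 0")
    case True
    then show ?thesis
      using assms(2)[OF less.prems] assms(3)[OF less.prems True] unfolding wp_def
      by (blast intro: exec.WhileFalse)
  next
    case False
    obtain t' s' where body: "exec w m P s t' s'" "I (t + (1 + expr_cost e) + t') s'" "\<mu> s' < \<mu> s"
      using assms(4)[OF less.prems False] unfolding wp_def by blast
    obtain t'' s'' where rest: "exec w m (While e P) s' t'' s''" "Q (t + (1 + expr_cost e) + t' + t'') s''"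
      using less.hyps[OF body(3,2)] unfolding wp_def by blast
    have "exec w m (While e P) s (1 + expr_cost e + t' + t'') s''"
      using assms(2)[OF less.prems] False body(1) rest(1) by (rule exec.WhileTrue)
    then show ?thesis using rest(2) unfolding wp_def add.assoc by blast
  qed
qed

section \<open>Searching the middle positions\<close>

text \<open>The registers are numbered by the nesting depth of the loops that write them, so that the frame
  condition of a loop has the form \<open>\<forall>r<k. reg s' r = reg s r\<close>. From register 9 on they serve
  other purposes before and after the merging rounds.\<close>

abbreviation "rN \<equiv> Reg 0"
abbreviation "rInf \<equiv> Reg 1"
abbreviation "rT \<equiv> Reg 2"
abbreviation "rY \<equiv> Reg 3"
abbreviation "rW \<equiv> Reg 4"
abbreviation "rH \<equiv> Reg 5"
abbreviation "rSrc \<equiv> Reg 6"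
abbreviation "rDst \<equiv> Reg 7"
abbreviation "rKB \<equiv> Reg 8"
abbreviation "rS \<equiv> Reg 9"
abbreviation "rA \<equiv> Reg 10"
abbreviation "rB \<equiv> Reg 11"
abbreviation "rR \<equiv> Reg 12"
abbreviation "rE \<equiv> Reg 13"
abbreviation "rP \<equiv> Reg 14"
abbreviation "rQ \<equiv> Reg 15"
abbreviation "rHi \<equiv> Reg 16"
abbreviation "rK \<equiv> Reg 17"
abbreviation "rBest \<equiv> Reg 18"
abbreviation "rArg \<equiv> Reg 19"
abbreviation "rV \<equiv> Reg 20"

abbreviation "plus_e \<equiv> Binop Add"
abbreviation "minus_e \<equiv> Binop Sub"
abbreviation "times_e \<equiv> Binop Mul"
abbreviation "less_e \<equiv> Binop Less"

abbreviation entry_e :: "expr \<Rightarrow> expr \<Rightarrow> expr \<Rightarrow> expr" where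
  "entry_e b r p \<equiv> plus_e (plus_e b (times_e r rY)) p"

text \<open>\<open>fits\<close> asks for a bound on every intermediate value, so all parts of an
  address computation have to be bounded along with the address.\<close>

lemma address_less:
  assumes "b + x * y + p < (v::nat)" "0 < y"
  shows "b < v" "x < v" "x * y < v" "b + x * y < v" "p < v"
proof -
  have "x * 1 \<le> x * y" using assms(2) by (intro mult_left_mono) auto
  then show "b < v" "x < v" "x * y < v" "b + x * y < v" "p < v" using assms(1) by linarith+
qed

text \<open>Tables are stored by diagonals: entry \<open>(p, k)\<close> of the first factor is in
  row \<open>ra + (k - p)\<close>, column \<open>p\<close>, and entry \<open>(k, q)\<close> of the
  second in row \<open>rb + (q - k)\<close>, column \<open>k\<close>.\<close>

definition scan_body :: prog where
  "scan_body =
     Seq (Assign 20 (plus_e (Load (entry_e rSrc (plus_e rA (minus_e rK rP)) rP))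
                            (Load (entry_e rSrc (plus_e rB (minus_e rQ rK)) rK))))
    (Seq (Cond (less_e rV rBest) (Seq (Assign 18 rV) (Assign 19 rK)) Skip)
         (Assign 17 (plus_e rK (Const 1))))"

definition scan :: prog where
  "scan = While (less_e rK rHi) scan_body"

text \<open>Register 18 starts above all candidates, so the first one is always accepted and
  register 19 ends up in the interval. The time is proportional to the length of the interval, as
  the telescoping argument requires.\<close>

lemma scan_correct:
  fixes Y src ra rb p q lo hi :: nat
  assumes m: "m \<le> 2 ^ w" and Y: "0 < Y" "Y < 2 ^ w"
    and regs: "reg s0 3 = Y" "reg s0 6 = src" "reg s0 10 = ra" "reg s0 11 = rb" "reg s0 14 = p"
      "reg s0 15 = q" "reg s0 16 = hi" "reg s0 17 = lo"
    and best: "reg s0 18 < 2 ^ w" "reg s0 19 < 2 ^ w" and hi: "lo < hi" "hi < 2 ^ w" "q < 2 ^ w"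
    and f: "\<And>k. lo \<le> k \<Longrightarrow> k < hi \<Longrightarrow>
      p \<le> k \<and> k \<le> q \<and> src + (ra + (k - p)) * Y + p < m \<and> src + (rb + (q - k)) * Y + k < m \<and>
      mem s0 (src + (ra + (k - p)) * Y + p) + mem s0 (src + (rb + (q - k)) * Y + k) = f k \<and>
      f k < reg s0 18"
  shows "wp w m scan (\<lambda>t s. t \<le> t0 + 60 * (hi - lo) + 10 \<and> mem s = mem s0 \<and> (\<forall>r<17. reg s r = reg s0 r)
      \<and> lo \<le> reg s 19 \<and> reg s 19 < hi \<and> reg s 18 = f (reg s 19)
      \<and> (\<forall>k. lo \<le> k \<longrightarrow> k < hi \<longrightarrow> f (reg s 19) \<le> f k)) t0 s0"
proof -
  define I :: "nat \<Rightarrow> ram_state \<Rightarrow> bool" where "I t s \<longleftrightarrow> (\<exists>k. reg s 17 = k \<and> lo \<le> k \<and> k \<le> hi \<and> t \<le> t0 + 60 * (k - lo)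
      \<and> mem s = mem s0 \<and> (\<forall>r<17. reg s r = reg s0 r)
      \<and> (if k = lo then reg s 18 = reg s0 18 \<and> reg s 19 = reg s0 19
         else lo \<le> reg s 19 \<and> reg s 19 < k \<and> reg s 18 = f (reg s 19) \<and>
           (\<forall>j. lo \<le> j \<longrightarrow> j < k \<longrightarrow> f (reg s 19) \<le> f j)))" for t s
  show ?thesis unfolding scan_def
  proof (rule wp_While[where I = I and \<mu> = "\<lambda>s. hi - reg s 17"])
    show "I t0 s0" using regs hi by (simp add: I_def)
  next
    fix t s assume "I t s"
    then show "fits w m (less_e rK rHi) s"
      using regs hi by (auto simp: I_def of_bool_def)
  next
    fix t s assume "I t s" "eval_expr (less_e rK rHi) s = 0"
    then show "t + (1 + expr_cost (less_e rK rHi)) \<le> t0 + 60 * (hi - lo) + 10 \<and> mem s = mem s0 \<and> (\<forall>r<17. reg s r = reg s0 r)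
      \<and> lo \<le> reg s 19 \<and> reg s 19 < hi \<and> reg s 18 = f (reg s 19)
      \<and> (\<forall>k. lo \<le> k \<longrightarrow> k < hi \<longrightarrow> f (reg s 19) \<le> f k)"
      using regs hi by (auto simp: I_def)
  next
    fix t s assume I: "I t s" and c: "eval_expr (less_e rK rHi) s \<noteq> 0"
    define k where "k = reg s 17"
    have R: "reg s 3 = Y" "reg s 6 = src" "reg s 10 = ra" "reg s 11 = rb" "reg s 14 = p"
      "reg s 15 = q" "reg s 16 = hi" "reg s 17 = k" "mem s = mem s0" and frame: "\<forall>r<17. reg s r = reg s0 r"
      using I regs by (auto simp: I_def k_def)
    have k: "lo \<le> k" "k < hi" "t \<le> t0 + 60 * (k - lo)" using I c R by (auto simp: I_def)
    note fk = f[OF k(1,2)]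
    have B: "reg s 18 < 2 ^ w" "reg s 18 \<le> reg s0 18" using I best f[of "reg s 19"] k
      by (auto simp: I_def k_def split: if_splits)
    have a: "src + (ra + (k - p)) * Y + p < 2 ^ w" "src + (rb + (q - k)) * Y + k < 2 ^ w"
      using fk m by auto
    have g: "src + (ra + (k - p)) * Y + p < m" "src + (rb + (q - k)) * Y + k < m"
      "mem s0 (src + (ra + (k - p)) * Y + p) + mem s0 (src + (rb + (q - k)) * Y + k) = f k"
      "mem s0 (src + (ra + (k - p)) * Y + p) < 2 ^ w" "mem s0 (src + (rb + (q - k)) * Y + k) < 2 ^ w"
      "f k < 2 ^ w" "k < 2 ^ w" "k + 1 < 2 ^ w" "k - p < 2 ^ w" "q - k < 2 ^ w" "ra < 2 ^ w" "rb < 2 ^ w" "1 < (2::nat) ^ w"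
      using fk best k hi address_less(2)[OF a(1) Y(1)] address_less(2)[OF a(2) Y(1)] by linarith+
    note ad = a g address_less[OF a(1) Y(1)] address_less[OF a(2) Y(1)]
    have ob: "wp w m scan_body (\<lambda>t' s'. t' \<le> t + 60 \<and> mem s' = mem s0 \<and> (\<forall>r<17. reg s' r = reg s r)
       \<and> reg s' 17 = k + 1 \<and> reg s' 18 = min (f k) (reg s 18) \<and> reg s' 19 = (if f k < reg s 18 then k else reg s 19))
       (t + (1 + expr_cost (less_e rK rHi))) s"
      unfolding scan_body_def using B(1) best hi Y(2) ad
      by (simp add: wp_simps R of_bool_def)
    show "wp w m scan_body (\<lambda>t' s'. I t' s' \<and> hi - reg s' 17 < hi - reg s 17) (t + (1 + expr_cost (less_e rK rHi))) s"
      using ob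
    proof (rule wp_mono)
      fix t' and s' :: ram_state
      assume a: "t' \<le> t + 60 \<and> mem s' = mem s0 \<and> (\<forall>r<17. reg s' r = reg s r)
       \<and> reg s' 17 = k + 1 \<and> reg s' 18 = min (f k) (reg s 18) \<and> reg s' 19 = (if f k < reg s 18 then k else reg s 19)"
      have t: "t' \<le> t0 + 60 * (k + 1 - lo)" using a k by (simp add: Suc_diff_le)
      have fr: "mem s' = mem s0 \<and> (\<forall>r<17. reg s' r = reg s0 r)" using a frame by simp
      have best': "lo \<le> reg s' 19 \<and> reg s' 19 < k + 1 \<and> reg s' 18 = f (reg s' 19) \<and>
          (\<forall>j. lo \<le> j \<longrightarrow> j < k + 1 \<longrightarrow> f (reg s' 19) \<le> f j)"
      proof (cases "k = lo")
        case True
        then have "reg s 18 = reg s0 18" using I R by (auto simp: I_def)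
        then show ?thesis using a fk True by (auto simp: less_Suc_eq)
      next
        case False
        then have "lo \<le> reg s 19 \<and> reg s 19 < k \<and> reg s 18 = f (reg s 19) \<and>
           (\<forall>j. lo \<le> j \<longrightarrow> j < k \<longrightarrow> f (reg s 19) \<le> f j)" using I R by (auto simp: I_def)
        then show ?thesis using a k by (auto simp: less_Suc_eq intro: order_trans less_imp_le)
      qed
      show "I t' s' \<and> hi - reg s' 17 < hi - reg s 17"
        using a k R t fr best' by (auto simp: I_def)
    qed
  qed
qed

lemma row_less: "x < r \<Longrightarrow> p < y \<Longrightarrow> x * y + p < r * (y :: nat)"
proof -
  assume "x < r" "p < y"
  then have "x * y + p < Suc x * y" by simp
  also have "\<dots> \<le> r * y" using \<open>x < r\<close> by (intro mult_right_mono) auto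
  finally show ?thesis .
qed

text \<open>Positions are cut off at \<open>2 * T\<close> because the wanted end positions
  \<open>T + n - i\<close> lie below it. Memory consists of the input, two tables of
  \<open>3 * T\<close> rows each, and the array of minimizers from \<open>KB\<close> on.
  \<open>3 * T\<close> rows hold the \<open>T / h\<close> blocks of \<open>2 * h + 1\<close> rows
  for every height \<open>h\<close>. \<open>(T + 1) * W\<close> serves as infinity, as walks through
  at most \<open>T\<close> layers cost at most \<open>T * W\<close>.\<close>

locale machine = grid +
  fixes T Y KB w m :: nat
  assumes Y: "Y = 2 * T" and T: "2 * n \<le> T" and KB: "KB = n * n + 6 * T * Y"
    and m: "KB + Y + 2 \<le> m" and mw: "m \<le> 2 ^ w" and inf: "(T + 1) * W < 2 ^ w"
begin

definition globals :: "ram_state \<Rightarrow> bool" where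
  "globals s \<longleftrightarrow> reg s 0 = n \<and> reg s 1 = (T + 1) * W \<and> reg s 2 = T \<and> reg s 3 = Y \<and>
     reg s 4 = W \<and> reg s 8 = KB"

lemma T4: "4 \<le> T" using T n2 by linarith

lemma Y8: "8 \<le> Y" using T4 Y by linarith

lemma Y_le_KB: "Y \<le> KB"
proof -
  have "1 * Y \<le> (6 * T) * Y" using T4 by (intro mult_right_mono) auto
  then show ?thesis using KB by linarith
qed

lemma W_pos: "0 < W" using c_less_W by linarith

lemma globals_cong: "globals s \<Longrightarrow> \<forall>r<9. reg s' r = reg s r \<Longrightarrow> globals s'"
  by (simp add: globals_def)

end

text \<open>Truncated subtraction provides \<open>max k a = k + (a - k)\<close> and \<open>min b a = b - (b - a)\<close>: the search
  interval found in the array at \<open>KB\<close> is clipped to admissible positions.\<close>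

definition step_pre :: prog where
  "step_pre =
     Seq (Assign 15 (plus_e rP rE))
    (Seq (Assign 17 (Load (plus_e rKB rP)))
    (Seq (Assign 17 (plus_e rK (minus_e (minus_e rQ (times_e (Const 2) rH)) rK)))
    (Seq (Assign 16 (Load (plus_e (plus_e rKB rP) (Const 1))))
    (Seq (Assign 16 (minus_e rHi (minus_e rHi (plus_e rP (times_e (Const 2) rH)))))
    (Seq (Assign 16 (plus_e (minus_e rHi (minus_e rHi rQ)) (Const 1)))
    (Seq (Assign 18 rInf)
         (Assign 19 (Const 0))))))))"

definition step_post :: prog where
  "step_post =
     Seq (Store (entry_e rDst rR rP) rBest)
    (Seq (Store (plus_e rKB rP) rArg)
         (Assign 14 (plus_e rP (Const 1))))"

definition step :: prog where
  "step = Seq step_pre (Seq scan step_post)"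

text \<open>When column distance \<open>e\<close> is processed, the array still holds at \<open>p\<close> and \<open>p + 1\<close> the minimizing
  positions for column distance \<open>e - 1\<close>, that is, for the entries \<open>(p, q - 1)\<close> and \<open>(p + 1, q)\<close>
  with \<open>q = p + e\<close>.\<close>

definition sweep :: prog where
  "sweep = While (less_e (plus_e rP rE) rY) step"

locale block = machine +
  fixes h src dst ra rb t0 :: nat
  assumes h: "2 * h \<le> T" "0 < h"
    and src: "src + 3 * T * Y \<le> KB" and dst: "dst + 3 * T * Y \<le> KB"
    and disj: "src + 3 * T * Y \<le> dst \<or> dst + 3 * T * Y \<le> src"
    and rows: "ra + 2 * h < 3 * T" "rb + 2 * h < 3 * T"
begin

text \<open>Cutting off the columns at \<open>Y\<close> loses nothing: positions never decrease
  along a walk, so the middles of an entry with \<open>q < Y\<close> are below \<open>Y\<close> as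
  well.\<close>

definition inputs :: "ram_state \<Rightarrow> bool" where
  "inputs s \<longleftrightarrow> globals s \<and> reg s 5 = h \<and> reg s 6 = src \<and> reg s 7 = dst \<and> reg s 10 = ra \<and> reg s 11 = rb \<and>
     (\<forall>e p. e \<le> 2 * h \<longrightarrow> p + e < Y \<longrightarrow>
        mem s (src + (ra + e) * Y + p) = val t0 h p (p + e) \<and>
        mem s (src + (rb + e) * Y + p) = val (t0 + h) h p (p + e))"

lemma src_less: "x < 3 * T \<Longrightarrow> p < Y \<Longrightarrow> src + x * Y + p < KB"
  using row_less[of x "3 * T" p Y] src by linarith

lemma dst_less: "x < 3 * T \<Longrightarrow> p < Y \<Longrightarrow> dst + x * Y + p < KB"
  using row_less[of x "3 * T" p Y] dst by linarith

lemma inputs_preserved: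
  assumes s: "inputs s0" and fr: "\<forall>r<12. reg s r = reg s0 r"
    and other: "\<forall>a<KB. \<not> (dst \<le> a \<and> a < dst + 3 * T * Y) \<longrightarrow> mem s a = mem s0 a"
  shows "inputs s"
proof -
  have same: "mem s (src + x * Y + p) = mem s0 (src + x * Y + p)" if "x < 3 * T" "p < Y" for x p
  proof -
    have "src + x * Y + p < KB" using that by (rule src_less)
    moreover have "x * Y + p < 3 * T * Y" using that by (rule row_less)
    then have "\<not> (dst \<le> src + x * Y + p \<and> src + x * Y + p < dst + 3 * T * Y)"
      using disj by linarith
    ultimately show ?thesis using other by blast
  qed
  show ?thesis unfolding inputs_def
  proof (intro conjI allI impI)
    show "globals s" using s fr by (auto simp: inputs_def intro: globals_cong)
    show "reg s 5 = h" "reg s 6 = src" "reg s 7 = dst" "reg s 10 = ra" "reg s 11 = rb"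
      using s fr by (auto simp: inputs_def)
  next
    fix e p assume ep: "e \<le> 2 * h" "p + e < Y"
    then show "mem s (src + (ra + e) * Y + p) = val t0 h p (p + e)"
      "mem s (src + (rb + e) * Y + p) = val (t0 + h) h p (p + e)"
      using s rows same[of "ra + e" p] same[of "rb + e" p] by (auto simp: inputs_def)
  qed
qed

text \<open>The loaded interval contains a minimizer but possibly also inadmissible middles, whose
  table cells would be meaningless. Clipping removes exactly those, so the minimum over the clipped
  interval is the global one.\<close>

lemma step_correct:
  assumes s: "inputs s" and p: "reg s 14 = p" and e: "reg s 13 = e" "p + e < Y" and r: "reg s 12 = r" "r < 3 * T"
    and K: "mem s (KB + p) = a" "mem s (KB + (p + 1)) = b" "a \<le> b" "b \<le> Y" "p \<le> a"
    and ex: "\<exists>k. a \<le> k \<and> k \<le> b \<and> opt t0 h p (p + e) k"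
  shows "wp w m step (\<lambda>t' s'. t' \<le> t + 60 * (b - a) + 200 \<and> (\<forall>r<14. reg s' r = reg s r) \<and> reg s' 14 = p + 1 \<and>
     (\<exists>k. a \<le> k \<and> k \<le> b \<and> opt t0 h p (p + e) k \<and>
        mem s' = (mem s)(dst + r * Y + p := val t0 (2 * h) p (p + e), KB + p := k))) t s"
proof -
  define q where "q = p + e"
  define lo where "lo = max a (q - 2 * h)"
  define hi where "hi = min (min b (p + 2 * h)) q + 1"
  have R: "reg s 0 = n" "reg s 1 = (T + 1) * W" "reg s (Suc 0) = (T + 1) * W" "reg s 2 = T" "reg s 3 = Y" "reg s 4 = W" "reg s 8 = KB"
    "reg s 5 = h" "reg s 6 = src" "reg s 7 = dst" "reg s 10 = ra" "reg s 11 = rb"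
    using s by (auto simp: inputs_def globals_def)
  \<comment> \<open>The constraint \<open>p <= k\<close> needs no clipping, because the loaded lower
    end is already at least \<open>p\<close>.\<close>
  have range: "lo \<le> k \<and> k < hi \<longleftrightarrow> a \<le> k \<and> k \<le> b \<and> adm h p q k" for k
    using K(5) by (auto simp: lo_def hi_def adm_def)
  obtain k0 where k0: "lo \<le> k0" "k0 < hi" "opt t0 h p q k0"
    using ex range by (auto simp: opt_def q_def)
  have small: "p < Y" "e < Y" "q < Y" "2 * h \<le> Y" "lo < hi" "hi \<le> Y" "b \<le> Y"
    using e h Y k0(1,2) K unfolding q_def hi_def by linarith+
  have V: "KB + Y + 2 \<le> 2 ^ w" using m mw by linarith
  have Kb: "KB + p < m" "KB + p + 1 < m" "KB + p < 2 ^ w" "KB + p + 1 < 2 ^ w"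
    using small m mw by linarith+
  have pre: "wp w m step_pre (\<lambda>t' s'. t' \<le> t + 80 \<and> mem s' = mem s \<and> (\<forall>r<15. reg s' r = reg s r) \<and>
      reg s' 15 = q \<and> reg s' 16 = hi \<and> reg s' 17 = lo \<and> reg s' 18 = (T + 1) * W \<and> reg s' 19 = 0) t s"
  proof -
    have mx: "a + (q - 2 * h - a) = lo" by (simp add: lo_def)
    have mn: "b - (b - (p + 2 * h)) = min b (p + 2 * h)"
      "min b (p + 2 * h) - (min b (p + 2 * h) - q) + 1 = hi" by (auto simp: hi_def)
    have "p + e < 2 ^ w" "p < 2 ^ w" "e < 2 ^ w" "KB < 2 ^ w" "a < 2 ^ w" "b < 2 ^ w" "h < 2 ^ w" "2 * h < 2 ^ w" "q < 2 ^ w"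
      "lo < 2 ^ w" "hi < 2 ^ w" "p + 2 * h < 2 ^ w" "q - 2 * h < 2 ^ w" "q - 2 * h - a < 2 ^ w"
      "b - (p + 2 * h) < 2 ^ w" "min b (p + 2 * h) < 2 ^ w" "min b (p + 2 * h) - q < 2 ^ w" "1 < (2::nat) ^ w" "2 < (2::nat)^ w"
      "min b (p + 2 * h) - (min b (p + 2 * h) - q) < 2 ^ w"
      using small V K Y8 Y_le_KB e(2) min.cobounded1[of b "p + 2 * h"] by linarith+
    note fits_facts = this
    show ?thesis
      unfolding step_pre_def
      using fits_facts Kb inf mx mn K(1,2)
      by (simp add: wp_simps R p e(1) q_def[symmetric])
  qed
  \<comment> \<open>Two walks of height \<open>h\<close> with \<open>2 * h <= T\<close> stay below
    the value used as infinity.\<close>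
  have big: "cost t0 h p q k < (T + 1) * W" if "adm h p q k" for k
  proof -
    have "cost t0 h p q k \<le> 2 * h * W" using that by (rule cost_le)
    also have "\<dots> < (T + 1) * W" using h W_pos by (intro mult_strict_right_mono) auto
    finally show ?thesis .
  qed
  have f: "p \<le> k \<and> k \<le> q \<and> src + (ra + (k - p)) * Y + p < m \<and> src + (rb + (q - k)) * Y + k < m \<and>
      mem s (src + (ra + (k - p)) * Y + p) + mem s (src + (rb + (q - k)) * Y + k) = cost t0 h p q k \<and>
      cost t0 h p q k < (T + 1) * W"
    if "lo \<le> k" "k < hi" for k
  proof -
    have k: "adm h p q k" using range that by blast
    then have "p \<le> k" "k \<le> q" "k - p \<le> 2 * h" "q - k \<le> 2 * h" "k < Y" using small by (auto simp: adm_def)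
    moreover from this have "src + (ra + (k - p)) * Y + p < KB" "src + (rb + (q - k)) * Y + k < KB"
      using rows small by (auto intro!: src_less)
    moreover have "mem s (src + (ra + (k - p)) * Y + p) = val t0 h p k"
      "mem s (src + (rb + (q - k)) * Y + k) = val (t0 + h) h k q"
      using s calculation small unfolding inputs_def by (metis le_add_diff_inverse)+
    ultimately show ?thesis using big[OF k] m by (simp add: cost_def)
  qed
  have dstp: "dst + r * Y + p < KB" using r small by (intro dst_less)
  show ?thesis unfolding step_def wp_Seq
  proof (rule wp_mono[OF pre])
    fix t1 and s1 :: ram_state
    assume s1: "t1 \<le> t + 80 \<and> mem s1 = mem s \<and> (\<forall>r<15. reg s1 r = reg s r) \<and>
      reg s1 15 = q \<and> reg s1 16 = hi \<and> reg s1 17 = lo \<and> reg s1 18 = (T + 1) * W \<and> reg s1 19 = 0"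
    have scan: "wp w m scan (\<lambda>t s. t \<le> t1 + 60 * (hi - lo) + 10 \<and> mem s = mem s1 \<and> (\<forall>r<17. reg s r = reg s1 r)
      \<and> lo \<le> reg s 19 \<and> reg s 19 < hi \<and> reg s 18 = cost t0 h p q (reg s 19)
      \<and> (\<forall>k. lo \<le> k \<longrightarrow> k < hi \<longrightarrow> cost t0 h p q (reg s 19) \<le> cost t0 h p q k)) t1 s1"
    proof (rule scan_correct[where Y = Y and src = src and ra = ra and rb = rb and p = p and q = q])
      show "reg s1 3 = Y" "reg s1 6 = src" "reg s1 10 = ra" "reg s1 11 = rb" "reg s1 14 = p"
        "reg s1 15 = q" "reg s1 16 = hi" "reg s1 17 = lo" "reg s1 18 < 2 ^ w" "reg s1 19 < 2 ^ w"
        using s1 R p inf by simp_all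
      show "lo < hi" "hi < 2 ^ w" "q < 2 ^ w" "0 < Y" "Y < 2 ^ w" using small V Y8 by linarith+
      show "p \<le> k \<and> k \<le> q \<and> src + (ra + (k - p)) * Y + p < m \<and> src + (rb + (q - k)) * Y + k < m \<and>
          mem s1 (src + (ra + (k - p)) * Y + p) + mem s1 (src + (rb + (q - k)) * Y + k) = cost t0 h p q k \<and>
          cost t0 h p q k < reg s1 18" if "lo \<le> k" "k < hi" for k
        using f[OF that] s1 by metis
    qed (rule mw)
    show "wp w m scan (wp w m step_post (\<lambda>t' s'. t' \<le> t + 60 * (b - a) + 200 \<and> (\<forall>r<14. reg s' r = reg s r) \<and> reg s' 14 = p + 1 \<and>
     (\<exists>k. a \<le> k \<and> k \<le> b \<and> opt t0 h p (p + e) k \<and>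
        mem s' = (mem s)(dst + r * Y + p := val t0 (2 * h) p (p + e), KB + p := k)))) t1 s1"
    proof (rule wp_mono[OF scan])
      fix t2 and s2 :: ram_state
      assume s2: "t2 \<le> t1 + 60 * (hi - lo) + 10 \<and> mem s2 = mem s1 \<and> (\<forall>r<17. reg s2 r = reg s1 r)
      \<and> lo \<le> reg s2 19 \<and> reg s2 19 < hi \<and> reg s2 18 = cost t0 h p q (reg s2 19)
      \<and> (\<forall>k. lo \<le> k \<longrightarrow> k < hi \<longrightarrow> cost t0 h p q (reg s2 19) \<le> cost t0 h p q k)"
      define k where "k = reg s2 19"
      have k: "lo \<le> k" "k < hi" "a \<le> k" "k \<le> b" "adm h p q k" using s2 range by (auto simp: k_def)
      have "cost t0 h p q k \<le> cost t0 h p q k0" using s2 k0 by (auto simp: k_def)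
      then have opt: "opt t0 h p q k" using k(5) k0(3) by (auto simp: opt_def intro: order_trans)
      have R2: "reg s2 3 = Y" "reg s2 7 = dst" "reg s2 8 = KB" "reg s2 12 = r" "reg s2 14 = p"
        "reg s2 18 = val t0 (2 * h) p q" "reg s2 19 = k" "mem s2 = mem s" and fr: "\<forall>r<14. reg s2 r = reg s r"
        using s1 s2 R p r opt_val[OF opt] by (auto simp: k_def)
      have time: "t2 \<le> t + 90 + 60 * (b - a + 1)"
      proof -
        have "hi - lo \<le> b - a + 1" using K(3) unfolding hi_def lo_def by auto
        moreover have "t1 \<le> t + 80" "t2 \<le> t1 + 60 * (hi - lo) + 10" using s1 s2 by auto
        moreover have "t1 \<le> t + 80 \<Longrightarrow> t2 \<le> t1 + 60 * x + 10 \<Longrightarrow> x \<le> y \<Longrightarrow> t2 \<le> t + 90 + 60 * y" for x y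
          by linarith
        ultimately show ?thesis by blast
      qed
      have A: "dst + r * Y + p < 2 ^ w" "dst + r * Y + p < m" using dstp V m by linarith+
      have "val t0 (2 * h) p q < 2 ^ w" using opt_val[OF opt] big[OF k(5)] inf by simp
      moreover have "p + 1 < 2 ^ w" "k < 2 ^ w" "KB < 2 ^ w" "Y < 2 ^ w" "1 < (2::nat) ^ w"
        using small V k by linarith+
      ultimately show "wp w m step_post (\<lambda>t' s'. t' \<le> t + 60 * (b - a) + 200 \<and> (\<forall>r<14. reg s' r = reg s r) \<and> reg s' 14 = p + 1 \<and>
         (\<exists>k. a \<le> k \<and> k \<le> b \<and> opt t0 h p (p + e) k \<and>
            mem s' = (mem s)(dst + r * Y + p := val t0 (2 * h) p (p + e), KB + p := k))) t2 s2"
        unfolding step_post_def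
        using A Kb address_less[OF A(1)] time Y8 opt k fr
        by (auto simp: wp_simps R2 q_def[symmetric])
    qed
  qed
qed

lemma sweep_correct:
  assumes s: "inputs s0" and p: "reg s0 14 = 0" and e: "reg s0 13 = e" "e \<le> Y" and r: "reg s0 12 = r" "r < 3 * T"
    and K: "\<And>p. p + e \<le> Y \<Longrightarrow> mem s0 (KB + p) = K p" "\<And>p. p + e \<le> Y \<Longrightarrow> p \<le> K p \<and> K p \<le> Y"
      "\<And>p. p + e < Y \<Longrightarrow> K p \<le> K (p + 1)"
    and ex: "\<And>p. p + e < Y \<Longrightarrow> \<exists>k. K p \<le> k \<and> k \<le> K (p + 1) \<and> opt t0 h p (p + e) k"
  shows "wp w m sweep (\<lambda>t' s'. t' \<le> t + 270 * Y + 10 \<and> (\<forall>r<14. reg s' r = reg s0 r) \<and>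
     (\<forall>p. p + e < Y \<longrightarrow> mem s' (dst + r * Y + p) = val t0 (2 * h) p (p + e) \<and>
       K p \<le> mem s' (KB + p) \<and> mem s' (KB + p) \<le> K (p + 1) \<and> opt t0 h p (p + e) (mem s' (KB + p))) \<and>
     (\<forall>a<KB. \<not> (dst + r * Y \<le> a \<and> a < dst + r * Y + Y) \<longrightarrow> mem s' a = mem s0 a)) t s0"
proof -
  \<comment> \<open>The term \<open>60 * K p\<close> is the potential behind the telescoping:
    searching between \<open>K p\<close> and \<open>K (p + 1)\<close> is paid by the increase of
    \<open>K\<close>, which never exceeds \<open>Y\<close>. Cells from \<open>p\<close> on still
    hold the old minimizers, since the sweep only overwrites cells it has passed.\<close>
  define I :: "nat \<Rightarrow> ram_state \<Rightarrow> bool" where "I t' s \<longleftrightarrow> (\<exists>p. reg s 14 = p \<and> p + e \<le> Y \<and>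
     t' \<le> t + 210 * p + 60 * K p \<and> (\<forall>r<14. reg s r = reg s0 r) \<and>
     (\<forall>p'<p. mem s (dst + r * Y + p') = val t0 (2 * h) p' (p' + e) \<and>
       K p' \<le> mem s (KB + p') \<and> mem s (KB + p') \<le> K (p' + 1) \<and> opt t0 h p' (p' + e) (mem s (KB + p'))) \<and>
     (\<forall>p'. p \<le> p' \<longrightarrow> p' + e \<le> Y \<longrightarrow> mem s (KB + p') = K p') \<and>
     (\<forall>a<KB. \<not> (dst + r * Y \<le> a \<and> a < dst + r * Y + Y) \<longrightarrow> mem s a = mem s0 a))" for t' s
  have V: "KB + Y + 2 \<le> 2 ^ w" using m mw by linarith
  have dstr: "dst + r * Y + p < KB" if "p < Y" for p using dst_less[OF r(2) that] .
  have regs: "reg s 3 = Y" "reg s 13 = e" "reg s 12 = r" "inputs s" if "I t' s" for t' s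
  proof -
    have fr: "\<forall>r<14. reg s r = reg s0 r" using that by (auto simp: I_def)
    then show "reg s 3 = Y" "reg s 13 = e" "reg s 12 = r" using assms(1) e r by (auto simp: inputs_def globals_def)
    have "r * Y + (Y - 1) < 3 * T * Y" using r Y8 by (intro row_less) auto
    then have "dst \<le> dst + r * Y" "dst + r * Y + Y \<le> dst + 3 * T * Y" using Y8 by linarith+
    then have "\<forall>a<KB. \<not> (dst \<le> a \<and> a < dst + 3 * T * Y) \<longrightarrow> mem s a = mem s0 a"
      using that unfolding I_def by (meson order_trans less_le_trans)
    then show "inputs s" using inputs_preserved[OF s] fr by simp
  qed
  show ?thesis unfolding sweep_def
  proof (rule wp_While[where I = I and \<mu> = "\<lambda>s. Y - reg s 14"])
    show "I t s0" using p e K by (auto simp: I_def)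
  next
    fix t' s assume I: "I t' s"
    have "reg s 14 + e \<le> Y" using I by (auto simp: I_def)
    then show "fits w m (less_e (plus_e rP rE) rY) s"
      using regs[OF I] V Y_le_KB by (auto simp: of_bool_def)
  next
    fix t' s assume I: "I t' s" and c: "eval_expr (less_e (plus_e rP rE) rY) s = 0"
    have pe: "reg s 14 + e = Y" using I c regs[OF I] by (auto simp: I_def)
    have "K (reg s 14) \<le> Y" "reg s 14 \<le> Y" using K(2)[of "reg s 14"] pe by auto
    then have "t' + 6 \<le> t + 270 * Y + 10" using I by (auto simp: I_def)
    moreover have "p' < reg s 14" if "p' + e < Y" for p' using that pe by simp
    ultimately show "t' + (1 + expr_cost (less_e (plus_e rP rE) rY)) \<le> t + 270 * Y + 10 \<and> (\<forall>r<14. reg s r = reg s0 r) \<and>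
     (\<forall>p. p + e < Y \<longrightarrow> mem s (dst + r * Y + p) = val t0 (2 * h) p (p + e) \<and>
       K p \<le> mem s (KB + p) \<and> mem s (KB + p) \<le> K (p + 1) \<and> opt t0 h p (p + e) (mem s (KB + p))) \<and>
     (\<forall>a<KB. \<not> (dst + r * Y \<le> a \<and> a < dst + r * Y + Y) \<longrightarrow> mem s a = mem s0 a)"
      using I by (auto simp: I_def)
  next
    fix t' s assume I: "I t' s" and c: "eval_expr (less_e (plus_e rP rE) rY) s \<noteq> 0"
    define p where "p = reg s 14"
    note R = regs[OF I]
    have pe: "p + e < Y" using c R by (auto simp: p_def)
    have time: "t' \<le> t + 210 * p + 60 * K p" using I by (auto simp: I_def p_def)
    have step: "wp w m step (\<lambda>t'' s'. t'' \<le> t' + (1 + expr_cost (less_e (plus_e rP rE) rY)) + 60 * (K (p + 1) - K p) + 200 \<and>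
       (\<forall>r<14. reg s' r = reg s r) \<and> reg s' 14 = p + 1 \<and>
       (\<exists>k. K p \<le> k \<and> k \<le> K (p + 1) \<and> opt t0 h p (p + e) k \<and>
        mem s' = (mem s)(dst + r * Y + p := val t0 (2 * h) p (p + e), KB + p := k)))
       (t' + (1 + expr_cost (less_e (plus_e rP rE) rY))) s"
    proof (rule step_correct)
      have "\<forall>p'. p \<le> p' \<longrightarrow> p' + e \<le> Y \<longrightarrow> mem s (KB + p') = K p'" using I by (auto simp: I_def p_def)
      from this[rule_format, of p] this[rule_format, of "p + 1"]
      show "mem s (KB + p) = K p" "mem s (KB + (p + 1)) = K (p + 1)" using pe by simp_all
      show "K p \<le> K (p + 1)" "K (p + 1) \<le> Y" "p \<le> K p"
        using K(2)[of p] K(2)[of "p + 1"] K(3)[of p] pe by simp_all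
    qed (use R pe r ex in \<open>simp_all add: p_def\<close>)
    show "wp w m step (\<lambda>t'' s'. I t'' s' \<and> Y - reg s' 14 < Y - reg s 14)
      (t' + (1 + expr_cost (less_e (plus_e rP rE) rY))) s"
    proof (rule wp_mono[OF step])
      fix t'' and s' :: ram_state
      assume a: "t'' \<le> t' + (1 + expr_cost (less_e (plus_e rP rE) rY)) + 60 * (K (p + 1) - K p) + 200 \<and>
       (\<forall>r<14. reg s' r = reg s r) \<and> reg s' 14 = p + 1 \<and>
       (\<exists>k. K p \<le> k \<and> k \<le> K (p + 1) \<and> opt t0 h p (p + e) k \<and>
        mem s' = (mem s)(dst + r * Y + p := val t0 (2 * h) p (p + e), KB + p := k))"
      then obtain k where k: "K p \<le> k" "k \<le> K (p + 1)" "opt t0 h p (p + e) k"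
        "mem s' = (mem s)(dst + r * Y + p := val t0 (2 * h) p (p + e), KB + p := k)" by blast
      have t'': "t'' \<le> t + 210 * (p + 1) + 60 * K (p + 1)"
      proof -
        have "t'' \<le> t' + 206 + 60 * (K (p + 1) - K p)" using a by simp
        moreover obtain z where "K (p + 1) = K p + z" using K(3)[OF pe] le_iff_add by blast
        ultimately show ?thesis using time by simp
      qed
      have pY: "p < Y" using pe by simp
      have ne: "dst + r * Y + p' \<noteq> KB + p''" "KB + p'' \<noteq> dst + r * Y + p'" if "p' < Y" for p' p''
        using dstr[OF that] by simp_all
      have Ip: "\<forall>p'<p. mem s (dst + r * Y + p') = val t0 (2 * h) p' (p' + e) \<and>
          K p' \<le> mem s (KB + p') \<and> mem s (KB + p') \<le> K (p' + 1) \<and> opt t0 h p' (p' + e) (mem s (KB + p'))"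
        "\<forall>p'. p \<le> p' \<longrightarrow> p' + e \<le> Y \<longrightarrow> mem s (KB + p') = K p'"
        "\<forall>a<KB. \<not> (dst + r * Y \<le> a \<and> a < dst + r * Y + Y) \<longrightarrow> mem s a = mem s0 a"
        using I by (auto simp: I_def p_def)
      have done_: "mem s' (dst + r * Y + p') = val t0 (2 * h) p' (p' + e) \<and>
         K p' \<le> mem s' (KB + p') \<and> mem s' (KB + p') \<le> K (p' + 1) \<and> opt t0 h p' (p' + e) (mem s' (KB + p'))"
        if "p' < p + 1" for p'
      proof (cases "p' = p")
        case True
        then show ?thesis using k ne(1)[OF pY, of p] by simp
      next
        case False
        then have "p' < p" "p' < Y" using that pY by simp_all
        then show ?thesis using Ip(1) k(4) ne[OF pY] ne[of p'] by simp
      qed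
      have todo: "mem s' (KB + p') = K p'" if "p + 1 \<le> p'" "p' + e \<le> Y" for p'
        using that Ip(2) k(4) ne[OF pY] by simp
      have other: "mem s' a = mem s0 a" if "a < KB" "\<not> (dst + r * Y \<le> a \<and> a < dst + r * Y + Y)" for a
      proof -
        have "a \<noteq> dst + r * Y + p" "a \<noteq> KB + p" using that pY by auto
        then show ?thesis using Ip(3) that k(4) by simp
      qed
      have fr: "\<forall>r<14. reg s' r = reg s0 r" using a I by (auto simp: I_def)
      have "I t'' s'" unfolding I_def
        using t'' done_ todo other fr a pe by (intro exI[of _ "p + 1"]) auto
      then show "I t'' s' \<and> Y - reg s' 14 < Y - reg s 14" using a pe by (auto simp: p_def)
    qed
  qed
qed

end

section \<open>Merging two blocks\<close>

definition init_body :: prog where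
  "init_body = Seq (Store (plus_e rKB rP) rP) (Assign 14 (plus_e rP (Const 1)))"

text \<open>The identity plays the part of the minimizers for column distance -1. Cell
  \<open>Y\<close> is included because at column distance 0 the last entry \<open>p = Y - 1\<close>
  reads its right neighbour.\<close>

definition init :: prog where
  "init = Seq (Assign 14 (Const 0)) (While (less_e rP (plus_e rY (Const 1))) init_body)"

lemma (in machine) init_correct:
  assumes "globals s0"
  shows "wp w m init (\<lambda>t' s'. t' \<le> t + 20 * Y + 20 \<and> (\<forall>r<14. reg s' r = reg s0 r) \<and>
    (\<forall>p\<le>Y. mem s' (KB + p) = p) \<and> (\<forall>a<KB. mem s' a = mem s0 a)) t s0"
proof -
  define I :: "nat \<Rightarrow> ram_state \<Rightarrow> bool" where "I t' s \<longleftrightarrow> (\<exists>p. reg s 14 = p \<and> p \<le> Y + 1 \<and>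
     t' \<le> t + 2 + 16 * p \<and> (\<forall>r<14. reg s r = reg s0 r) \<and>
     (\<forall>p'<p. mem s (KB + p') = p') \<and> (\<forall>a<KB. mem s a = mem s0 a))" for t' s
  have V: "KB + Y + 2 \<le> 2 ^ w" using m mw by linarith
  have v: "Y + 1 < 2 ^ w" "Y < 2 ^ w" "KB < 2 ^ w" "1 < (2::nat) ^ w" "0 < (2::nat) ^ w" using V Y_le_KB Y8 by linarith+
  have regs: "reg s 3 = Y" "reg s 8 = KB" if "I t' s" for t' s
    using assms that by (auto simp: I_def globals_def)
  have loop: "wp w m (While (less_e rP (plus_e rY (Const 1))) init_body)
    (\<lambda>t' s'. t' \<le> t + 20 * Y + 20 \<and> (\<forall>r<14. reg s' r = reg s0 r) \<and>
      (\<forall>p\<le>Y. mem s' (KB + p) = p) \<and> (\<forall>a<KB. mem s' a = mem s0 a)) t1 s1" if "I t1 s1" for t1 s1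
    using that
  proof (rule wp_While[where I = I and \<mu> = "\<lambda>s. Y + 1 - reg s 14"])
    fix t' s assume I: "I t' s"
    have "reg s 14 < 2 ^ w" using I v by (auto simp: I_def)
    then show "fits w m (less_e rP (plus_e rY (Const 1))) s"
      using regs[OF I] v by (simp add: of_bool_def)
  next
    fix t' s assume I: "I t' s" and c: "eval_expr (less_e rP (plus_e rY (Const 1))) s = 0"
    then have "reg s 14 = Y + 1" using regs[OF I] by (auto simp: I_def)
    then show "t' + (1 + expr_cost (less_e rP (plus_e rY (Const 1)))) \<le> t + 20 * Y + 20 \<and> (\<forall>r<14. reg s r = reg s0 r) \<and>
      (\<forall>p\<le>Y. mem s (KB + p) = p) \<and> (\<forall>a<KB. mem s a = mem s0 a)"
      using I Y8 by (auto simp: I_def)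
  next
    fix t' s assume I: "I t' s" and c: "eval_expr (less_e rP (plus_e rY (Const 1))) s \<noteq> 0"
    have p: "reg s 14 \<le> Y" using regs[OF I] c by auto
    then have "KB + reg s 14 < m" "KB + reg s 14 < 2 ^ w" "reg s 14 < 2 ^ w" "reg s 14 + 1 < 2 ^ w" using m V Y_le_KB by linarith+
    then show "wp w m init_body (\<lambda>t' s'. I t' s' \<and> Y + 1 - reg s' 14 < Y + 1 - reg s 14)
       (t' + (1 + expr_cost (less_e rP (plus_e rY (Const 1))))) s"
      using I p v unfolding init_body_def by (auto simp: wp_simps I_def regs[OF I] less_Suc_eq)
  qed
  have "I (t + 2) (s0\<lparr>reg := (reg s0)(14 := 0)\<rparr>)" by (auto simp: I_def)
  from loop[OF this] show ?thesis using v by (simp add: init_def wp_Seq wp_Assign)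
qed

definition block_post :: prog where
  "block_post = Seq (Assign 12 (plus_e rR (Const 1))) (Assign 13 (plus_e rE (Const 1)))"

definition block_body :: prog where
  "block_body = Seq (Assign 14 (Const 0)) (Seq sweep block_post)"

definition block_prog :: prog where
  "block_prog = Seq init (Seq (Assign 13 (Const 0))
     (While (less_e rE (plus_e (times_e (Const 4) rH) (Const 1))) block_body))"

context block
begin

lemma block_correct:
  assumes s: "inputs s0" and r: "reg s0 12 = r" "r + 4 * h < 3 * T"
  shows "wp w m block_prog (\<lambda>t' s'. t' \<le> t + 2000 * h * Y \<and> (\<forall>x<12. reg s' x = reg s0 x) \<and>
     reg s' 12 = r + (4 * h + 1) \<and>
     (\<forall>e p. e \<le> 4 * h \<longrightarrow> p + e < Y \<longrightarrow> mem s' (dst + (r + e) * Y + p) = val t0 (2 * h) p (p + e)) \<and>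
     (\<forall>a<KB. \<not> (dst + r * Y \<le> a \<and> a < dst + (r + (4 * h + 1)) * Y) \<longrightarrow> mem s' a = mem s0 a)) t s0"
proof -
  define c where "c = less_e rE (plus_e (times_e (Const 4) rH) (Const 1))"
  \<comment> \<open>\<open>J\<close> is what a sweep over diagonal \<open>e\<close> needs from the
    array. The sandwich clause stops at \<open>4 * h\<close>, beyond which the product has no
    entries.\<close>
  define J where "J e K \<longleftrightarrow> (\<forall>p. p + e \<le> Y \<longrightarrow> p \<le> K p \<and> K p \<le> Y) \<and> (\<forall>p. p + e < Y \<longrightarrow> K p \<le> K (p + 1)) \<and>
     (e \<le> 4 * h \<longrightarrow> (\<forall>p. p + e < Y \<longrightarrow> (\<exists>k. K p \<le> k \<and> k \<le> K (p + 1) \<and> opt t0 h p (p + e) k)))" for e and K :: "nat \<Rightarrow> nat"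
  define I :: "nat \<Rightarrow> ram_state \<Rightarrow> bool" where "I t' s \<longleftrightarrow> (\<exists>e. reg s 13 = e \<and> e \<le> 4 * h + 1 \<and> reg s 12 = r + e \<and>
     t' \<le> t + 20 * Y + 30 + (270 * Y + 40) * e \<and> (\<forall>x<12. reg s x = reg s0 x) \<and>
     J e (\<lambda>p. mem s (KB + p)) \<and>
     (\<forall>e'<e. \<forall>p. p + e' < Y \<longrightarrow> mem s (dst + (r + e') * Y + p) = val t0 (2 * h) p (p + e')) \<and>
     (\<forall>a<KB. \<not> (dst + r * Y \<le> a \<and> a < dst + (r + e) * Y) \<longrightarrow> mem s a = mem s0 a))" for t' s
  have V: "KB + Y + 2 \<le> 2 ^ w" using m mw by linarith
  have hY: "4 * h \<le> Y" using h Y by linarith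
  have h5: "reg s 5 = h" if "I t' s" for t' s using that s by (auto simp: I_def inputs_def)
  have region: "dst + (r + e) * Y \<le> dst + 3 * T * Y" if "e \<le> 4 * h + 1" for e
    using that r by (intro add_left_mono mult_right_mono) auto
  have inp: "inputs s" if I: "I t' s" for t' s
  proof -
    obtain e where e: "e \<le> 4 * h + 1"
      "\<forall>a<KB. \<not> (dst + r * Y \<le> a \<and> a < dst + (r + e) * Y) \<longrightarrow> mem s a = mem s0 a"
      "\<forall>x<12. reg s x = reg s0 x" using I by (auto simp: I_def)
    have "\<forall>a<KB. \<not> (dst \<le> a \<and> a < dst + 3 * T * Y) \<longrightarrow> mem s a = mem s0 a"
      using e(2) region[OF e(1)] by (meson le_add1 order_trans less_le_trans)
    then show ?thesis using inputs_preserved[OF s e(3)] by simp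
  qed
  have J0: "J 0 K" if "\<forall>p\<le>Y. K p = p" for K
  proof -
    \<comment> \<open>On the main diagonal \<open>p\<close> is the only admissible middle.\<close>
    have "opt t0 h p p p" for p by (auto simp: opt_def adm_def)
    then show ?thesis using that unfolding J_def by (auto intro!: exI)
  qed
  \<comment> \<open>Both \<open>K' p\<close> and \<open>K' (p + 1)\<close> are separated by the old
    \<open>K (p + 1)\<close>, which gives monotonicity; \<open>opt_between\<close> then yields a
    minimizer of the next diagonal between them.\<close>
  have JS: "J (e + 1) K'" if J: "J e K" and e: "e \<le> 4 * h"
    and K': "\<And>p. p + e < Y \<Longrightarrow> K p \<le> K' p \<and> K' p \<le> K (p + 1) \<and> opt t0 h p (p + e) (K' p)" for e K K'
  proof -
    have 1: "p \<le> K' p \<and> K' p \<le> Y" if "p + (e + 1) \<le> Y" for p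
    proof -
      have "p \<le> K p" "K (p + 1) \<le> Y" using J[unfolded J_def] that by simp_all
      then show ?thesis using K'[of p] that by linarith
    qed
    have 2: "K' p \<le> K' (p + 1)" if "p + (e + 1) < Y" for p
      using K'[of p] K'[of "p + 1"] that by (auto intro: order_trans)
    have 3: "\<exists>k. K' p \<le> k \<and> k \<le> K' (p + 1) \<and> opt t0 h p (p + (e + 1)) k"
      if "e + 1 \<le> 4 * h" "p + (e + 1) < Y" for p
      using opt_between[of t0 h p "p + e" "K' p" "K' (p + 1)"] K'[of p] K'[of "p + 1"] 2[of p] that by (simp add: add.assoc)
    show ?thesis using 1 2 3 unfolding J_def by blast
  qed
  have loop: "wp w m (While c block_body)
     (\<lambda>t' s'. t' \<le> t + 2000 * h * Y \<and> (\<forall>x<12. reg s' x = reg s0 x) \<and>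
     reg s' 12 = r + (4 * h + 1) \<and>
     (\<forall>e p. e \<le> 4 * h \<longrightarrow> p + e < Y \<longrightarrow> mem s' (dst + (r + e) * Y + p) = val t0 (2 * h) p (p + e)) \<and>
     (\<forall>a<KB. \<not> (dst + r * Y \<le> a \<and> a < dst + (r + (4 * h + 1)) * Y) \<longrightarrow> mem s' a = mem s0 a)) t1 s1"
    if "I t1 s1" for t1 s1
    using that
  proof (rule wp_While[where I = I and \<mu> = "\<lambda>s. 4 * h + 1 - reg s 13"])
    fix t' s assume I: "I t' s"
    have "reg s 13 \<le> 4 * h + 1" using I by (auto simp: I_def)
    then have "reg s 13 < 2 ^ w" "4 * h + 1 < 2 ^ w" "4 * h < 2 ^ w" "h < 2 ^ w" "4 < (2::nat) ^ w" "1 < (2::nat) ^ w"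
      using hY V Y_le_KB Y8 by linarith+
    then show "fits w m c s" using h5[OF I] by (simp add: c_def of_bool_def)
  next
    fix t' s assume I: "I t' s" and c0: "eval_expr c s = 0"
    have e: "reg s 13 = 4 * h + 1" using I c0 h5[OF I] by (auto simp: I_def c_def)
    have "t' + 8 \<le> t + 2000 * h * Y"
    proof -
      have "t' \<le> t + 20 * Y + 30 + (270 * Y + 40) * (4 * h + 1)" using I e by (auto simp: I_def)
      \<comment> \<open>Uses \<open>40 <= 5 * Y\<close> and
        \<open>4 * h + 1 <= 5 * h\<close>.\<close>
      also have "\<dots> \<le> t + 20 * Y + 30 + (275 * Y) * (5 * h)"
        using Y8 h by (intro add_left_mono mult_mono) auto
      finally have "t' + 8 \<le> t + 20 * Y + 38 + 1375 * (h * Y)" by (simp add: mult.commute)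
      moreover have "1 * Y \<le> h * Y" using h by (intro mult_right_mono) auto
      ultimately show ?thesis using Y8 by linarith
    qed
    then show "t' + (1 + expr_cost c) \<le> t + 2000 * h * Y \<and> (\<forall>x<12. reg s x = reg s0 x) \<and>
     reg s 12 = r + (4 * h + 1) \<and>
     (\<forall>e p. e \<le> 4 * h \<longrightarrow> p + e < Y \<longrightarrow> mem s (dst + (r + e) * Y + p) = val t0 (2 * h) p (p + e)) \<and>
     (\<forall>a<KB. \<not> (dst + r * Y \<le> a \<and> a < dst + (r + (4 * h + 1)) * Y) \<longrightarrow> mem s a = mem s0 a)"
      using I e by (auto simp: I_def c_def)
  next
    fix t' s assume I: "I t' s" and c1: "eval_expr c s \<noteq> 0"
    define e where "e = reg s 13"
    have e: "e \<le> 4 * h" using c1 h5[OF I] by (auto simp: e_def c_def)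
    have Is: "reg s 12 = r + e" "t' \<le> t + 20 * Y + 30 + (270 * Y + 40) * e" "\<forall>x<12. reg s x = reg s0 x"
      "J e (\<lambda>p. mem s (KB + p))"
      "\<forall>e'<e. \<forall>p. p + e' < Y \<longrightarrow> mem s (dst + (r + e') * Y + p) = val t0 (2 * h) p (p + e')"
      "\<forall>a<KB. \<not> (dst + r * Y \<le> a \<and> a < dst + (r + e) * Y) \<longrightarrow> mem s a = mem s0 a"
      using I by (auto simp: I_def e_def)
    define s1 where "s1 = s\<lparr>reg := (reg s)(14 := 0)\<rparr>"
    have s1: "inputs s1" "reg s1 14 = 0" "reg s1 13 = e" "reg s1 12 = r + e" "mem s1 = mem s"
      using inp[OF I] Is(1) by (auto simp: s1_def inputs_def globals_def e_def)
    have sw: "wp w m sweep (\<lambda>t'' s'. t'' \<le> t' + 10 + 270 * Y + 10 \<and> (\<forall>x<14. reg s' x = reg s1 x) \<and>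
     (\<forall>p. p + e < Y \<longrightarrow> mem s' (dst + (r + e) * Y + p) = val t0 (2 * h) p (p + e) \<and>
       mem s (KB + p) \<le> mem s' (KB + p) \<and> mem s' (KB + p) \<le> mem s (KB + (p + 1)) \<and> opt t0 h p (p + e) (mem s' (KB + p))) \<and>
     (\<forall>a<KB. \<not> (dst + (r + e) * Y \<le> a \<and> a < dst + (r + e) * Y + Y) \<longrightarrow> mem s' a = mem s1 a)) (t' + 10) s1"
      using Is(4) e hY r unfolding J_def
      by (intro sweep_correct) (use s1 in auto)
    show "wp w m block_body (\<lambda>t' s'. I t' s' \<and> 4 * h + 1 - reg s' 13 < 4 * h + 1 - reg s 13) (t' + (1 + expr_cost c)) s"
    proof -
      have "wp w m block_post (\<lambda>t' s'. I t' s' \<and> 4 * h + 1 - reg s' 13 < 4 * h + 1 - reg s 13) t2 s2"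
        if a: "t2 \<le> t' + 10 + 270 * Y + 10 \<and> (\<forall>x<14. reg s2 x = reg s1 x) \<and>
          (\<forall>p. p + e < Y \<longrightarrow> mem s2 (dst + (r + e) * Y + p) = val t0 (2 * h) p (p + e) \<and>
           mem s (KB + p) \<le> mem s2 (KB + p) \<and> mem s2 (KB + p) \<le> mem s (KB + (p + 1)) \<and> opt t0 h p (p + e) (mem s2 (KB + p))) \<and>
          (\<forall>a<KB. \<not> (dst + (r + e) * Y \<le> a \<and> a < dst + (r + e) * Y + Y) \<longrightarrow> mem s2 a = mem s1 a)" for t2 s2
      proof -
        define s3 where "s3 = s2\<lparr>reg := (reg s2)(12 := r + (e + 1), 13 := e + 1)\<rparr>"
        have R2: "reg s2 12 = r + e" "reg s2 13 = e" using a s1 by auto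
        have small: "1 < (2::nat) ^ w" "r + e < 2 ^ w" "r + e + 1 < 2 ^ w" "e < 2 ^ w" "e + 1 < 2 ^ w"
          using V Y8 Y_le_KB e hY r T Y KB by linarith+
        have "J (e + 1) (\<lambda>p. mem s3 (KB + p))"
          using a by (intro JS[OF Is(4) e]) (auto simp: s3_def)
        moreover have "mem s3 (dst + (r + e') * Y + p) = val t0 (2 * h) p (p + e')" if "e' < e + 1" "p + e' < Y" for e' p
        proof (cases "e' = e")
          case True
          then show ?thesis using a that by (auto simp: s3_def)
        next
          case False
          then have e': "e' < e" using that by simp
          have p: "p < Y" using that by simp
          have "(r + e') * Y + p < (r + e) * Y" using e' p by (intro row_less) auto
          moreover have "dst + (r + e') * Y + p < KB" using e' e r p by (intro dst_less) auto
          ultimately have "mem s2 (dst + (r + e') * Y + p) = mem s (dst + (r + e') * Y + p)"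
            using a s1(5) by auto
          then show ?thesis using Is(5) e' that by (simp add: s3_def)
        qed
        moreover have "mem s3 a' = mem s0 a'" if "a' < KB" "\<not> (dst + r * Y \<le> a' \<and> a' < dst + (r + (e + 1)) * Y)" for a'
        proof -
          have le: "r * Y \<le> (r + e) * Y" "(r + e) * Y \<le> (r + (e + 1)) * Y" "(r + e) * Y + Y = (r + (e + 1)) * Y"
            by (auto simp: algebra_simps)
          then have "\<not> (dst + (r + e) * Y \<le> a' \<and> a' < dst + (r + e) * Y + Y)"
            "\<not> (dst + r * Y \<le> a' \<and> a' < dst + (r + e) * Y)" using that(2) by linarith+
          then have "mem s2 a' = mem s1 a'" "mem s a' = mem s0 a'" using a Is(6) that(1) by blast+
          then have "mem s2 a' = mem s a'" "mem s a' = mem s0 a'" using s1(5) by simp_all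
          then show ?thesis by (simp add: s3_def)
        qed
        moreover have "\<forall>x<12. reg s3 x = reg s0 x" using a Is(3) by (auto simp: s3_def s1_def)
        moreover have "t2 + 8 \<le> t + 20 * Y + 30 + (270 * Y + 40) * (e + 1)" using a Is(2) by simp
        ultimately have "I (t2 + 8) s3" using e unfolding I_def
          by (intro exI[of _ "e + 1"]) (auto simp: s3_def)
        \<comment> \<open>Simplification expands the accumulated unit costs into successors; folding
          them back makes the established invariant applicable.\<close>
        have t8: "Suc (Suc (Suc (Suc (Suc (Suc (Suc (Suc t2))))))) = t2 + 8" by simp
        show ?thesis using small R2 e \<open>I (t2 + 8) s3\<close>
          by (simp add: block_post_def wp_simps s3_def e_def[symmetric] Suc_diff_le t8)
      qed
      then have "wp w m sweep (wp w m block_post (\<lambda>t' s'. I t' s' \<and> 4 * h + 1 - reg s' 13 < 4 * h + 1 - reg s 13)) (t' + 10) s1"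
        by (rule wp_mono[OF sw])
      moreover have t10: "Suc (Suc (Suc (Suc (Suc (Suc (Suc (Suc (Suc (Suc t'))))))))) = t' + 10" by simp
      ultimately show ?thesis by (simp add: block_body_def wp_Seq wp_Assign c_def s1_def t10)
    qed
  qed
  have "wp w m init (\<lambda>t' s'. t' \<le> t + 20 * Y + 20 \<and> (\<forall>r<14. reg s' r = reg s0 r) \<and>
    (\<forall>p\<le>Y. mem s' (KB + p) = p) \<and> (\<forall>a<KB. mem s' a = mem s0 a)) t s0"
    using s by (intro init_correct) (simp add: inputs_def)
  then show ?thesis unfolding block_prog_def wp_Seq
  proof (rule wp_mono)
    fix t1 and s1 :: ram_state
    assume a: "t1 \<le> t + 20 * Y + 20 \<and> (\<forall>r<14. reg s1 r = reg s0 r) \<and>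
      (\<forall>p\<le>Y. mem s1 (KB + p) = p) \<and> (\<forall>a<KB. mem s1 a = mem s0 a)"
    define s2 where "s2 = s1\<lparr>reg := (reg s1)(13 := 0)\<rparr>"
    have "J 0 (\<lambda>p. mem s2 (KB + p))" using a by (intro J0) (auto simp: s2_def)
    then have "I (t1 + 2) s2" using a r by (auto simp: I_def s2_def)
    from loop[OF this] show "wp w m (Assign 13 (Const 0)) (wp w m (While (less_e rE (plus_e (times_e (Const 4) rH) (Const 1))) block_body)
       (\<lambda>t' s'. t' \<le> t + 2000 * h * Y \<and> (\<forall>x<12. reg s' x = reg s0 x) \<and>
     reg s' 12 = r + (4 * h + 1) \<and>
     (\<forall>e p. e \<le> 4 * h \<longrightarrow> p + e < Y \<longrightarrow> mem s' (dst + (r + e) * Y + p) = val t0 (2 * h) p (p + e)) \<and>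
     (\<forall>a<KB. \<not> (dst + r * Y \<le> a \<and> a < dst + (r + (4 * h + 1)) * Y) \<longrightarrow> mem s' a = mem s0 a))) t1 s1"
      by (simp add: wp_Assign s2_def c_def)
  qed
qed

end

section \<open>Rounds of merging\<close>

definition level_pre :: prog where
  "level_pre = Assign 11 (plus_e rA (plus_e (times_e (Const 2) rH) (Const 1)))"

definition level_post :: prog where
  "level_post = Seq (Assign 10 (plus_e rB (plus_e (times_e (Const 2) rH) (Const 1))))
     (Assign 9 (plus_e rS (times_e (Const 2) rH)))"

definition level_body :: prog where
  "level_body = Seq level_pre (Seq block_prog level_post)"

definition level_init :: prog where
  "level_init = Seq (Assign 9 (Const 0)) (Seq (Assign 10 (Const 0)) (Assign 12 (Const 0)))"

text \<open>The layer counter in register 9 is free after the loop and serves as temporary storage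
  for the exchange of the two tables.\<close>

definition level_swap :: prog where
  "level_swap = Seq (Assign 9 rSrc) (Seq (Assign 6 rDst) (Seq (Assign 7 rS) (Assign 5 (times_e (Const 2) rH))))"

definition level :: prog where
  "level = Seq level_init (Seq (While (less_e rS rT) level_body) level_swap)"

definition levels :: prog where
  "levels = While (less_e rH rT) level"

context machine
begin

text \<open>Block \<open>z\<close> of height \<open>h\<close> starts at layer \<open>z * h\<close>; its entries \<open>(p, p + e)\<close> form the memory row
  \<open>z * (2 * h + 1) + e\<close>, relative to the base address \<open>b\<close>.\<close>

definition table :: "nat \<Rightarrow> nat \<Rightarrow> ram_state \<Rightarrow> bool" where
  "table b h s \<longleftrightarrow> (\<forall>z e p. z * h < T \<longrightarrow> e \<le> 2 * h \<longrightarrow> p + e < Y \<longrightarrow>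
     mem s (b + (z * (2 * h + 1) + e) * Y + p) = val (z * h) h p (p + e))"

lemma T_le_Y: "T \<le> Y" using Y by simp

text \<open>\<open>k\<close> is the number of pairs of blocks. Each merge costs a multiple of
  \<open>h * Y\<close>, and \<open>h * k = T / 2\<close>, so the cost of a round does not depend on
  \<open>h\<close>.\<close>

lemma level_correct:
  assumes s: "globals s0" "reg s0 5 = h" "reg s0 6 = src" "reg s0 7 = dst"
    and h: "0 < h" "2 * h * k = T"
    and src: "src + 3 * T * Y \<le> KB" and dst: "dst + 3 * T * Y \<le> KB"
    and disj: "src + 3 * T * Y \<le> dst \<or> dst + 3 * T * Y \<le> src"
    and tab: "table src h s0"
  shows "wp w m level (\<lambda>t' s'. t' \<le> t + 1200 * (T * Y) \<and> globals s' \<and> reg s' 5 = 2 * h \<and>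
     reg s' 6 = dst \<and> reg s' 7 = src \<and> table dst (2 * h) s') t s0"
proof -
  define I :: "nat \<Rightarrow> ram_state \<Rightarrow> bool" where "I t' s \<longleftrightarrow> (\<exists>j. reg s 9 = 2 * h * j \<and> j \<le> k \<and>
     reg s 10 = 2 * j * (2 * h + 1) \<and> reg s 12 = j * (4 * h + 1) \<and>
     t' \<le> t + 6 + (2000 * h * Y + 60) * j \<and> (\<forall>x<9. reg s x = reg s0 x) \<and>
     (\<forall>z e p. z < j \<longrightarrow> e \<le> 4 * h \<longrightarrow> p + e < Y \<longrightarrow>
        mem s (dst + (z * (4 * h + 1) + e) * Y + p) = val (z * (2 * h)) (2 * h) p (p + e)) \<and>
     (\<forall>a<KB. \<not> (dst \<le> a \<and> a < dst + 3 * T * Y) \<longrightarrow> mem s a = mem s0 a))" for t' s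
  have V: "KB + Y + 2 \<le> 2 ^ w" using m mw by linarith
  have "6 * T * 1 \<le> 6 * T * Y" using Y8 by (intro mult_left_mono) auto
  then have KBT: "6 * T \<le> KB" using KB by linarith
  have k: "2 * k \<le> T" "2 * h \<le> T"
  proof -
    have "2 * 1 * k \<le> 2 * h * k" using h by (intro mult_right_mono mult_left_mono) auto
    then show "2 * k \<le> T" using h by simp
    have "0 < k" using h T4 by (cases k) auto
    then have "2 * h * 1 \<le> 2 * h * k" by (intro mult_left_mono) auto
    then show "2 * h \<le> T" using h by simp
  qed
  have R: "reg s 0 = n" "reg s 2 = T" "reg s 3 = Y" "reg s 5 = h" "reg s 6 = src" "reg s 7 = dst" "globals s"
    if "I t' s" for t' s
    using s that globals_cong[of s0 s] by (auto simp: I_def globals_def)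
  have loop: "wp w m (While (less_e rS rT) level_body)
     (\<lambda>t' s'. t' \<le> t + 6 + (2000 * h * Y + 60) * k + 10 \<and> (\<forall>x<9. reg s' x = reg s0 x) \<and> table dst (2 * h) s') t1 s1"
    if "I t1 s1" for t1 s1
    using that
  proof (rule wp_While[where I = I and \<mu> = "\<lambda>s. T - reg s 9"])
    fix t' s assume I: "I t' s"
    then obtain j where j: "reg s 9 = 2 * h * j" "j \<le> k" by (auto simp: I_def)
    have "2 * h * j \<le> T" using mult_le_mono2[OF j(2), of "2 * h"] h by simp
    then have "reg s 9 < 2 ^ w" "T < 2 ^ w" "1 < (2::nat) ^ w" using j T_le_Y V Y8 by linarith+
    then show "fits w m (less_e rS rT) s" using R[OF I] by (simp add: of_bool_def)
  next
    fix t' s assume I: "I t' s" and c: "eval_expr (less_e rS rT) s = 0"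
    then obtain j where j: "reg s 9 = 2 * h * j" "j \<le> k" "t' \<le> t + 6 + (2000 * h * Y + 60) * j"
      "\<forall>z e p. z < j \<longrightarrow> e \<le> 4 * h \<longrightarrow> p + e < Y \<longrightarrow>
        mem s (dst + (z * (4 * h + 1) + e) * Y + p) = val (z * (2 * h)) (2 * h) p (p + e)" by (auto simp: I_def)
    have "T \<le> 2 * h * j" using c R[OF I] j by auto
    then have "2 * h * k \<le> 2 * h * j" using h by simp
    then have [simp]: "j = k" using h j(2) by auto
    have "z < k" if "z * (2 * h) < T" for z
    proof -
      have "2 * h * z < 2 * h * k" using that h by (simp add: mult.commute)
      then show ?thesis by (metis mult_less_cancel1)
    qed
    then have "table dst (2 * h) s" using j(4) unfolding table_def by auto
    then show "t' + (1 + expr_cost (less_e rS rT)) \<le> t + 6 + (2000 * h * Y + 60) * k + 10 \<and>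
      (\<forall>x<9. reg s x = reg s0 x) \<and> table dst (2 * h) s" using I j by (auto simp: I_def)
  next
    fix t' s assume I: "I t' s" and c: "eval_expr (less_e rS rT) s \<noteq> 0"
    then obtain j where j: "reg s 9 = 2 * h * j" "j \<le> k" "t' \<le> t + 6 + (2000 * h * Y + 60) * j"
      "reg s 10 = 2 * j * (2 * h + 1)" "reg s 12 = j * (4 * h + 1)" "\<forall>x<9. reg s x = reg s0 x"
      "\<forall>z e p. z < j \<longrightarrow> e \<le> 4 * h \<longrightarrow> p + e < Y \<longrightarrow>
        mem s (dst + (z * (4 * h + 1) + e) * Y + p) = val (z * (2 * h)) (2 * h) p (p + e)"
      "\<forall>a<KB. \<not> (dst \<le> a \<and> a < dst + 3 * T * Y) \<longrightarrow> mem s a = mem s0 a" by (auto simp: I_def)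
    have "2 * h * j < 2 * h * k" using c R[OF I] j h by auto
    then have jk: "j + 1 \<le> k" by simp
    define ra where "ra = 2 * j * (2 * h + 1)"
    define rb where "rb = ra + (2 * h + 1)"
    define r where "r = j * (4 * h + 1)"
    have ra': "rb + (2 * h + 1) = 2 * (j + 1) * (2 * h + 1)" by (simp add: ra_def rb_def algebra_simps)
    \<comment> \<open>The \<open>2 * k\<close> old blocks occupy \<open>2 * T + 2 * k\<close> rows
      and the \<open>k\<close> new ones \<open>2 * T + k\<close>; both fit into \<open>3 * T\<close>
      rows because \<open>2 * k <= T\<close>.\<close>
    have "2 * (j + 1) * (2 * h + 1) \<le> 2 * k * (2 * h + 1)" using jk by (intro mult_right_mono mult_left_mono) auto
    also have "\<dots> = 2 * T + 2 * k" using h(2) by (simp add: algebra_simps)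
    finally have rbT: "rb + (2 * h + 1) \<le> 3 * T" using k ra' by simp
    have r': "r + (4 * h + 1) = (j + 1) * (4 * h + 1)" by (simp add: r_def algebra_simps)
    have "(j + 1) * (4 * h + 1) \<le> k * (4 * h + 1)" using jk by (intro mult_right_mono) auto
    also have "\<dots> = 2 * T + k" using h(2) by (simp add: algebra_simps)
    finally have rT: "r + (4 * h + 1) \<le> 3 * T" using k r' by simp
    interpret B: block n W c d T Y KB w m h src dst ra rb "2 * j * h"
      using h k src dst disj rbT rb_def by unfold_locales auto
    define s1 where "s1 = s\<lparr>reg := (reg s)(11 := rb)\<rparr>"
    have inputs: "B.inputs s1"
    proof -
      have G: "globals s1" using R[OF I] by (auto simp: s1_def globals_def)
      have jT: "2 * j * h < T" "(2 * j + 1) * h < T"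
      proof -
        have "(2 * j + 2) * h \<le> 2 * k * h" using jk by (intro mult_right_mono) auto
        also have "\<dots> = T" using h by (simp add: ac_simps)
        finally show "2 * j * h < T" "(2 * j + 1) * h < T" using h(1) by (auto simp: algebra_simps)
      qed
      have tab_s: "mem s (src + x * Y + p) = mem s0 (src + x * Y + p)" if "x < 3 * T" "p < Y" for x p
      proof -
        have "x * Y + p < 3 * T * Y" using that by (rule row_less)
        then have "src + x * Y + p < KB" "\<not> (dst \<le> src + x * Y + p \<and> src + x * Y + p < dst + 3 * T * Y)"
          using src disj by linarith+
        then show ?thesis using j(8) by blast
      qed
      have "mem s1 (src + (ra + e) * Y + p) = val (2 * j * h) h p (p + e) \<and>
        mem s1 (src + (rb + e) * Y + p) = val (2 * j * h + h) h p (p + e)" if "e \<le> 2 * h" "p + e < Y" for e p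
      proof -
        have "ra + e < 3 * T" "rb + e < 3 * T" "p < Y" using that rbT rb_def by auto
        then have "mem s1 (src + (ra + e) * Y + p) = mem s0 (src + (2 * j * (2 * h + 1) + e) * Y + p)"
          "mem s1 (src + (rb + e) * Y + p) = mem s0 (src + ((2 * j + 1) * (2 * h + 1) + e) * Y + p)"
          using tab_s[of "ra + e" p] tab_s[of "rb + e" p] by (simp_all add: s1_def ra_def rb_def algebra_simps)
        moreover have "mem s0 (src + (2 * j * (2 * h + 1) + e) * Y + p) = val (2 * j * h) h p (p + e)"
          "mem s0 (src + ((2 * j + 1) * (2 * h + 1) + e) * Y + p) = val ((2 * j + 1) * h) h p (p + e)"
          using tab jT that unfolding table_def by blast+
        moreover have eq: "(2 * j + 1) * h = 2 * j * h + h" by simp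
        ultimately show ?thesis by (simp only: eq simp_thms)
      qed
      then show ?thesis using G R[OF I] j unfolding B.inputs_def by (simp add: s1_def ra_def)
    qed
    have block: "wp w m block_prog (\<lambda>t'' s'. t'' \<le> t' + 12 + 2000 * h * Y \<and> (\<forall>x<12. reg s' x = reg s1 x) \<and>
     reg s' 12 = r + (4 * h + 1) \<and>
     (\<forall>e p. e \<le> 4 * h \<longrightarrow> p + e < Y \<longrightarrow> mem s' (dst + (r + e) * Y + p) = val (2 * j * h) (2 * h) p (p + e)) \<and>
     (\<forall>a<KB. \<not> (dst + r * Y \<le> a \<and> a < dst + (r + (4 * h + 1)) * Y) \<longrightarrow> mem s' a = mem s1 a)) (t' + 12) s1"
      using inputs rT j(5) by (intro B.block_correct) (auto simp: s1_def r_def)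
    have after: "wp w m level_post (\<lambda>t' s'. I t' s' \<and> T - reg s' 9 < T - reg s 9) t2 s2"
      if a: "t2 \<le> t' + 12 + 2000 * h * Y \<and> (\<forall>x<12. reg s2 x = reg s1 x) \<and>
       reg s2 12 = r + (4 * h + 1) \<and>
       (\<forall>e p. e \<le> 4 * h \<longrightarrow> p + e < Y \<longrightarrow> mem s2 (dst + (r + e) * Y + p) = val (2 * j * h) (2 * h) p (p + e)) \<and>
       (\<forall>a<KB. \<not> (dst + r * Y \<le> a \<and> a < dst + (r + (4 * h + 1)) * Y) \<longrightarrow> mem s2 a = mem s1 a)" for t2 s2
    proof -
      define s3 where "s3 = s2\<lparr>reg := (reg s2)(10 := rb + (2 * h + 1), 9 := 2 * h * j + 2 * h)\<rparr>"
      have R2: "reg s2 11 = rb" "reg s2 9 = 2 * h * j" "reg s2 5 = h"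
        using a j R[OF I] by (auto simp: s1_def)
      have jT: "2 * h * j + 2 * h \<le> T"
      proof -
        have "2 * h * (j + 1) \<le> 2 * h * k" using jk by (intro mult_left_mono) auto
        then show ?thesis using h by simp
      qed
      have "mem s3 (dst + (z * (4 * h + 1) + e) * Y + p) = val (z * (2 * h)) (2 * h) p (p + e)"
        if z: "z < j + 1" "e \<le> 4 * h" "p + e < Y" for z e p
      proof (cases "z = j")
        case True
        then have eq: "z * (2 * h) = 2 * j * h" "z * (4 * h + 1) = r" by (simp_all add: r_def)
        have "mem s2 (dst + (r + e) * Y + p) = val (2 * j * h) (2 * h) p (p + e)" using a z by blast
        then show ?thesis unfolding eq by (simp add: s3_def)
      next
        case False
        then have zj: "z < j" using z by simp
        then have row: "z * (4 * h + 1) + e < r" unfolding r_def using z by (intro row_less) auto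
        then have "(z * (4 * h + 1) + e) * Y + p < r * Y" using z by (intro row_less) auto
        moreover have "r * Y \<le> 3 * T * Y" using rT by (intro mult_right_mono) auto
        ultimately have "dst + (z * (4 * h + 1) + e) * Y + p < KB"
          "\<not> dst + r * Y \<le> dst + (z * (4 * h + 1) + e) * Y + p" using dst by linarith+
        then have "mem s2 (dst + (z * (4 * h + 1) + e) * Y + p) = mem s1 (dst + (z * (4 * h + 1) + e) * Y + p)"
          using a by blast
        then show ?thesis using j(7) zj z by (simp add: s3_def s1_def)
      qed
      moreover have "mem s3 a' = mem s0 a'" if a': "a' < KB" "\<not> (dst \<le> a' \<and> a' < dst + 3 * T * Y)" for a'
      proof -
        have "(r + (4 * h + 1)) * Y \<le> 3 * T * Y" using rT by (intro mult_right_mono) auto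
        then have "\<not> (dst + r * Y \<le> a' \<and> a' < dst + (r + (4 * h + 1)) * Y)" using a' by linarith
        then have "mem s2 a' = mem s1 a'" using a a' by blast
        then show ?thesis using j(8) a' by (simp add: s3_def s1_def)
      qed
      moreover have "\<forall>x<9. reg s3 x = reg s0 x" using a j(6) by (auto simp: s3_def s1_def)
      moreover have "t2 + 16 \<le> t + 6 + (2000 * h * Y + 60) * (j + 1)" using a j(3) by simp
      moreover have "reg s3 12 = (j + 1) * (4 * h + 1)" "reg s3 10 = 2 * (j + 1) * (2 * h + 1)"
        "reg s3 9 = 2 * h * (j + 1)"
        using a r' ra' by (simp_all add: s3_def)
      ultimately have I': "I (t2 + 14) s3" using jk unfolding I_def
        by (intro exI[of _ "j + 1"]) auto
      have t14: "Suc (Suc (Suc (Suc (Suc (Suc (Suc (Suc (Suc (Suc (Suc (Suc (Suc (Suc t2))))))))))))) = t2 + 14" by simp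
      have "rb + (2 * h + 1) < 2 ^ w" "rb < 2 ^ w" "2 * h + 1 < 2 ^ w" "2 * h < 2 ^ w" "h < 2 ^ w"
        "2 < (2::nat) ^ w" "1 < (2::nat) ^ w" "2 * h * j + 2 * h < 2 ^ w" "2 * h * j < 2 ^ w"
        using rbT KBT V jT T4 Y8 by linarith+
      moreover have "T - (2 * h * j + 2 * h) < T - 2 * h * j" using jT h by linarith
      ultimately show ?thesis using I' R2 j(1)
        by (simp add: level_post_def wp_simps s3_def t14)
    qed
    have "wp w m block_prog (wp w m level_post (\<lambda>t' s'. I t' s' \<and> T - reg s' 9 < T - reg s 9)) (t' + 12) s1"
      by (rule wp_mono[OF block]) (rule after)
    moreover have t12: "Suc (Suc (Suc (Suc (Suc (Suc (Suc (Suc (Suc (Suc (Suc (Suc t'))))))))))) = t' + 12" by simp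
    moreover have "reg s 10 = ra" "Suc (ra + 2 * h) = rb" using j(4) by (simp_all add: ra_def rb_def)
    moreover have "rb < 2 ^ w" "ra < 2 ^ w" "2 * h + 1 < 2 ^ w" "2 * h < 2 ^ w" "h < 2 ^ w"
        "2 < (2::nat) ^ w" "1 < (2::nat) ^ w"
        using rbT rb_def KBT V T4 Y8 by linarith+
    ultimately show "wp w m level_body (\<lambda>t' s'. I t' s' \<and> T - reg s' 9 < T - reg s 9) (t' + (1 + expr_cost (less_e rS rT))) s"
      using j(1) R(1-6)[OF I] by (simp add: level_body_def level_pre_def wp_Seq wp_Assign s1_def t12)
  qed
  define s1 where "s1 = s0\<lparr>reg := (reg s0)(9 := 0, 10 := 0, 12 := 0)\<rparr>"
  have "I (t + 6) s1" by (auto simp: I_def s1_def)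
  from loop[OF this] have "wp w m (While (less_e rS rT) level_body) (wp w m level_swap
    (\<lambda>t' s'. t' \<le> t + 1200 * (T * Y) \<and> globals s' \<and> reg s' 5 = 2 * h \<and>
     reg s' 6 = dst \<and> reg s' 7 = src \<and> table dst (2 * h) s')) (t + 6) s1"
  proof (rule wp_mono)
    fix t2 and s2 :: ram_state
    assume a: "t2 \<le> t + 6 + (2000 * h * Y + 60) * k + 10 \<and> (\<forall>x<9. reg s2 x = reg s0 x) \<and> table dst (2 * h) s2"
    have R2: "reg s2 5 = h" "reg s2 6 = src" "reg s2 7 = dst" "globals s2"
      using a s globals_cong[of s0 s2] by auto
    have v: "src < 2 ^ w" "dst < 2 ^ w" "h < 2 ^ w" "2 * h < 2 ^ w" "2 < (2::nat) ^ w"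
      using src dst V k T_le_Y Y8 by linarith+
    \<comment> \<open>This is where the height cancels, by \<open>2 * h * k = T\<close>.\<close>
    have "(2000 * h * Y + 60) * k = 1000 * (T * Y) + 60 * k" using h(2) by (simp add: algebra_simps)
    moreover have "T * 8 \<le> T * Y" using Y8 by (intro mult_left_mono) auto
    ultimately have time: "t2 + 12 \<le> t + 1200 * (T * Y)" using a k T4 by linarith
    have "table dst (2 * h) (s2\<lparr>reg := f\<rparr>)" for f using a by (simp add: table_def)
    moreover have "globals (s2\<lparr>reg := (reg s2)(9 := src, 6 := dst, 7 := src, 5 := 2 * h)\<rparr>)"
      using R2 by (simp add: globals_def)
    ultimately show "wp w m level_swap
    (\<lambda>t' s'. t' \<le> t + 1200 * (T * Y) \<and> globals s' \<and> reg s' 5 = 2 * h \<and>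
     reg s' 6 = dst \<and> reg s' 7 = src \<and> table dst (2 * h) s') t2 s2"
      using v R2 time by (simp add: level_swap_def wp_simps)
  qed
  moreover have t6: "Suc (Suc (Suc (Suc (Suc (Suc t))))) = t + 6" by simp
  ultimately show ?thesis by (simp add: level_def level_init_def wp_Seq wp_Assign s1_def t6)
qed

text \<open>Doubling the height \<open>L\<close> times leaves one block of height \<open>T\<close>,
  starting at layer 0.\<close>

lemma levels_correct:
  assumes s: "globals s0" "reg s0 5 = 1" "reg s0 6 = n * n" "reg s0 7 = n * n + 3 * T * Y" "table (n * n) 1 s0"
    and L: "T = 2 ^ L"
  shows "wp w m levels (\<lambda>t' s'. t' \<le> t + 1300 * (T * Y) * L + 10 \<and> globals s' \<and>
     reg s' 6 + 3 * T * Y \<le> KB \<and> table (reg s' 6) T s') t s0"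
proof -
  \<comment> \<open>The equation between the two-element sets leaves open which buffer is currently
    the source; it changes in every round.\<close>
  define I :: "nat \<Rightarrow> ram_state \<Rightarrow> bool" where "I t' s \<longleftrightarrow> (\<exists>j. reg s 5 = 2 ^ j \<and> j \<le> L \<and> globals s \<and>
     {reg s 6, reg s 7} = {n * n, n * n + 3 * T * Y} \<and> table (reg s 6) (2 ^ j) s \<and>
     t' \<le> t + 1300 * (T * Y) * j)" for t' s
  have V: "KB + Y + 2 \<le> 2 ^ w" using m mw by linarith
  have R: "reg s 2 = T" if "I t' s" for t' s using that by (auto simp: I_def globals_def)
  have bufs: "reg s 6 + 3 * T * Y \<le> KB" "reg s 7 + 3 * T * Y \<le> KB"
    "reg s 6 + 3 * T * Y \<le> reg s 7 \<or> reg s 7 + 3 * T * Y \<le> reg s 6" if "I t' s" for t' s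
    using that KB by (auto simp: I_def doubleton_eq_iff)
  show ?thesis unfolding levels_def
  proof (rule wp_While[where I = I and \<mu> = "\<lambda>s. T - reg s 5"])
    show "I t s0" using s by (auto simp: I_def intro!: exI[of _ 0])
  next
    fix t' s assume I: "I t' s"
    then obtain j where j: "reg s 5 = 2 ^ j" "j \<le> L" by (auto simp: I_def)
    then have "reg s 5 \<le> T" using L by simp
    then have "reg s 5 < 2 ^ w" "T < 2 ^ w" "1 < (2::nat) ^ w" using T_le_Y V Y8 by linarith+
    then show "fits w m (less_e rH rT) s" using R[OF I] by (simp add: of_bool_def)
  next
    fix t' s assume I: "I t' s" and c: "eval_expr (less_e rH rT) s = 0"
    then obtain j where j: "reg s 5 = 2 ^ j" "j \<le> L" "globals s" "table (reg s 6) (2 ^ j) s"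
      "t' \<le> t + 1300 * (T * Y) * j" by (auto simp: I_def)
    have "(2::nat) ^ L \<le> 2 ^ j" using c R[OF I] j L by auto
    then have "j = L" using j(2) by simp
    then show "t' + (1 + expr_cost (less_e rH rT)) \<le> t + 1300 * (T * Y) * L + 10 \<and> globals s \<and>
     reg s 6 + 3 * T * Y \<le> KB \<and> table (reg s 6) T s"
      using j L bufs[OF I] by simp
  next
    fix t' s assume I: "I t' s" and c: "eval_expr (less_e rH rT) s \<noteq> 0"
    then obtain j where j: "reg s 5 = 2 ^ j" "j \<le> L" "globals s" "table (reg s 6) (2 ^ j) s"
      "{reg s 6, reg s 7} = {n * n, n * n + 3 * T * Y}"
      "t' \<le> t + 1300 * (T * Y) * j" by (auto simp: I_def)
    have "(2::nat) ^ j < 2 ^ L" using c R[OF I] j L by auto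
    then have jL: "j < L" by simp
    then have hk: "2 * 2 ^ j * 2 ^ (L - Suc j) = T"
      using L by (simp add: power_add[symmetric] power_Suc[symmetric] del: power_Suc)
    have t4: "t' + (1 + expr_cost (less_e rH rT)) = t' + 4" by simp
    have "wp w m level (\<lambda>t'' s'. t'' \<le> t' + 4 + 1200 * (T * Y) \<and> globals s' \<and> reg s' 5 = 2 * 2 ^ j \<and>
       reg s' 6 = reg s 7 \<and> reg s' 7 = reg s 6 \<and> table (reg s 7) (2 * 2 ^ j) s') (t' + 4) s"
      using j bufs[OF I] hk by (intro level_correct) auto
    then show "wp w m level (\<lambda>t'' s'. I t'' s' \<and> T - reg s' 5 < T - reg s 5) (t' + (1 + expr_cost (less_e rH rT))) s"
      unfolding t4
    proof (rule wp_mono)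
      fix t'' and s' :: ram_state
      assume a: "t'' \<le> t' + 4 + 1200 * (T * Y) \<and> globals s' \<and> reg s' 5 = 2 * 2 ^ j \<and>
       reg s' 6 = reg s 7 \<and> reg s' 7 = reg s 6 \<and> table (reg s 7) (2 * 2 ^ j) s'"
      have "T * 8 \<le> T * Y" using Y8 by (intro mult_left_mono) auto
      moreover have "t'' \<le> t' + 4 + 1200 * (T * Y)" using a by simp
      moreover have "1300 * (T * Y) * Suc j = 1300 * (T * Y) * j + 1300 * (T * Y)" by simp
      ultimately have "t'' \<le> t + 1300 * (T * Y) * Suc j" using j(6) T4 by linarith
      then have "I t'' s'" using a j jL unfolding I_def
        by (intro exI[of _ "Suc j"]) auto
      moreover have "2 * 2 ^ j \<le> T" using jL L power_increasing[of "Suc j" L "2::nat"] by simp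
      then have "T - 2 * 2 ^ j < T - 2 ^ j" by (intro diff_less_mono2) (auto intro: less_le_trans[rotated])
      ultimately show "I t'' s' \<and> T - reg s' 5 < T - reg s 5" using a j by simp
    qed
  qed
qed

end

section \<open>The complete program\<close>

definition doubling :: prog where
  "doubling = While (less_e rT (times_e (Const 2) rN)) (Assign 2 (times_e (Const 2) rT))"

text \<open>The bound \<open>c\<close> enters as a literal, so it is a constant of the program; from
  it the prohibitive cost in register 4 and the infinity in register 1 are computed.\<close>

definition setup_regs :: "nat \<Rightarrow> prog" where
  "setup_regs c =
     Seq (Assign 3 (times_e (Const 2) rT))
    (Seq (Assign 4 (times_e (Const (c + 1)) rN))
    (Seq (Assign 1 (times_e (plus_e rT (Const 1)) rW))
    (Seq (Assign 6 (times_e rN rN))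
    (Seq (Assign 7 (plus_e rSrc (times_e (times_e (Const 3) rT) rY)))
    (Seq (Assign 8 (plus_e rSrc (times_e (times_e (Const 6) rT) rY)))
    (Seq (Assign 5 (Const 1))
         (Assign 9 (Const 0))))))))"

definition setup_prog :: "nat \<Rightarrow> prog" where
  "setup_prog c = Seq (Assign 2 (Const 1)) (Seq doubling (setup_regs c))"

text \<open>A single running cell counter suffices: its remainder modulo \<open>Y\<close> is the
  position, and its quotient splits into layer and increment, because a block of height 1 has three
  rows.\<close>

definition fill_pre :: prog where
  "fill_pre =
     Seq (Assign 14 (Binop Mod rS rY))
    (Seq (Assign 12 (Binop Div rS rY))
    (Seq (Assign 10 (Binop Div rR (Const 3)))
    (Seq (Assign 13 (Binop Mod rR (Const 3)))
    (Seq (Assign 15 (plus_e rP rE))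
    (Seq (Assign 16 (Binop Div rQ (Const 2)))
         (Assign 17 (minus_e (plus_e rA (Const 1)) rHi)))))))"

text \<open>Truth values are 0 and 1, so products are conjunctions. The factors mirror the
  conditions in \<open>base\<close>, including the truncated \<open>x\<close>.\<close>

definition fill_test :: expr where
  "fill_test = times_e
     (times_e (Binop Eq (Binop Mod rQ (Const 2)) (Const 0)) (less_e (Binop Eq rE (Const 0)) rK))
     (times_e (less_e (plus_e rK (Binop Eq rE (Const 2))) rHi) (less_e rHi (plus_e rN (Const 1))))"

definition fill_value :: prog where
  "fill_value =
     Cond fill_test
       (Assign 20 (Load (plus_e (times_e (minus_e rK (Const 1)) rN) (minus_e rHi (Const 1)))))
       (Cond (Binop Eq rE (Const 1)) (Assign 20 (Const 0)) (Assign 20 rW))"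

definition fill_post :: prog where
  "fill_post = Seq (Store (plus_e rSrc rS) rV) (Assign 9 (plus_e rS (Const 1)))"

definition fill_body :: prog where
  "fill_body = Seq fill_pre (Seq fill_value fill_post)"

definition fill :: prog where
  "fill = While (less_e rS (times_e (times_e (Const 3) rT) rY)) fill_body"

definition answer_body :: prog where
  "answer_body =
     Seq (Assign 12 (Load (entry_e rSrc (minus_e (plus_e rT rN) (times_e (Const 2) rS)) rS)))
    (Seq (Cond (less_e rR rA) (Seq (Assign 10 rR) (Assign 11 rS)) Skip)
         (Assign 9 (plus_e rS (Const 1))))"

definition answer_loop :: prog where
  "answer_loop = While (less_e rS rN) answer_body"

definition answer :: prog where
  "answer =
     Seq (Assign 9 (Const 1))
    (Seq (Assign 10 rInf)
    (Seq (Assign 11 (Const 0))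
    (Seq answer_loop
    (Seq (Assign 0 rB) (Assign 1 rA)))))"

definition sqrt_dtw_prog :: "nat \<Rightarrow> prog" where
  "sqrt_dtw_prog c = Seq (setup_prog c) (Seq fill (Seq levels answer))"

section \<open>Correctness of the complete program\<close>

context machine
begin

lemma base_fits: "KB + Y + 2 \<le> 2 ^ w"
  using m mw by linarith

lemma T_le_TY: "8 * T \<le> T * Y"
  using mult_le_mono2[OF Y8, of T] by (simp add: mult.commute)

lemma TY_le_KB: "6 * (T * Y) \<le> KB"
  using KB by simp

lemma n_le_KB: "n * n \<le> KB" "n * n + 3 * T * Y \<le> KB"
  using KB by simp_all

text \<open>Minimality of \<open>L\<close> identifies the number at which the doubling loop stops
  with the fixed \<open>T\<close> of the locale.\<close>

lemma setup_correct:
  assumes r: "reg s0 0 = n" and L: "T = 2 ^ L" "\<And>j. 2 * n \<le> 2 ^ j \<Longrightarrow> L \<le> j"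
  shows "wp w m (setup_prog c) (\<lambda>t' s'. t' \<le> t + 10 * T + 100 \<and> mem s' = mem s0 \<and> globals s' \<and>
     reg s' 5 = 1 \<and> reg s' 6 = n * n \<and> reg s' 7 = n * n + 3 * T * Y \<and> reg s' 9 = 0) t s0"
proof -
  define e where "e = less_e rT (times_e (Const 2) rN)"
  define I :: "nat \<Rightarrow> ram_state \<Rightarrow> bool" where "I t' s \<longleftrightarrow> (\<exists>j. reg s 2 = 2 ^ j \<and> j \<le> L \<and>
     reg s 0 = n \<and> mem s = mem s0 \<and> t' \<le> t + 2 + 10 * j)" for t' s
  have TV: "T < 2 ^ w" "2 * T < 2 ^ w" "n < 2 ^ w" "2 * n < 2 ^ w" "2 < (2::nat) ^ w" "1 < (2::nat) ^ w"
    "3 < (2::nat) ^ w" "6 < (2::nat) ^ w" "3 * T < 2 ^ w" "6 * T < 2 ^ w"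
    using base_fits Y_le_KB Y8 Y T T_le_TY TY_le_KB by linarith+
  have loop: "wp w m doubling (\<lambda>t' s'. t' \<le> t + 12 + 10 * L \<and> reg s' 2 = T \<and> reg s' 0 = n \<and> mem s' = mem s0) t1 s1"
    if "I t1 s1" for t1 s1
    using that unfolding doubling_def e_def[symmetric]
  proof (rule wp_While[where I = I and \<mu> = "\<lambda>s. T - reg s 2"])
    fix t' s assume I: "I t' s"
    then obtain j where j: "reg s 2 = 2 ^ j" "j \<le> L" by (auto simp: I_def)
    then have "reg s 2 \<le> T" using L by simp
    then show "fits w m e s" using I TV by (auto simp: e_def I_def of_bool_def)
  next
    fix t' s assume I: "I t' s" and c: "eval_expr e s = 0"
    then obtain j where j: "reg s 2 = 2 ^ j" "j \<le> L" "t' \<le> t + 2 + 10 * j" by (auto simp: I_def)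
    have "2 * n \<le> 2 ^ j" using c I j by (auto simp: e_def I_def)
    then have "j = L" using L(2) j(2) by (simp add: antisym)
    then show "t' + (1 + expr_cost e) \<le> t + 12 + 10 * L \<and> reg s 2 = T \<and> reg s 0 = n \<and> mem s = mem s0"
      using j I L(1) by (auto simp: e_def I_def)
  next
    fix t' s assume I: "I t' s" and c: "eval_expr e s \<noteq> 0"
    then obtain j where j: "reg s 2 = 2 ^ j" "j \<le> L" "t' \<le> t + 2 + 10 * j" "reg s 0 = n" "mem s = mem s0"
      by (auto simp: I_def)
    have "2 ^ j < 2 * n" using c I j by (auto simp: e_def I_def)
    then have "(2::nat) ^ j < 2 ^ L" using T L(1) by linarith
    then have "Suc j \<le> L" by simp
    then have T': "2 * 2 ^ j \<le> T" using L(1) power_increasing[of "Suc j" L "2::nat"] by simp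
    then have "T - 2 * 2 ^ j < T - 2 ^ j" by (intro diff_less_mono2) (auto intro: less_le_trans[rotated])
    moreover have "I (t' + 10) (s\<lparr>reg := (reg s)(2 := 2 * 2 ^ j)\<rparr>)"
      using j \<open>Suc j \<le> L\<close> unfolding I_def by (intro exI[of _ "Suc j"]) auto
    moreover have t10: "Suc (Suc (Suc (Suc (Suc (Suc (Suc (Suc (Suc (Suc t'))))))))) = t' + 10" by simp
    moreover have "2 ^ j < (2::nat) ^ w" "2 * 2 ^ j < (2::nat) ^ w" using T' TV by linarith+
    ultimately show "wp w m (Assign 2 (times_e (Const 2) rT)) (\<lambda>t'' s'. I t'' s' \<and> T - reg s' 2 < T - reg s 2) (t' + (1 + expr_cost e)) s"
      using j TV by (simp add: wp_Assign e_def t10)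
  qed
  have "I (t + 2) (s0\<lparr>reg := (reg s0)(2 := 1)\<rparr>)" using r by (auto simp: I_def intro!: exI[of _ 0])
  from loop[OF this] have "wp w m doubling (wp w m (setup_regs c) (\<lambda>t' s'. t' \<le> t + 10 * T + 100 \<and> mem s' = mem s0 \<and> globals s' \<and>
     reg s' 5 = 1 \<and> reg s' 6 = n * n \<and> reg s' 7 = n * n + 3 * T * Y \<and> reg s' 9 = 0)) (t + 2) (s0\<lparr>reg := (reg s0)(2 := 1)\<rparr>)"
  proof (rule wp_mono)
    fix t1 and s1 :: ram_state
    assume a: "t1 \<le> t + 12 + 10 * L \<and> reg s1 2 = T \<and> reg s1 0 = n \<and> mem s1 = mem s0"
    have "L < T" using L(1) less_exp by simp
    then have time: "t1 + 70 \<le> t + 10 * T + 100" using a by linarith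
    have W: "W < 2 ^ w" "(c + 1) < 2 ^ w"
    proof -
      have "1 * W \<le> (T + 1) * W" by (intro mult_right_mono) auto
      then show "W < 2 ^ w" "(c + 1) < 2 ^ w" using inf c_less_W by linarith+
    qed
    have "3 * T * Y < 2 ^ w" "6 * T * Y < 2 ^ w" "n * n < 2 ^ w" "n * n + 3 * T * Y < 2 ^ w" "KB < 2 ^ w" "T + 1 < 2 ^ w"
      "Y < 2 ^ w"
      using base_fits n_le_KB TY_le_KB T_le_TY T4 Y TV by linarith+
    note v = this
    define s2 where "s2 = s1\<lparr>reg := (reg s1)(3 := Y, 4 := W, 1 := (T + 1) * W, 6 := n * n,
      7 := n * n + 3 * T * Y, 8 := KB, 5 := 1, 9 := 0)\<rparr>"
    have eqs: "2 * T = Y" "n + c * n = W" "n * n + 6 * T * Y = KB" using Y KB by (simp_all add: W_def)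
    have "globals s2" using a by (simp add: s2_def globals_def)
    then show "wp w m (setup_regs c) (\<lambda>t' s'. t' \<le> t + 10 * T + 100 \<and> mem s' = mem s0 \<and> globals s' \<and>
     reg s' 5 = 1 \<and> reg s' 6 = n * n \<and> reg s' 7 = n * n + 3 * T * Y \<and> reg s' 9 = 0) t1 s1"
    proof -
      have R: "reg s1 2 = T" "reg s1 0 = n" "mem s1 = mem s0" using a by auto
      have f: "n + c * n < 2 ^ w" "n + c * n + T * (n + c * n) < 2 ^ w" using W inf eqs by auto
      have eqs': "6 * (T * T) = 3 * T * Y" "12 * (T * T) = 6 * T * Y" using Y by simp_all
      have small: "Suc c < 2 ^ w" "Suc 0 < 2 ^ w" "Suc T < 2 ^ w" using W TV v by simp_all
      have "t1 + 70 \<le> t + 10 * T + 100 \<Longrightarrow> ?thesis" unfolding setup_regs_def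
        by (simp add: wp_simps R TV v f small) (use \<open>globals s2\<close> in \<open>simp add: s2_def eqs eqs' v\<close>)
      with time show ?thesis by blast
    qed
  qed
  then show ?thesis using TV by (simp add: setup_prog_def wp_Seq wp_Assign)
qed

lemma fill_correct:
  assumes s: "globals s0" "reg s0 6 = n * n" "reg s0 9 = 0"
    and input: "\<And>x y. x < n \<Longrightarrow> y < n \<Longrightarrow> mem s0 (x * n + y) = d (x + 1) (y + 1)"
  shows "wp w m fill (\<lambda>t' s'. t' \<le> t + 400 * (T * Y) + 20 \<and> globals s' \<and> (\<forall>r<9. reg s' r = reg s0 r) \<and>
     table (n * n) 1 s') t s0"
proof -
  define e where "e = less_e rS (times_e (times_e (Const 3) rT) rY)"
  define I :: "nat \<Rightarrow> ram_state \<Rightarrow> bool" where "I t' s \<longleftrightarrow> (\<exists>a. reg s 9 = a \<and> a \<le> 3 * T * Y \<and>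
     (\<forall>r<9. reg s r = reg s0 r) \<and> t' \<le> t + 120 * a \<and> (\<forall>x<n * n. mem s x = mem s0 x) \<and>
     (\<forall>b<a. mem s (n * n + b) = base (b div Y div 3) (b mod Y) (b div Y mod 3)))" for t' s
  have V: "n * n + 3 * T * Y < 2 ^ w" "3 * T * Y < 2 ^ w" "3 * T < 2 ^ w" "T < 2 ^ w" "Y < 2 ^ w" "n * n < 2 ^ w"
    "1 < (2::nat) ^ w" "2 < (2::nat) ^ w" "3 < (2::nat) ^ w" "n < 2 ^ w" "n + 1 < 2 ^ w"
    using base_fits n_le_KB TY_le_KB T_le_TY T4 Y T Y_le_KB by linarith+
  have R: "reg s 0 = n" "reg s 2 = T" "reg s 3 = Y" "reg s 4 = W" "reg s 6 = n * n" if "I t' s" for t' s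
    using s that by (auto simp: I_def globals_def)
  have loop: "wp w m (While e fill_body) (\<lambda>t' s'. t' \<le> t + 400 * (T * Y) + 20 \<and> globals s' \<and> (\<forall>r<9. reg s' r = reg s0 r) \<and>
     table (n * n) 1 s') t s0"
  proof (rule wp_While[where I = I and \<mu> = "\<lambda>s. 3 * T * Y - reg s 9"])
    show "I t s0" using s by (auto simp: I_def)
  next
    fix t' s assume I: "I t' s"
    have "reg s 9 \<le> 3 * T * Y" using I by (auto simp: I_def)
    then have "reg s 9 < 2 ^ w" using V by linarith
    then show "fits w m e s" using R[OF I] V by (simp add: e_def of_bool_def)
  next
    fix t' s assume I: "I t' s" and c: "eval_expr e s = 0"
    then have a: "reg s 9 = 3 * T * Y" "t' \<le> t + 120 * (3 * T * Y)"
      using R[OF I] by (auto simp: I_def e_def)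
    have b: "mem s (n * n + b) = base (b div Y div 3) (b mod Y) (b div Y mod 3)" if "b < 3 * T * Y" for b
      using I a that by (auto simp: I_def)
    \<comment> \<open>Walks of height 1 are single edges, so by \<open>val_one\<close> the stored
      edge costs already form the initial table.\<close>
    have "table (n * n) 1 s" unfolding table_def
    proof (intro allI impI)
      fix z e p assume z: "z * 1 < T" "e \<le> 2 * 1" "p + e < Y"
      then have "z * 3 + e < 3 * T" by auto
      then have "mem s (n * n + ((z * 3 + e) * Y + p)) = base ((z * 3 + e) div 3) p ((z * 3 + e) mod 3)"
        using z b[of "(z * 3 + e) * Y + p"] row_less[of "z * 3 + e" "3 * T" p Y] by simp
      moreover have "(z * 3 + e) div 3 = z" "(z * 3 + e) mod 3 = e" using z by auto
      ultimately show "mem s (n * n + (z * (2 * 1 + 1) + e) * Y + p) = val (z * 1) 1 p (p + e)"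
        using val_one[of e z p] z by (simp add: add.assoc)
    qed
    moreover have "t' + 8 \<le> t + 400 * (T * Y) + 20" using a(2) by simp
    ultimately show "t' + (1 + expr_cost e) \<le> t + 400 * (T * Y) + 20 \<and> globals s \<and> (\<forall>r<9. reg s r = reg s0 r) \<and>
     table (n * n) 1 s"
      using I s globals_cong[of s0 s] by (auto simp: I_def e_def)
  next
    fix t' s assume I: "I t' s" and c: "eval_expr e s \<noteq> 0"
    define a where "a = reg s 9"
    have a: "a < 3 * T * Y" "t' \<le> t + 120 * a" "\<forall>x<n * n. mem s x = mem s0 x" "\<forall>r<9. reg s r = reg s0 r"
      "\<forall>b<a. mem s (n * n + b) = base (b div Y div 3) (b mod Y) (b div Y mod 3)"
      using I c R[OF I] by (auto simp: I_def e_def a_def)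
    define p where "p = a mod Y"
    define r where "r = a div Y"
    define z where "z = r div 3"
    define k where "k = r mod 3"
    define y where "y = (p + k) div 2"
    define x where "x = z + 1 - y"
    have bounds: "p < Y" "r \<le> a" "z \<le> r" "k < 3" "y \<le> p + k" "x \<le> z + 1" "p \<le> a"
      using Y8 by (auto simp: p_def r_def z_def k_def y_def x_def intro: div_le_dividend)
    have rT: "r < 3 * T" using a(1) Y8 by (simp add: r_def less_mult_imp_div_less)
    have pre: "wp w m fill_pre (\<lambda>t'' s'. t'' \<le> t' + 50 \<and> mem s' = mem s \<and> (\<forall>r<10. reg s' r = reg s r) \<and>
        reg s' 13 = k \<and> reg s' 15 = p + k \<and> reg s' 16 = y \<and> reg s' 17 = x) (t' + (1 + expr_cost e)) s"
    proof -
      have "a < 2 ^ w" "p < 2 ^ w" "r < 2 ^ w" "z < 2 ^ w" "k < 2 ^ w" "p + k < 2 ^ w" "y < 2 ^ w" "x < 2 ^ w" "z + 1 < 2 ^ w"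
        using bounds rT V a(1) T_le_TY Y8 base_fits Y_le_KB T4 by linarith+
      moreover have "Suc z - y = x" "reg s 9 = a" "a mod Y = p" "a div Y = r" "r div 3 = z" "r mod 3 = k" "(p + k) div 2 = y"
        by (simp_all add: x_def a_def p_def r_def z_def k_def y_def)
      ultimately show ?thesis using V R[OF I] unfolding fill_pre_def
        by (simp add: wp_simps e_def)
    qed
    have val_ok: "wp w m fill_value (\<lambda>t'' s'. t'' \<le> t' + 100 \<and> mem s' = mem s \<and> (\<forall>r<10. reg s' r = reg s r) \<and>
        reg s' 20 = base z p k) t1 s1"
      if s1: "t1 \<le> t' + 50 \<and> mem s1 = mem s \<and> (\<forall>r<10. reg s1 r = reg s r) \<and>
        reg s1 13 = k \<and> reg s1 15 = p + k \<and> reg s1 16 = y \<and> reg s1 17 = x" for t1 s1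
    proof -
      have R1: "reg s1 13 = k" "reg s1 15 = p + k" "reg s1 16 = y" "reg s1 17 = x" "reg s1 0 = n" "reg s1 4 = W"
        "mem s1 = mem s" "\<forall>r<10. reg s1 r = reg s r"
        using s1 R[OF I] by auto
      define ok where "ok \<longleftrightarrow> even (p + k) \<and> of_bool (k = 0) < x \<and> x + of_bool (k = 2) < y \<and> y < n + 1"
      have base: "base z p k = (if ok then d x y else if k = 1 then 0 else W)"
        unfolding base_def Let_def ok_def y_def[symmetric] x_def[symmetric] by (rule refl)
      have small: "k < 2 ^ w" "p + k < 2 ^ w" "y < 2 ^ w" "x < 2 ^ w" "x + 1 < 2 ^ w" "x - 1 < 2 ^ w" "y - 1 < 2 ^ w" "W < 2 ^ w"
      proof -
        have "1 * W \<le> (T + 1) * W" by (intro mult_right_mono) auto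
        then show "W < 2 ^ w" using inf by linarith
      qed (use bounds rT V T_le_TY Y8 base_fits Y_le_KB T4 in linarith)+
      have test: "fits w m fill_test s1" "eval_expr fill_test s1 \<noteq> 0 \<longleftrightarrow> ok"
      proof -
        have b: "of_bool P < (2::nat) ^ w" for P using V by (cases P) simp_all
        have "x + of_bool (k = 2) < 2 ^ w" "(p + k) mod 2 < 2 ^ w"
          using small mod_less_eq_dividend[of "p + k" 2] by (auto simp: of_bool_def)
        then show "fits w m fill_test s1"
          using V small by (simp add: fill_test_def R1 b of_bool_conj[symmetric])
        show "eval_expr fill_test s1 \<noteq> 0 \<longleftrightarrow> ok"
          unfolding ok_def by (auto simp: fill_test_def R1 even_iff_mod_2_eq_zero)
      qed
      show ?thesis
      proof (cases ok)
        case True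
        \<comment> \<open>Only a successful test leads to the load; the subtractions of 1 are then
          exact and the address lies in the input matrix.\<close>
        then have xy: "1 \<le> x" "x < y" "y \<le> n" by (auto simp: ok_def)
        then have lt: "x - 1 < n" "y - 1 < n" by auto
        then have adr: "(x - 1) * n + (y - 1) < n * n" by (rule row_less)
        have "mem s ((x - 1) * n + (y - 1)) = d x y"
          using input[OF lt] a(3) adr xy by simp
        moreover have "(x - 1) * n + (y - 1) < m" "(x - 1) * n + (y - 1) < 2 ^ w" "(x - 1) * n < 2 ^ w"
          using adr V m n_le_KB by linarith+
        moreover have "d x y < 2 ^ w" using base_le[of z p k] base True small by simp
        ultimately show ?thesis
          using test True s1 small V by (simp add: fill_value_def wp_Cond wp_Assign R1 base) (simp add: fill_test_def)
      next
        case False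
        show ?thesis
          using test False s1 small V by (simp add: fill_value_def wp_Cond wp_Assign R1 base) (simp add: fill_test_def)
      qed
    qed
    show "wp w m fill_body (\<lambda>t' s'. I t' s' \<and> 3 * T * Y - reg s' 9 < 3 * T * Y - reg s 9) (t' + (1 + expr_cost e)) s"
      unfolding fill_body_def wp_Seq
    proof (rule wp_mono[OF pre])
      fix t1 and s1 :: ram_state
      assume s1: "t1 \<le> t' + 50 \<and> mem s1 = mem s \<and> (\<forall>r<10. reg s1 r = reg s r) \<and>
        reg s1 13 = k \<and> reg s1 15 = p + k \<and> reg s1 16 = y \<and> reg s1 17 = x"
      show "wp w m fill_value (wp w m fill_post (\<lambda>t' s'. I t' s' \<and> 3 * T * Y - reg s' 9 < 3 * T * Y - reg s 9)) t1 s1"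
      proof (rule wp_mono[OF val_ok[OF s1]])
        fix t2 and s2 :: ram_state
        assume b: "t2 \<le> t' + 100 \<and> mem s2 = mem s \<and> (\<forall>r<10. reg s2 r = reg s r) \<and> reg s2 20 = base z p k"
        define s3 where "s3 = s2\<lparr>mem := (mem s2)(n * n + a := base z p k), reg := (reg s2)(9 := a + 1)\<rparr>"
        have "I (t2 + 9) s3" using a b unfolding I_def
          by (intro exI[of _ "a + 1"]) (auto simp: s3_def less_Suc_eq z_def p_def k_def r_def)
        moreover have t9: "Suc (Suc (Suc (Suc (Suc (Suc (Suc (Suc (Suc t2)))))))) = t2 + 9" by simp
        moreover have "reg s2 6 = n * n" "reg s2 9 = a" "reg s2 20 = base z p k" using b R[OF I] by (auto simp: a_def)
        moreover have "base z p k < 2 ^ w" "n * n + a < 2 ^ w" "n * n + a < m" "a + 1 < 2 ^ w" "a < 2 ^ w"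
        proof -
          have "1 * W \<le> (T + 1) * W" by (intro mult_right_mono) auto
          then show "base z p k < 2 ^ w" using base_le[of z p k] inf by linarith
          show "n * n + a < 2 ^ w" "n * n + a < m" "a + 1 < 2 ^ w" "a < 2 ^ w" using a V m n_le_KB by linarith+
        qed
        ultimately show "wp w m fill_post (\<lambda>t' s'. I t' s' \<and> 3 * T * Y - reg s' 9 < 3 * T * Y - reg s 9) t2 s2"
          using V a(1) by (simp add: fill_post_def wp_simps s3_def a_def[symmetric] t9 diff_less_mono2)
      qed
    qed
  qed
  then show ?thesis by (simp add: fill_def e_def)
qed

lemma answer_correct:
  assumes s: "globals s0" "reg s0 6 = src" "src + 3 * T * Y \<le> KB" "table src T s0"
  defines "f \<equiv> \<lambda>i. val 0 T i (T + n - i)"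
  shows "wp w m answer (\<lambda>t' s'. t' \<le> t + 100 * n + 50 \<and> 1 \<le> reg s' 0 \<and> reg s' 0 < n \<and>
     reg s' 1 = f (reg s' 0) \<and> (\<forall>j. 1 \<le> j \<longrightarrow> j < n \<longrightarrow> f (reg s' 0) \<le> f j)) t s0"
proof -
  define I :: "nat \<Rightarrow> ram_state \<Rightarrow> bool" where "I t' s \<longleftrightarrow> (\<exists>i. reg s 9 = i \<and> 1 \<le> i \<and> i \<le> n \<and>
     (\<forall>r<9. reg s r = reg s0 r) \<and> mem s = mem s0 \<and> t' \<le> t + 6 + 80 * i \<and>
     (if i = 1 then reg s 10 = (T + 1) * W \<and> reg s 11 = 0
      else 1 \<le> reg s 11 \<and> reg s 11 < i \<and> reg s 10 = f (reg s 11) \<and>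
        (\<forall>j. 1 \<le> j \<longrightarrow> j < i \<longrightarrow> f (reg s 11) \<le> f j)))" for t' s
  have V: "T + n < 2 ^ w" "T < 2 ^ w" "n < 2 ^ w" "2 * n < 2 ^ w" "Y < 2 ^ w" "2 < (2::nat) ^ w" "1 < (2::nat) ^ w" "0 < (2::nat) ^ w"
    using base_fits Y_le_KB Y8 Y T T4 by linarith+
  have R: "reg s 0 = n" "reg s 2 = T" "reg s 3 = Y" "reg s 6 = src" if "I t' s" for t' s
    using s that by (auto simp: I_def globals_def)
  have f_less: "f i < (T + 1) * W" if "i < n" for i
  proof -
    have "f i \<le> T * W" unfolding f_def using that T by (intro val_le) auto
    then show ?thesis using W_pos by simp
  qed
  have loop: "wp w m answer_loop (\<lambda>t' s'. t' \<le> t + 100 * n + 20 \<and> 1 \<le> reg s' 11 \<and> reg s' 11 < n \<and>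
     reg s' 10 = f (reg s' 11) \<and> (\<forall>j. 1 \<le> j \<longrightarrow> j < n \<longrightarrow> f (reg s' 11) \<le> f j)) t1 s1"
    if "I t1 s1" for t1 s1
    using that unfolding answer_loop_def
  proof (rule wp_While[where I = I and \<mu> = "\<lambda>s. n - reg s 9"])
    fix t' s assume I: "I t' s"
    have "reg s 9 \<le> n" using I by (auto simp: I_def)
    then have "reg s 9 < 2 ^ w" using V by linarith
    then show "fits w m (less_e rS rN) s" using R[OF I] V by (simp add: of_bool_def)
  next
    fix t' s assume I: "I t' s" and c: "eval_expr (less_e rS rN) s = 0"
    then have "reg s 9 = n" using R[OF I] by (auto simp: I_def)
    then show "t' + (1 + expr_cost (less_e rS rN)) \<le> t + 100 * n + 20 \<and> 1 \<le> reg s 11 \<and> reg s 11 < n \<and>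
     reg s 10 = f (reg s 11) \<and> (\<forall>j. 1 \<le> j \<longrightarrow> j < n \<longrightarrow> f (reg s 11) \<le> f j)"
      using I n2 by (auto simp: I_def)
  next
    fix t' s assume I: "I t' s" and c: "eval_expr (less_e rS rN) s \<noteq> 0"
    define i where "i = reg s 9"
    have i: "1 \<le> i" "i < n" "t' \<le> t + 6 + 80 * i" "\<forall>r<9. reg s r = reg s0 r" "mem s = mem s0"
      and best: "if i = 1 then reg s 10 = (T + 1) * W \<and> reg s 11 = 0
        else 1 \<le> reg s 11 \<and> reg s 11 < i \<and> reg s 10 = f (reg s 11) \<and>
        (\<forall>j. 1 \<le> j \<longrightarrow> j < i \<longrightarrow> f (reg s 11) \<le> f j)"
      using I c R[OF I] by (auto simp: I_def i_def)
    \<comment> \<open>The column distance of the wanted entry \<open>(i, T + n - i)\<close>, hence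
      its row in the only remaining block.\<close>
    define e where "e = T + n - 2 * i"
    have e: "e \<le> 2 * T" "i + e < Y" "i + e = T + n - i" "e < 3 * T" "i < Y" using i T Y by (auto simp: e_def)
    have cell: "mem s0 (src + e * Y + i) = f i"
      using s(4)[unfolded table_def, rule_format, of 0 e i] e T4 by (simp add: f_def)
    have "e * Y + i < 3 * T * Y" using e by (intro row_less) auto
    then have adr: "src + e * Y + i < m" "src + e * Y + i < 2 ^ w" using s(3) m base_fits by linarith+
    note fits' = address_less[OF adr(2)]
    have small: "f i < 2 ^ w" "i < 2 ^ w" "i + 1 < 2 ^ w" "2 * i < 2 ^ w" "reg s 10 < 2 ^ w" "reg s 11 < 2 ^ w"
    proof -
      show "f i < 2 ^ w" using f_less[OF i(2)] inf by linarith
      show "reg s 10 < 2 ^ w" "reg s 11 < 2 ^ w"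
        using best inf f_less[of "reg s 11"] i V by (auto split: if_splits)
    qed (use i V in linarith)+
    have ob: "wp w m answer_body (\<lambda>t'' s'. t'' \<le> t' + 80 \<and> mem s' = mem s0 \<and> (\<forall>r<9. reg s' r = reg s0 r)
       \<and> reg s' 9 = i + 1 \<and> reg s' 10 = min (f i) (reg s 10) \<and> reg s' 11 = (if f i < reg s 10 then i else reg s 11))
       (t' + (1 + expr_cost (less_e rS rN))) s"
      unfolding answer_body_def using V small adr fits' Y8 i(4)
      by (simp add: wp_simps R[OF I] i_def[symmetric] e_def[symmetric] i(5) cell of_bool_def)
    show "wp w m answer_body (\<lambda>t' s'. I t' s' \<and> n - reg s' 9 < n - reg s 9) (t' + (1 + expr_cost (less_e rS rN))) s"
    proof (rule wp_mono[OF ob])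
      fix t'' and s' :: ram_state
      assume a: "t'' \<le> t' + 80 \<and> mem s' = mem s0 \<and> (\<forall>r<9. reg s' r = reg s0 r)
       \<and> reg s' 9 = i + 1 \<and> reg s' 10 = min (f i) (reg s 10) \<and> reg s' 11 = (if f i < reg s 10 then i else reg s 11)"
      have "1 \<le> reg s' 11 \<and> reg s' 11 < i + 1 \<and> reg s' 10 = f (reg s' 11) \<and>
        (\<forall>j. 1 \<le> j \<longrightarrow> j < i + 1 \<longrightarrow> f (reg s' 11) \<le> f j)"
      proof (cases "i = 1")
        case True
        then show ?thesis using a best f_less[OF i(2)] by (auto simp: less_Suc_eq)
      next
        case False
        then show ?thesis using a best i by (auto simp: less_Suc_eq intro: order_trans less_imp_le)
      qed
      then show "I t'' s' \<and> n - reg s' 9 < n - reg s 9"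
        using a i by (auto simp: I_def i_def[symmetric])
    qed
  qed
  define s1 where "s1 = s0\<lparr>reg := (reg s0)(9 := 1, 10 := (T + 1) * W, 11 := 0)\<rparr>"
  have "I (t + 6) s1" using n2 by (auto simp: I_def s1_def)
  from loop[OF this] have "wp w m answer_loop (wp w m (Seq (Assign 0 rB) (Assign 1 rA))
     (\<lambda>t' s'. t' \<le> t + 100 * n + 50 \<and> 1 \<le> reg s' 0 \<and> reg s' 0 < n \<and>
     reg s' 1 = f (reg s' 0) \<and> (\<forall>j. 1 \<le> j \<longrightarrow> j < n \<longrightarrow> f (reg s' 0) \<le> f j))) (t + 6) s1"
  proof (rule wp_mono)
    fix t2 and s2 :: ram_state
    assume a: "t2 \<le> t + 100 * n + 20 \<and> 1 \<le> reg s2 11 \<and> reg s2 11 < n \<and>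
     reg s2 10 = f (reg s2 11) \<and> (\<forall>j. 1 \<le> j \<longrightarrow> j < n \<longrightarrow> f (reg s2 11) \<le> f j)"
    then have "reg s2 11 < 2 ^ w" "f (reg s2 11) < 2 ^ w" using V f_less[of "reg s2 11"] inf by linarith+
    then show "wp w m (Seq (Assign 0 rB) (Assign 1 rA))
     (\<lambda>t' s'. t' \<le> t + 100 * n + 50 \<and> 1 \<le> reg s' 0 \<and> reg s' 0 < n \<and>
     reg s' 1 = f (reg s' 0) \<and> (\<forall>j. 1 \<le> j \<longrightarrow> j < n \<longrightarrow> f (reg s' 0) \<le> f j)) t2 s2"
      using a by (simp add: wp_simps)
  qed
  moreover have t6: "Suc (Suc (Suc (Suc (Suc (Suc t))))) = t + 6" by simp
  moreover have "reg s0 (Suc 0) = (T + 1) * W" using s(1) by (simp add: globals_def)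
  ultimately show ?thesis using V inf by (simp add: answer_def wp_Seq wp_Assign s1_def t6)
qed

lemma program_correct:
  assumes r: "reg s0 0 = n" and L: "T = 2 ^ L" "\<And>j. 2 * n \<le> 2 ^ j \<Longrightarrow> L \<le> j"
    and input: "\<And>x y. x < n \<Longrightarrow> y < n \<Longrightarrow> mem s0 (x * n + y) = d (x + 1) (y + 1)"
  shows "\<exists>t s. exec w m (sqrt_dtw_prog c) s0 t s \<and> t \<le> 5000 * T ^ 2 * (L + 1) \<and>
     1 \<le> reg s 0 \<and> reg s 0 < n \<and> reg s 1 = val 0 T (reg s 0) (T + n - reg s 0) \<and>
     (\<forall>j. 1 \<le> j \<longrightarrow> j < n \<longrightarrow> reg s 1 \<le> val 0 T j (T + n - j))"
proof -
  have "wp w m (sqrt_dtw_prog c) (\<lambda>t s. t \<le> 5000 * T ^ 2 * (L + 1) \<and>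
     1 \<le> reg s 0 \<and> reg s 0 < n \<and> reg s 1 = val 0 T (reg s 0) (T + n - reg s 0) \<and>
     (\<forall>j. 1 \<le> j \<longrightarrow> j < n \<longrightarrow> reg s 1 \<le> val 0 T j (T + n - j))) 0 s0"
    unfolding sqrt_dtw_prog_def wp_Seq
  proof (rule wp_mono[OF setup_correct[OF r L]])
    fix t1 and s1 :: ram_state
    assume 1: "t1 \<le> 0 + 10 * T + 100 \<and> mem s1 = mem s0 \<and> globals s1 \<and>
     reg s1 5 = 1 \<and> reg s1 6 = n * n \<and> reg s1 7 = n * n + 3 * T * Y \<and> reg s1 9 = 0"
    show "wp w m fill (wp w m levels (wp w m answer (\<lambda>t s. t \<le> 5000 * T ^ 2 * (L + 1) \<and>
     1 \<le> reg s 0 \<and> reg s 0 < n \<and> reg s 1 = val 0 T (reg s 0) (T + n - reg s 0) \<and>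
     (\<forall>j. 1 \<le> j \<longrightarrow> j < n \<longrightarrow> reg s 1 \<le> val 0 T j (T + n - j))))) t1 s1"
    proof (rule wp_mono[OF fill_correct])
      fix t2 and s2 :: ram_state
      assume 2: "t2 \<le> t1 + 400 * (T * Y) + 20 \<and> globals s2 \<and> (\<forall>r<9. reg s2 r = reg s1 r) \<and> table (n * n) 1 s2"
      show "wp w m levels (wp w m answer (\<lambda>t s. t \<le> 5000 * T ^ 2 * (L + 1) \<and>
         1 \<le> reg s 0 \<and> reg s 0 < n \<and> reg s 1 = val 0 T (reg s 0) (T + n - reg s 0) \<and>
         (\<forall>j. 1 \<le> j \<longrightarrow> j < n \<longrightarrow> reg s 1 \<le> val 0 T j (T + n - j)))) t2 s2"
      proof (rule wp_mono[OF levels_correct])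
        fix t3 and s3 :: ram_state
        assume 3: "t3 \<le> t2 + 1300 * (T * Y) * L + 10 \<and> globals s3 \<and> reg s3 6 + 3 * T * Y \<le> KB \<and> table (reg s3 6) T s3"
        show "wp w m answer (\<lambda>t s. t \<le> 5000 * T ^ 2 * (L + 1) \<and>
         1 \<le> reg s 0 \<and> reg s 0 < n \<and> reg s 1 = val 0 T (reg s 0) (T + n - reg s 0) \<and>
         (\<forall>j. 1 \<le> j \<longrightarrow> j < n \<longrightarrow> reg s 1 \<le> val 0 T j (T + n - j))) t3 s3"
        proof (rule wp_mono[OF answer_correct])
          fix t4 and s4 :: ram_state
          assume 4: "t4 \<le> t3 + 100 * n + 50 \<and> 1 \<le> reg s4 0 \<and> reg s4 0 < n \<and>
            reg s4 1 = val 0 T (reg s4 0) (T + n - reg s4 0) \<and>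
            (\<forall>j. 1 \<le> j \<longrightarrow> j < n \<longrightarrow> val 0 T (reg s4 0) (T + n - reg s4 0) \<le> val 0 T j (T + n - j))"
          \<comment> \<open>Each of the \<open>L\<close> rounds costs a multiple of
            \<open>T * Y\<close>; setting up, filling and reading the answer are absorbed by one
            further summand, hence \<open>L + 1\<close>.\<close>
          have TY: "T * Y = 2 * (T * T)" using Y by simp
          have "4 * T \<le> T * T" using T4 by (intro mult_right_mono) auto
          then have "10 * T + 100 + 400 * (T * Y) + 20 + 10 + 100 * n + 50 \<le> 2400 * (T * T)"
            using TY T T4 by linarith
          moreover have "t4 \<le> 10 * T + 100 + 400 * (T * Y) + 20 + 1300 * (T * Y) * L + 10 + 100 * n + 50"
            using 1 2 3 4 by linarith
          moreover have "1300 * (T * Y) * L = 2600 * (T * T * L)" unfolding TY by simp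
          moreover have "5000 * T ^ 2 * (L + 1) = 5000 * (T * T * L) + 5000 * (T * T)"
            by (simp add: power2_eq_square algebra_simps)
          ultimately have "t4 \<le> 5000 * T ^ 2 * (L + 1)" by linarith
          then show "t4 \<le> 5000 * T ^ 2 * (L + 1) \<and>
           1 \<le> reg s4 0 \<and> reg s4 0 < n \<and> reg s4 1 = val 0 T (reg s4 0) (T + n - reg s4 0) \<and>
           (\<forall>j. 1 \<le> j \<longrightarrow> j < n \<longrightarrow> reg s4 1 \<le> val 0 T j (T + n - j))" using 4 by simp
        qed (use 3 in auto)
      qed (use 1 2 L in auto)
    qed (use 1 input in auto)
  qed
  then show ?thesis unfolding wp_def by auto
qed

end

section \<open>Resource bounds\<close>

definition exponent :: "nat \<Rightarrow> nat" where
  "exponent n = (LEAST j. 2 * n \<le> 2 ^ j)"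

lemma exponent_ge: "2 * n \<le> 2 ^ exponent n"
  unfolding exponent_def by (rule LeastI[of _ "2 * n"]) (rule less_imp_le[OF less_exp])

lemma exponent_le: "2 * n \<le> 2 ^ j \<Longrightarrow> exponent n \<le> j"
  unfolding exponent_def by (rule Least_le)

text \<open>By minimality, half of the power is below \<open>2 * n\<close>. So rounding up to a
  power of two keeps the number of layers linear, as the quadratic space bound requires.\<close>

lemma exponent_less:
  assumes "1 \<le> n"
  shows "2 ^ exponent n < 4 * n"
proof (cases "exponent n")
  case 0
  then show ?thesis using assms by simp
next
  case (Suc j)
  then have "\<not> 2 * n \<le> 2 ^ j" using exponent_le[of n j] by auto
  then show ?thesis using Suc by simp
qed

lemma exponent_le_log:
  assumes "2 \<le> n"
  shows "real (exponent n) \<le> log 2 (real n) + 2"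
proof -
  have "real (2 ^ exponent n) \<le> 4 * real n" using exponent_less[of n] assms by linarith
  then have "2 powr (real (exponent n) - 2) \<le> real n"
    by (simp add: powr_diff powr_realpow)
  then have "real (exponent n) - 2 \<le> log 2 (real n)" using assms by (subst le_log_iff) auto
  then show ?thesis by simp
qed

lemma log_ge_1: "2 \<le> n \<Longrightarrow> 1 \<le> log 2 (real n)"
  by (subst le_log_iff) auto

definition time_bound :: "nat \<Rightarrow> nat" where
  "time_bound n = 5000 * (2 ^ exponent n) ^ 2 * (exponent n + 1)"

text \<open>This is \<open>KB + Y + 2\<close> for \<open>T = 2 ^ exponent n\<close> and
  \<open>Y = 2 * T\<close>.\<close>

definition space_bound :: "nat \<Rightarrow> nat" where
  "space_bound n = n * n + 12 * (2 ^ exponent n) ^ 2 + 2 * 2 ^ exponent n + 2"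

text \<open>Chosen so that \<open>2 ^ w\<close> is \<open>1024 * 2 ^ c * T ^ 2\<close>. The square
  accommodates addresses and accumulated costs, and the \<open>c\<close> extra bits cover the factor
  \<open>c + 1\<close> in \<open>W\<close>.\<close>

definition word_bound :: "nat \<Rightarrow> nat \<Rightarrow> nat" where
  "word_bound c n = 2 * exponent n + c + 10"

lemma time_bound_bigo: "(\<lambda>n. real (time_bound n)) \<in> O(\<lambda>n. real n ^ 2 * log 2 (real n) ^ 2)"
proof (intro bigoI[where c = 320000] eventually_sequentiallyI[where c = 2])
  fix n :: nat
  assume n: "2 \<le> n"
  define l where "l = log 2 (real n)"
  have l: "1 \<le> l" using log_ge_1[OF n] by (simp add: l_def)
  have "real (2 ^ exponent n) \<le> 4 * real n" using exponent_less[of n] n by linarith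
  then have "(real (2 ^ exponent n)) ^ 2 \<le> (4 * real n) ^ 2" by (intro power_mono) auto
  moreover have "real (exponent n) + 1 \<le> 4 * l ^ 2"
  proof -
    \<comment> \<open>The actual time bound has a single logarithm; the second factor is only
      padding.\<close>
    have "l * 1 \<le> l * l" using l by (intro mult_left_mono) auto
    then show ?thesis
      using exponent_le_log[OF n] l unfolding l_def[symmetric] power2_eq_square by linarith
  qed
  ultimately have "5000 * (real (2 ^ exponent n)) ^ 2 * (real (exponent n) + 1) \<le> 5000 * (4 * real n) ^ 2 * (4 * l ^ 2)"
    by (intro mult_mono) auto
  then show "norm (real (time_bound n)) \<le> 320000 * norm (real n ^ 2 * log 2 (real n) ^ 2)"
    by (simp add: time_bound_def l_def power_mult_distrib algebra_simps)
qed

lemma space_bound_bigo: "(\<lambda>n. real (space_bound n)) \<in> O(\<lambda>n. real n ^ 2)"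
proof (intro bigoI[where c = 300] eventually_sequentiallyI[where c = 2])
  fix n :: nat
  assume n: "2 \<le> n"
  have le: "2 ^ exponent n \<le> 4 * n" using exponent_less[of n] n by simp
  then have "(2 ^ exponent n) ^ 2 \<le> (4 * n) ^ 2" by (rule power_mono) simp
  moreover have "n * 2 \<le> n * n" using n by (intro mult_left_mono) auto
  ultimately have "space_bound n \<le> 300 * n ^ 2"
    using le n unfolding space_bound_def power2_eq_square by linarith
  then have "real (space_bound n) \<le> real (300 * n ^ 2)" by (rule of_nat_mono)
  then show "norm (real (space_bound n)) \<le> 300 * norm (real n ^ 2)" by simp
qed

lemma word_bound_bigo: "(\<lambda>n. real (word_bound c n)) \<in> O(\<lambda>n. log 2 (real n))"
proof (intro bigoI[where c = "real c + 16"] eventually_sequentiallyI[where c = 2])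
  fix n :: nat
  assume n: "2 \<le> n"
  have "(real c + 14) * 1 \<le> (real c + 14) * log 2 (real n)"
    using log_ge_1[OF n] by (intro mult_left_mono) auto
  then show "norm (real (word_bound c n)) \<le> (real c + 16) * norm (log 2 (real n))"
    using exponent_le_log[OF n] log_ge_1[OF n] by (simp add: word_bound_def algebra_simps)
qed

lemma word_bound_suffices:
  assumes "2 \<le> n"
  shows "space_bound n \<le> 2 ^ word_bound c n" "(2 ^ exponent n + 1) * ((c + 1) * n) < 2 ^ word_bound c n"
proof -
  define T :: nat where "T = 2 ^ exponent n"
  have T: "2 * n \<le> T" using exponent_ge by (simp add: T_def)
  have w: "2 ^ word_bound c n = 1024 * 2 ^ c * (T * T)"
    unfolding word_bound_def T_def mult_2 power_add by simp
  have c: "c + 1 \<le> 2 ^ c" using less_exp[of c] unfolding Suc_eq_plus1[symmetric] Suc_le_eq .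
  have "n * n \<le> T * T" using T by (intro mult_mono) auto
  moreover have "1 * T \<le> T * T" using T assms by (intro mult_right_mono) auto
  ultimately have "space_bound n \<le> 1024 * 1 * (T * T)"
    using T assms unfolding space_bound_def T_def[symmetric] power2_eq_square by linarith
  also have "\<dots> \<le> 1024 * 2 ^ c * (T * T)" by (intro mult_right_mono mult_left_mono) auto
  finally show "space_bound n \<le> 2 ^ word_bound c n" unfolding w .
  have "(T + 1) * ((c + 1) * n) \<le> (2 * T) * (2 ^ c * T)" using T assms c by (intro mult_mono) auto
  also have "\<dots> = 2 * (2 ^ c * (T * T))" by simp
  also have "\<dots> < 1024 * (2 ^ c * (T * T))" using T assms by (intro mult_strict_right_mono) auto
  finally show "(2 ^ exponent n + 1) * ((c + 1) * n) < 2 ^ word_bound c n" unfolding w T_def[symmetric] by (simp only: mult.assoc)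
qed

theorem theorem4:
  fixes c :: nat
  shows "\<exists>(P :: prog) (T :: nat \<Rightarrow> nat) (S :: nat \<Rightarrow> nat) (w :: nat \<Rightarrow> nat).
    (\<lambda>n. real (T n)) \<in> O(\<lambda>n. real n ^ 2 * log 2 (real n) ^ 2) \<and>
    (\<lambda>n. real (S n)) \<in> O(\<lambda>n. real n ^ 2) \<and>
    (\<lambda>n. real (w n)) \<in> O(\<lambda>n. log 2 (real n)) \<and>
    (\<forall>(A :: 'a list) (d :: dissim).
       2 \<le> length A \<and> (\<forall>i\<in>{1..length A}. \<forall>j\<in>{1..length A}. d i j \<le> c) \<longrightarrow>
       computes_sqrt_dtw (w (length A)) (S (length A)) (T (length A)) P A d)"
proof (rule exI[of _ "sqrt_dtw_prog c"], rule exI[of _ time_bound], rule exI[of _ space_bound],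
    rule exI[of _ "word_bound c"], intro conjI allI impI)
  fix A :: "'a list" and d :: dissim
  assume a: "2 \<le> length A \<and> (\<forall>i\<in>{1..length A}. \<forall>j\<in>{1..length A}. d i j \<le> c)"
  define n where "n = length A"
  define T :: nat where "T = 2 ^ exponent n"
  have n: "2 \<le> n" using a by (simp add: n_def)
  \<comment> \<open>Words and memory are taken exactly as large as the declared bounds;
    \<open>word_bound_suffices\<close> makes all addresses and costs fit.\<close>
  interpret machine n "(c + 1) * n" c d T "2 * T" "n * n + 6 * T * (2 * T)" "word_bound c n" "space_bound n"
    using a n exponent_ge[of n] word_bound_suffices[OF n, of c]
    by unfold_locales (auto simp: n_def[symmetric] T_def[symmetric] space_bound_def power2_eq_square)
  have "\<exists>t s. exec (word_bound c n) (space_bound n) (sqrt_dtw_prog c) (ram_input A d) t s \<and>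
     t \<le> 5000 * T ^ 2 * (exponent n + 1) \<and>
     1 \<le> reg s 0 \<and> reg s 0 < n \<and> reg s 1 = val 0 T (reg s 0) (T + n - reg s 0) \<and>
     (\<forall>j. 1 \<le> j \<longrightarrow> j < n \<longrightarrow> reg s 1 \<le> val 0 T j (T + n - j))"
  proof (rule program_correct[OF _ T_def exponent_le])
    show "reg (ram_input A d) 0 = n" by (simp add: ram_input_def Let_def n_def)
    fix x y assume xy: "x < n" "y < n"
    then have "x * n + y < n * n" by (rule row_less)
    then show "mem (ram_input A d) (x * n + y) = d (x + 1) (y + 1)"
      using xy by (simp add: ram_input_def Let_def n_def[symmetric])
  qed
  then obtain t s where ts: "exec (word_bound c n) (space_bound n) (sqrt_dtw_prog c) (ram_input A d) t s"
    "t \<le> time_bound n" "1 \<le> reg s 0" "reg s 0 < n" "reg s 1 = val 0 T (reg s 0) (T + n - reg s 0)"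
    "\<And>j. 1 \<le> j \<Longrightarrow> j < n \<Longrightarrow> reg s 1 \<le> val 0 T j (T + n - j)"
    unfolding time_bound_def T_def by blast
  \<comment> \<open>The one table entry per split that the program compares is the DTW distance of
    that split, so minimality of the entries becomes minimality over all splits.\<close>
  have split: "split_dtw A d i = val 0 T i (T + n - i)" if "1 \<le> i" "i < n" for i
    using dtw_eq_val[OF that, of T] exponent_ge[of n] unfolding split_dtw_def n_def[symmetric] T_def by simp
  have "sqrt_dtw_solution A d (reg s 0) (reg s 1)"
    unfolding sqrt_dtw_solution_def is_arg_min_linorder n_def[symmetric]
    using ts split by auto
  with ts(1,2) show "computes_sqrt_dtw (word_bound c (length A)) (space_bound (length A)) (time_bound (length A))
      (sqrt_dtw_prog c) A d"
    unfolding computes_sqrt_dtw_def n_def[symmetric] by blast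
qed (rule time_bound_bigo space_bound_bigo word_bound_bigo)+

end
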